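(* Let $\mathbb{K}$ be a field of characteristic zero and let $G_1$, $G_2$ be two graphs (loopless, multiple edges allowed) without isolated vertices. Then $\mathcal{K}_{G_1}$ and $\mathcal{K}_{G_2}$ are isomorphic as filtered algebras if and only if $G_1$ and $G_2$ are isomorphic graphs.
   Context: For a graph $G$ on vertex set $\{0,\dots,n\}$: $\Phi_G$ is the commutative $\mathbb{K}$-algebra generated by $\phi_e$ ($e$ an edge of $G$) with relations $\phi_e^2=0$. For a vertex $i$ and edge $e$: $c_{i,e}=1$ if $e$ joins $i$ to $j$ with $i<j$, $c_{i,e}=-1$ if $e$ joins $i$ to $j$ with $i>j$, $c_{i,e}=0$ otherwise. $X_i=\sum_e c_{i,e}\phi_e$, $Y_i=\exp(X_i)=\prod_e(1+c_{i,e}\phi_e)$. $\mathcal{K}_G$ is the subalgebra of $\Phi_G$ generated by $1,Y_0,\dots,Y_n$, filtered by letting the $k$-th piece be the span of all products of at most $k$ of the $Y_i$ (empty product $1$). A filtered isomorphism is an algebra isomorphism mapping the $k$-th piece onto the $k$-th piece for every $k$. An isolated vertex is one incident to no edge. Graph isomorphism means a vertex bijection preserving the number of edges between each pair of vertices. *)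

theory Defs
  imports "HOL-Algebra.QuotRing" "HOL-Algebra.Module" "HOL-Library.Poly_Mapping"
begin

section \<open>Loopless multigraphs on the vertex set \<open>{0..n}\<close>\<close>

record 'e mgraph =
  top_vertex :: nat
  edges :: "'e set"
  ends :: "'e \<Rightarrow> nat set"

definition vertices :: "'e mgraph \<Rightarrow> nat set" where
  "vertices G = {0..top_vertex G}"

text \<open>Every edge has exactly two distinct endpoints, so loops are excluded; distinct
  elements of \<open>edges G\<close> may have the same endpoints.\<close>

definition loopless_multigraph :: "'e mgraph \<Rightarrow> bool" where
  "loopless_multigraph G \<longleftrightarrow>
     finite (edges G) \<and> (\<forall>e\<in>edges G. ends G e \<subseteq> vertices G \<and> card (ends G e) = 2)"

definition isolated :: "'e mgraph \<Rightarrow> nat \<Rightarrow> bool" where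
  "isolated G i \<longleftrightarrow> i \<in> vertices G \<and> (\<forall>e\<in>edges G. i \<notin> ends G e)"

definition edge_count :: "'e mgraph \<Rightarrow> nat \<Rightarrow> nat \<Rightarrow> nat" where
  "edge_count G i j = card {e \<in> edges G. ends G e = {i, j}}"

definition graph_isomorphic :: "'e mgraph \<Rightarrow> 'f mgraph \<Rightarrow> bool" where
  "graph_isomorphic G H \<longleftrightarrow>
     (\<exists>\<pi>. bij_betw \<pi> (vertices G) (vertices H) \<and>
          (\<forall>i\<in>vertices G. \<forall>j\<in>vertices G. edge_count H (\<pi> i) (\<pi> j) = edge_count G i j))"


section \<open>Algebras over a field, generated subalgebras, filtered isomorphisms\<close>

text \<open>The base field is a type \<open>'k\<close> of class \<open>field\<close>; an algebra over it is a record
  \<open>('k, 'a) module\<close>, which carries ring operations and a scalar multiplication.\<close>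

definition base_field :: "'k::field ring" where
  "base_field = \<lparr>carrier = UNIV, mult = (*), one = 1, zero = 0, add = (+)\<rparr>"

inductive_set lin_span :: "('k, 'a, 'm) module_scheme \<Rightarrow> 'a set \<Rightarrow> 'a set"
  for A (structure) and S where
    zero: "\<zero> \<in> lin_span A S"
  | base: "x \<in> S \<Longrightarrow> x \<in> lin_span A S"
  | add: "x \<in> lin_span A S \<Longrightarrow> y \<in> lin_span A S \<Longrightarrow> x \<oplus> y \<in> lin_span A S"
  | smult: "x \<in> lin_span A S \<Longrightarrow> c \<odot> x \<in> lin_span A S"

inductive_set gen_subalgebra :: "('k, 'a, 'm) module_scheme \<Rightarrow> 'a set \<Rightarrow> 'a set"
  for A (structure) and S where
    one: "\<one> \<in> gen_subalgebra A S"
  | base: "x \<in> S \<Longrightarrow> x \<in> gen_subalgebra A S"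
  | add: "x \<in> gen_subalgebra A S \<Longrightarrow> y \<in> gen_subalgebra A S \<Longrightarrow> x \<oplus> y \<in> gen_subalgebra A S"
  | mult: "x \<in> gen_subalgebra A S \<Longrightarrow> y \<in> gen_subalgebra A S \<Longrightarrow> x \<otimes> y \<in> gen_subalgebra A S"
  | smult: "x \<in> gen_subalgebra A S \<Longrightarrow> c \<odot> x \<in> gen_subalgebra A S"

definition algebra_iso :: "('k, 'a, 'm) module_scheme \<Rightarrow> ('k, 'b, 'n) module_scheme \<Rightarrow> ('a \<Rightarrow> 'b) set" where
  "algebra_iso A B =
     {f \<in> ring_iso A B. \<forall>c. \<forall>x\<in>carrier A. f (c \<odot>\<^bsub>A\<^esub> x) = c \<odot>\<^bsub>B\<^esub> f x}"

definition filtered_isomorphic ::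
  "('k, 'a, 'm) module_scheme \<Rightarrow> (nat \<Rightarrow> 'a set) \<Rightarrow> ('k, 'b, 'n) module_scheme \<Rightarrow> (nat \<Rightarrow> 'b set) \<Rightarrow> bool" where
  "filtered_isomorphic A F B H \<longleftrightarrow> (\<exists>f\<in>algebra_iso A B. \<forall>k. f ` F k = H k)"


section \<open>The algebra \<open>\<Phi>\<^sub>G\<close>\<close>

text \<open>A multivariate polynomial is a finitely supported map from monomials, themselves
  finitely supported exponent maps, to coefficients. \<open>poly_ring E\<close> is the ring of
  polynomials in the variables indexed by \<open>E\<close>.\<close>

type_synonym ('e, 'k) mpoly = "('e \<Rightarrow>\<^sub>0 nat) \<Rightarrow>\<^sub>0 'k"

definition Const :: "'k \<Rightarrow> ('e, 'k::field) mpoly" where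
  "Const c = Poly_Mapping.single 0 c"

definition Var :: "'e \<Rightarrow> ('e, 'k::field) mpoly" where
  "Var e = Poly_Mapping.single (Poly_Mapping.single e 1) 1"

definition poly_ring :: "'e set \<Rightarrow> ('e, 'k::field) mpoly ring" where
  "poly_ring E =
     \<lparr>carrier = {p. \<forall>m\<in>Poly_Mapping.keys p. Poly_Mapping.keys m \<subseteq> E},
      mult = (*), one = 1, zero = 0, add = (+)\<rparr>"

definition square_ideal :: "'e set \<Rightarrow> ('e, 'k::field) mpoly set" where
  "square_ideal E = genideal (poly_ring E) ((\<lambda>e. Var e * Var e) ` E)"

definition coset_of :: "'e set \<Rightarrow> ('e, 'k::field) mpoly \<Rightarrow> ('e, 'k) mpoly set" where
  "coset_of E p = square_ideal E +>\<^bsub>poly_ring E\<^esub> p"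

definition Phi :: "'e mgraph \<Rightarrow> ('k::field, ('e, 'k) mpoly set) module" where
  "Phi G =
     ring.extend (poly_ring (edges G) Quot square_ideal (edges G))
       (module.fields (\<lambda>c x. coset_of (edges G) (Const c)
                         \<otimes>\<^bsub>poly_ring (edges G) Quot square_ideal (edges G)\<^esub> x))"

definition phi :: "'e mgraph \<Rightarrow> 'e \<Rightarrow> ('e, 'k::field) mpoly set" where
  "phi G e = coset_of (edges G) (Var e)"


section \<open>The filtered algebra \<open>\<K>\<^sub>G\<close>\<close>

definition incidence :: "'e mgraph \<Rightarrow> nat \<Rightarrow> 'e \<Rightarrow> 'k::field" where
  "incidence G i e =
     (if \<exists>j. ends G e = {i, j} \<and> i < j then 1
      else if \<exists>j. ends G e = {i, j} \<and> i > j then - 1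
      else 0)"

text \<open>With \<open>X\<^sub>i = (\<Sum>e. c\<^sub>i\<^sub>e \<phi>\<^sub>e)\<close>, the product below is \<open>exp X\<^sub>i\<close>, since \<open>\<phi>\<^sub>e\<^sup>2 = 0\<close> gives
  \<open>exp (c\<^sub>i\<^sub>e \<phi>\<^sub>e) = 1 + c\<^sub>i\<^sub>e \<phi>\<^sub>e\<close>.\<close>

definition Y :: "'e mgraph \<Rightarrow> nat \<Rightarrow> ('e, 'k::field) mpoly set" where
  "Y G i = (\<Otimes>\<^bsub>Phi G\<^esub>e\<in>edges G. \<one>\<^bsub>Phi G\<^esub> \<oplus>\<^bsub>Phi G\<^esub> incidence G i e \<odot>\<^bsub>Phi G\<^esub> phi G e)"

definition K_alg :: "'e mgraph \<Rightarrow> ('k::field, ('e, 'k) mpoly set) module" where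
  "K_alg G = (Phi G)\<lparr>carrier := gen_subalgebra (Phi G) (Y G ` vertices G)\<rparr>"

text \<open>A list of vertices, repetitions allowed, indexes a product of the \<open>Y\<^sub>i\<close>.\<close>

definition Y_prod :: "'e mgraph \<Rightarrow> nat list \<Rightarrow> ('e, 'k::field) mpoly set" where
  "Y_prod G is = foldr (\<lambda>i x. Y G i \<otimes>\<^bsub>Phi G\<^esub> x) is \<one>\<^bsub>Phi G\<^esub>"

definition K_filt :: "'e mgraph \<Rightarrow> nat \<Rightarrow> ('e, 'k::field) mpoly set set" where
  "K_filt G k = lin_span (Phi G) {Y_prod G is | is. set is \<subseteq> vertices G \<and> length is \<le> k}"


section \<open>Well-formedness\<close>

lemma cring_base_field: "cring (base_field :: 'k::field ring)"
proof (rule cringI)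
  show "abelian_group (base_field :: 'k ring)"
  proof (rule abelian_groupI)
    fix x :: 'k
    show "\<exists>y\<in>carrier base_field. y \<oplus>\<^bsub>base_field\<^esub> x = \<zero>\<^bsub>base_field\<^esub>"
      by (intro bexI[of _ "- x"]) (simp_all add: base_field_def)
  qed (simp_all add: base_field_def algebra_simps)
  show "Group.comm_monoid (base_field :: 'k ring)"
    by (rule comm_monoidI) (simp_all add: base_field_def algebra_simps)
qed (simp_all add: base_field_def algebra_simps)

lemma poly_ring_simps:
  "mult (poly_ring E) = (*)" "one (poly_ring E) = 1"
  "zero (poly_ring E) = 0" "add (poly_ring E) = (+)"
  by (simp_all add: poly_ring_def)

lemma cring_poly_ring: "cring (poly_ring E :: ('e, 'k::field) mpoly ring)"
proof (rule cringI)
  have add: "p + q \<in> carrier (poly_ring E)"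
    if "p \<in> carrier (poly_ring E)" "q \<in> carrier (poly_ring E)" for p q :: "('e, 'k) mpoly"
    using that Poly_Mapping.keys_add[of p q] unfolding poly_ring_def by simp blast
  have mult: "p * q \<in> carrier (poly_ring E)"
    if "p \<in> carrier (poly_ring E)" "q \<in> carrier (poly_ring E)" for p q :: "('e, 'k) mpoly"
  proof -
    note pq = that
    have "Poly_Mapping.keys m \<subseteq> E" if m: "m \<in> Poly_Mapping.keys (p * q)" for m
    proof -
      obtain a b where ab: "m = a + b" "a \<in> Poly_Mapping.keys p" "b \<in> Poly_Mapping.keys q"
        using keys_mult[of p q] m by blast
      then have "Poly_Mapping.keys a \<subseteq> E" "Poly_Mapping.keys b \<subseteq> E"
        using pq by (simp_all add: poly_ring_def)
      then show ?thesis
        using Poly_Mapping.keys_add[of a b] ab(1) by blast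
    qed
    then show ?thesis by (simp add: poly_ring_def)
  qed
  show "abelian_group (poly_ring E :: ('e, 'k) mpoly ring)"
  proof (rule abelian_groupI)
    fix p :: "('e, 'k) mpoly" assume "p \<in> carrier (poly_ring E)"
    then show "\<exists>q\<in>carrier (poly_ring E). q \<oplus>\<^bsub>poly_ring E\<^esub> p = \<zero>\<^bsub>poly_ring E\<^esub>"
      by (intro bexI[of _ "- p"]) (simp_all add: poly_ring_def)
  qed (simp_all add: poly_ring_simps add ac_simps, simp add: poly_ring_def)
  show "Group.comm_monoid (poly_ring E :: ('e, 'k) mpoly ring)"
    by (rule comm_monoidI) (simp_all add: poly_ring_simps mult ac_simps, simp add: poly_ring_def)
qed (simp add: poly_ring_simps distrib_right)

lemma Const_in_carrier: "Const c \<in> carrier (poly_ring E)"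
  by (simp add: Const_def poly_ring_def)

lemma Var_in_carrier: "e \<in> E \<Longrightarrow> Var e \<in> carrier (poly_ring E)"
  by (simp add: Var_def poly_ring_def)

lemma ideal_square_ideal: "ideal (square_ideal E) (poly_ring E :: ('e, 'k::field) mpoly ring)"
proof -
  interpret cring "poly_ring E :: ('e, 'k) mpoly ring" by (rule cring_poly_ring)
  have "Var e * Var e \<in> carrier (poly_ring E :: ('e, 'k) mpoly ring)" if "e \<in> E" for e
    using m_closed[OF Var_in_carrier[OF that] Var_in_carrier[OF that]] by (simp add: poly_ring_simps)
  then show ?thesis unfolding square_ideal_def by (intro genideal_ideal) auto
qed

lemma algebra_Phi: "algebra base_field (Phi G :: ('k::field, ('e, 'k) mpoly set) module)"
proof -
  let ?P = "poly_ring (edges G) :: ('e, 'k) mpoly ring"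
  let ?I = "square_ideal (edges G) :: ('e, 'k) mpoly set"
  let ?c = "\<lambda>c. coset_of (edges G) (Const c) :: ('e, 'k) mpoly set"
  interpret P: cring ?P by (rule cring_poly_ring)
  interpret I: ideal ?I ?P by (rule ideal_square_ideal)
  interpret Q: cring "?P Quot ?I" by (rule I.quotient_is_cring) (rule cring_poly_ring)
  have hom: "(+>\<^bsub>?P\<^esub>) ?I \<in> ring_hom ?P (?P Quot ?I)"
    by (rule I.rcos_ring_hom)
  have cc: "?c a \<in> carrier (?P Quot ?I)" for a
    using ring_hom_closed[OF hom Const_in_carrier] by (simp add: coset_of_def)
  have cadd: "?c (a + b) = ?c a \<oplus>\<^bsub>?P Quot ?I\<^esub> ?c b" for a b
    using ring_hom_add[OF hom Const_in_carrier[of a] Const_in_carrier[of b]]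
    by (simp add: coset_of_def poly_ring_simps Const_def single_add)
  have cmul: "?c (a * b) = ?c a \<otimes>\<^bsub>?P Quot ?I\<^esub> ?c b" for a b
    using ring_hom_mult[OF hom Const_in_carrier[of a] Const_in_carrier[of b]]
    by (simp add: coset_of_def poly_ring_simps Const_def mult_single)
  have cone: "?c 1 = \<one>\<^bsub>?P Quot ?I\<^esub>"
    using ring_hom_one[OF hom] by (simp add: coset_of_def poly_ring_simps Const_def)
  have [simp]: "carrier (Phi G) = carrier (?P Quot ?I)" "mult (Phi G) = mult (?P Quot ?I)"
    "one (Phi G) = one (?P Quot ?I)" "zero (Phi G) = zero (?P Quot ?I)"
    "add (Phi G) = add (?P Quot ?I)"
    "smult (Phi G) = (\<lambda>c x. ?c c \<otimes>\<^bsub>?P Quot ?I\<^esub> x)"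
    by (simp_all add: Phi_def ring.extend_def module.fields_def)
  have crPhi: "cring (Phi G :: ('k, ('e, 'k) mpoly set) module)"
  proof (rule cringI)
    show "abelian_group (Phi G :: ('k, ('e, 'k) mpoly set) module)"
    proof (rule abelian_groupI)
      fix x :: "('e, 'k) mpoly set" assume "x \<in> carrier (Phi G)"
      then show "\<exists>y\<in>carrier (Phi G). y \<oplus>\<^bsub>Phi G\<^esub> x = \<zero>\<^bsub>Phi G\<^esub>"
        by (intro bexI[of _ "\<ominus>\<^bsub>?P Quot ?I\<^esub> x"]) (simp_all add: Q.l_neg)
    qed (simp_all add: Q.a_ac)
    show "Group.comm_monoid (Phi G :: ('k, ('e, 'k) mpoly set) module)"
      by (rule comm_monoidI) (simp_all add: Q.m_ac)
  qed (simp add: Q.l_distr)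
  show ?thesis
    by (rule algebraI[OF cring_base_field crPhi])
       (simp_all add: cc cadd cmul cone base_field_def Q.l_distr Q.r_distr Q.m_assoc)
qed

end

theory Submission
  imports Defs
begin

text \<open>Write \<open>V\<close> for the nilpotent elements \<open>\<Sum>\<^sub>i a\<^sub>i (Y\<^sub>i - 1)\<close> of the first filtration
  piece; a filtered isomorphism restricts to a linear bijection of the spaces \<open>V\<close> that preserves
  the vanishing of products. The linear part of such an element has the coefficient \<open>a\<^sub>i - a\<^sub>j\<close> at an
  edge between \<open>i < j\<close>, so with \<open>n\<close> edges \<open>v\<^sup>n\<close> is \<open>n!\<close> times the product of these differences.
  Hence the hyperplanes \<open>a\<^sub>i = a\<^sub>j\<close> of adjacent pairs are intrinsic, their multiplicities are read
  off from products \<open>R\<^bsup>n-k\<^esup> T\<^sup>k\<close> with \<open>R\<close> on the hyperplane, and triangles are the triples of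
  hyperplanes whose intersection has codimension two. For two classes of parallel edges \<open>e\<close>, \<open>f\<close> of sizes \<open>m\<close>, \<open>m'\<close> that
  lie in no triangle, a product of \<open>n - 1\<close> elements, namely \<open>n - m - m' + 1\<close> on both hyperplanes,
  \<open>m - 1\<close> on that of \<open>f\<close> and \<open>m' - 1\<close> on that of \<open>e\<close>, involves the quadratic part of exactly one
  factor, and it can be nonzero if and only if the classes share a vertex. Thus the line graph
  with its triangles and multiplicities is determined, and with it the graph.
  Conversely, a graph isomorphism acts on the generators \<open>\<phi>\<^sub>e\<close> up to signs.\<close>

section \<open>The square-free algebra\<close>

text \<open>Linear parts alone cannot suffice: all simple forests with n edges give n independent
  hyperplanes of multiplicity one, which do not show which edges meet. Vertices first appear in
  degree two, through the squares of the linear parts of the \<open>Y\<^sub>i\<close>. To isolate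
  them, the linear term has to die in the power taken: an element on both hyperplanes has a linear
  part in n - m - m' variables, so its power n - m - m' + 1 loses the pure linear term and keeps one
  quadratic factor. If a third class closes a triangle, the coefficients there vanish too and the
  product is always 0, but the triangle itself then shows that the classes meet. Triangles also
  matter in the last step, because a triangle and a star with three edges have the same line graph.
  An isomorphism is not assumed to respect constant terms; nilpotency, which amounts to constant
  term 0, is what makes V intrinsic. Characteristic zero enters twice: factorials are nonzero, and a
  space is not covered by finitely many hyperplanes. Cosets of polynomials are replaced by
  coefficient functions on edge sets.\<close>

typedef (overloaded) ('e, 'k::zero) sqfree = "{f :: 'e set \<Rightarrow> 'k. \<forall>S. infinite S \<longrightarrow> f S = 0}"
  morphisms coeff Sqfree
  by (rule exI[of _ "\<lambda>_. 0"]) simp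

setup_lifting type_definition_sqfree

lemma coeff_infinite: "infinite S \<Longrightarrow> coeff x S = 0"
  using coeff[of x] by simp

text \<open>Values at infinite sets are forced to be 0: the convolution is a sum over
  \<open>Pow S\<close>, which is 0 by convention for infinite \<open>S\<close>, so the unit law
  would otherwise fail there.\<close>

lemma sqfree_eqI: "(\<And>S. finite S \<Longrightarrow> coeff x S = coeff y S) \<Longrightarrow> x = y"
  by (metis coeff_inject coeff_infinite ext)

text \<open>Both sides run over the ordered partitions of \<open>S\<close> into three parts: a pair
  \<open>B \<subseteq> A\<close> encodes \<open>B\<close>, \<open>A - B\<close>,
  \<open>S - A\<close>, and a disjoint pair \<open>B\<close>, \<open>C\<close> encodes
  \<open>B\<close>, \<open>C\<close>, \<open>S - B - C\<close>.\<close>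

lemma subset_convolution_assoc:
  fixes f g h :: "'e set \<Rightarrow> 'k::comm_ring_1"
  assumes "finite S"
  shows "(\<Sum>A\<in>Pow S. (\<Sum>B\<in>Pow A. f B * g (A - B)) * h (S - A))
       = (\<Sum>B\<in>Pow S. f B * (\<Sum>C\<in>Pow (S - B). g C * h (S - B - C)))"
proof -
  have fin: "\<forall>A\<in>Pow S. finite (Pow A)" "\<forall>B\<in>Pow S. finite (Pow (S - B))"
    using assms finite_subset by auto
  have "(\<Sum>A\<in>Pow S. (\<Sum>B\<in>Pow A. f B * g (A - B)) * h (S - A))
      = (\<Sum>(A, B)\<in>(SIGMA A:Pow S. Pow A). f B * g (A - B) * h (S - A))"
    using assms fin by (simp add: sum.Sigma sum_distrib_right)
  also have "\<dots> = (\<Sum>(B, C)\<in>(SIGMA B:Pow S. Pow (S - B)). f B * (g C * h (S - B - C)))"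
  proof (rule sum.reindex_bij_witness[where i = "\<lambda>(B, C). (B \<union> C, B)" and j = "\<lambda>(A, B). (B, A - B)"],
         goal_cases)
    case (5 a)
    obtain A B where a: "a = (A, B)" by (cases a)
    with 5 have "S - B - (A - B) = S - A" by auto
    then show ?case by (simp add: a mult.assoc)
  qed (auto simp: Un_absorb1)
  also have "\<dots> = (\<Sum>B\<in>Pow S. f B * (\<Sum>C\<in>Pow (S - B). g C * h (S - B - C)))"
    using assms fin by (simp add: sum.Sigma sum_distrib_left)
  finally show ?thesis .
qed

instantiation sqfree :: (type, comm_ring_1) comm_ring_1
begin

lift_definition zero_sqfree :: "('a, 'b) sqfree" is "\<lambda>_. 0" by simp
lift_definition one_sqfree :: "('a, 'b) sqfree" is "\<lambda>S. if S = {} then 1 else 0" by auto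
lift_definition plus_sqfree :: "('a, 'b) sqfree \<Rightarrow> ('a, 'b) sqfree \<Rightarrow> ('a, 'b) sqfree"
  is "\<lambda>f g S. f S + g S" by simp
lift_definition minus_sqfree :: "('a, 'b) sqfree \<Rightarrow> ('a, 'b) sqfree \<Rightarrow> ('a, 'b) sqfree"
  is "\<lambda>f g S. f S - g S" by simp
lift_definition uminus_sqfree :: "('a, 'b) sqfree \<Rightarrow> ('a, 'b) sqfree"
  is "\<lambda>f S. - f S" by simp
lift_definition times_sqfree :: "('a, 'b) sqfree \<Rightarrow> ('a, 'b) sqfree \<Rightarrow> ('a, 'b) sqfree"
  is "\<lambda>f g S. \<Sum>A\<in>Pow S. f A * g (S - A)" by (simp add: finite_Pow_iff)

instance
proof
  fix a b c :: "('a, 'b) sqfree"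
  show "a * b * c = a * (b * c)"
    by (rule sqfree_eqI) (simp add: times_sqfree.rep_eq subset_convolution_assoc)
  show "a * b = b * a"
  proof (rule sqfree_eqI)
    fix S :: "'a set"
    show "coeff (a * b) S = coeff (b * a) S"
      unfolding times_sqfree.rep_eq
      by (rule sum.reindex_bij_witness[where i = "\<lambda>A. S - A" and j = "\<lambda>A. S - A"])
         (auto simp: double_diff mult.commute)
  qed
  show "1 * a = a"
  proof (rule sqfree_eqI)
    fix S :: "'a set" assume S: "finite S"
    have "coeff (1 * a) S = (\<Sum>A\<in>Pow S. if A = {} then coeff a S else 0)"
      unfolding times_sqfree.rep_eq one_sqfree.rep_eq by (rule sum.cong) auto
    then show "coeff (1 * a) S = coeff a S" using S by simp
  qed
  show "(a + b) * c = a * c + b * c"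
    by (rule sqfree_eqI) (simp add: times_sqfree.rep_eq plus_sqfree.rep_eq distrib_right sum.distrib)
  show "(0 :: ('a, 'b) sqfree) \<noteq> 1"
    by (metis one_sqfree.rep_eq zero_neq_one zero_sqfree.rep_eq)
qed (simp_all add: sqfree_eqI plus_sqfree.rep_eq minus_sqfree.rep_eq uminus_sqfree.rep_eq
      zero_sqfree.rep_eq add.assoc add.commute)

end

lemmas coeff_simps [simp] = zero_sqfree.rep_eq plus_sqfree.rep_eq minus_sqfree.rep_eq
  uminus_sqfree.rep_eq
lemmas coeff_one = one_sqfree.rep_eq
lemmas coeff_mult = times_sqfree.rep_eq

lemma coeff_sum [simp]: "coeff (\<Sum>i\<in>I. x i) S = (\<Sum>i\<in>I. coeff (x i) S)"
  by (induction I rule: infinite_finite_induct) simp_all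

lemma coeff_mult_empty [simp]: "coeff (x * y) {} = coeff x {} * coeff y {}"
  by (simp add: coeff_mult)

section \<open>Scalars and generators\<close>

lift_definition scalar :: "'k::comm_ring_1 \<Rightarrow> ('e, 'k) sqfree"
  is "\<lambda>c S. if S = {} then c else 0" by auto

lift_definition gen :: "'e \<Rightarrow> ('e, 'k::comm_ring_1) sqfree"
  is "\<lambda>e S. if S = {e} then 1 else 0" by auto

lemma coeff_scalar_mult [simp]: "coeff (scalar c * x) S = c * coeff x S"
proof (cases "finite S")
  case True
  have "coeff (scalar c * x) S = (\<Sum>A\<in>Pow S. if A = {} then c * coeff x S else 0)"
    unfolding coeff_mult scalar.rep_eq by (rule sum.cong) auto
  then show ?thesis using True by simp
qed (simp add: coeff_infinite)

lemma scalar_hom: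
  "scalar (a + b) = scalar a + scalar b" "scalar (a - b) = scalar a - scalar b"
  "scalar (a * b) = scalar a * scalar b" "scalar 0 = 0" "scalar 1 = 1" "scalar (- a) = - scalar a"
  by (rule sqfree_eqI, simp add: scalar.rep_eq coeff_one)+

lemma scalar_power: "scalar a ^ n = scalar (a ^ n)"
  by (induction n) (simp_all add: scalar_hom)

lemma scalar_of_nat: "scalar (of_nat n) = of_nat n"
  by (induction n) (simp_all add: scalar_hom)

lemma scalar_prod: "(\<Prod>i\<in>I. scalar (a i)) = scalar (\<Prod>i\<in>I. a i)"
  by (induction I rule: infinite_finite_induct) (simp_all add: scalar_hom)

lemma coeff_gen_mult:
  "finite S \<Longrightarrow> coeff (gen e * x) S = (if e \<in> S then coeff x (S - {e}) else 0)"
proof -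
  assume S: "finite S"
  have "coeff (gen e * x) S = (\<Sum>A\<in>Pow S. if A = {e} then coeff x (S - {e}) else 0)"
    unfolding coeff_mult gen.rep_eq by (rule sum.cong) auto
  then show ?thesis using S by simp
qed

lemma gen_square: "gen e * gen e = 0"
  by (rule sqfree_eqI) (auto simp: coeff_gen_mult gen.rep_eq)

lemma coeff_prod_gen:
  "finite T \<Longrightarrow> coeff (\<Prod>e\<in>T. gen e) S = (if S = T then 1 else 0)"
proof (induction T arbitrary: S rule: finite_induct)
  case (insert e T)
  show ?case
  proof (cases "finite S")
    case True
    then show ?thesis using insert by (auto simp: coeff_gen_mult)
  next
    case False
    then show ?thesis using insert by (auto simp: coeff_infinite)
  qed
qed (simp add: coeff_one)

section \<open>Support and order of vanishing\<close>

text \<open>The counterpart of using only variables from \<open>E\<close>. For finite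
  \<open>E\<close> it bounds the degree by \<open>card E\<close>, which turns a large order of
  vanishing into equality with 0.\<close>

definition supported :: "'e set \<Rightarrow> ('e, 'k::comm_ring_1) sqfree \<Rightarrow> bool" where
  "supported E x \<longleftrightarrow> (\<forall>S. coeff x S \<noteq> 0 \<longrightarrow> S \<subseteq> E)"

lemma supported_zero: "supported E 0"
  and supported_one: "supported E 1"
  and supported_scalar: "supported E (scalar c)"
  and supported_gen: "e \<in> E \<Longrightarrow> supported E (gen e)"
  and supported_add: "supported E x \<Longrightarrow> supported E y \<Longrightarrow> supported E (x + y)"
  and supported_diff: "supported E x \<Longrightarrow> supported E y \<Longrightarrow> supported E (x - y)"
  by (auto simp: supported_def coeff_one scalar.rep_eq gen.rep_eq split: if_splits)
     (metis add_0 subsetD, metis diff_0 diff_self add.inverse_neutral subsetD)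

lemma supported_mult: "supported E x \<Longrightarrow> supported E y \<Longrightarrow> supported E (x * y)"
  unfolding supported_def
proof (intro allI impI)
  fix S assume E: "\<forall>S. coeff x S \<noteq> 0 \<longrightarrow> S \<subseteq> E" "\<forall>S. coeff y S \<noteq> 0 \<longrightarrow> S \<subseteq> E"
    and nz: "coeff (x * y) S \<noteq> 0"
  then obtain A where "A \<subseteq> S" "coeff x A * coeff y (S - A) \<noteq> 0"
    unfolding coeff_mult by (meson PowD sum.not_neutral_contains_not_neutral)
  then have "A \<subseteq> S" "coeff x A \<noteq> 0" "coeff y (S - A) \<noteq> 0" by auto
  then show "S \<subseteq> E" using E by blast
qed

lemma supported_sum: "(\<And>i. i \<in> I \<Longrightarrow> supported E (x i)) \<Longrightarrow> supported E (\<Sum>i\<in>I. x i)"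
  by (induction I rule: infinite_finite_induct) (simp_all add: supported_zero supported_add)

lemma supported_prod: "(\<And>i. i \<in> I \<Longrightarrow> supported E (x i)) \<Longrightarrow> supported E (\<Prod>i\<in>I. x i)"
  by (induction I rule: infinite_finite_induct) (simp_all add: supported_one supported_mult)

lemma supported_power: "supported E x \<Longrightarrow> supported E (x ^ n)"
  by (induction n) (simp_all add: supported_one supported_mult)

text \<open>These elements form an ideal, and \<open>order_ge k (x - y)\<close> serves as congruence
  modulo terms of degree at least \<open>k\<close>.\<close>

definition order_ge :: "nat \<Rightarrow> ('e, 'k::comm_ring_1) sqfree \<Rightarrow> bool" where
  "order_ge k x \<longleftrightarrow> (\<forall>S. finite S \<longrightarrow> card S < k \<longrightarrow> coeff x S = 0)"

lemma order_ge_0 [simp]: "order_ge 0 x"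
  and order_ge_zero [simp]: "order_ge k 0"
  and order_ge_add: "order_ge k x \<Longrightarrow> order_ge k y \<Longrightarrow> order_ge k (x + y)"
  and order_ge_mono: "order_ge k x \<Longrightarrow> l \<le> k \<Longrightarrow> order_ge l x"
  by (auto simp: order_ge_def)

lemma order_ge_1_iff: "order_ge (Suc 0) x \<longleftrightarrow> coeff x {} = 0"
  by (auto simp: order_ge_def)

lemma order_ge_gen: "order_ge 1 (gen e)"
  by (simp add: order_ge_1_iff gen.rep_eq)

lemma order_ge_mult:
  assumes "order_ge k x" "order_ge l y"
  shows "order_ge (k + l) (x * y)"
  unfolding order_ge_def coeff_mult
proof (intro allI impI sum.neutral ballI)
  fix S A :: "'a set" assume S: "finite S" "card S < k + l" "A \<in> Pow S"
  then have "finite A" "card A + card (S - A) = card S"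
    by (auto simp: finite_subset card_Diff_subset card_mono)
  with S have "card A < k \<or> card (S - A) < l" by linarith
  then show "coeff x A * coeff y (S - A) = 0"
    using assms S \<open>finite A\<close> by (auto simp: order_ge_def)
qed

lemma order_ge_mult_left: "order_ge k x \<Longrightarrow> order_ge k (y * x)"
  using order_ge_mult[of 0 y k x] by simp

lemma order_ge_sum: "(\<And>i. i \<in> I \<Longrightarrow> order_ge k (x i)) \<Longrightarrow> order_ge k (\<Sum>i\<in>I. x i)"
  by (simp add: order_ge_def)

lemma order_ge_power: "order_ge k x \<Longrightarrow> order_ge (n * k) (x ^ n)"
  by (induction n) (simp_all add: order_ge_mult)

lemma order_ge_imp_zero:
  assumes "finite E" "supported E x" "order_ge k x" "card E < k"
  shows "x = 0"
proof (rule sqfree_eqI)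
  fix S :: "'a set" assume "finite S"
  then show "coeff x S = coeff 0 S"
    using assms card_mono[of E S] by (force simp: supported_def order_ge_def)
qed

section \<open>Powers of sums of square-zero elements\<close>

text \<open>Multinomial theorem when all squares vanish: in degree \<open>card F\<close> only the
  term using every element once survives, with coefficient \<open>fact (card F)\<close>. Both claims
  share one induction, because the step for the first uses the vanishing of the next power of the
  smaller sum.\<close>

lemma power_sum_square_zero:
  fixes x :: "'e \<Rightarrow> 'r::comm_ring_1"
  assumes "finite F" "\<And>e. e \<in> F \<Longrightarrow> x e * x e = 0"
  shows "(\<Sum>e\<in>F. x e) ^ card F = of_nat (fact (card F)) * (\<Prod>e\<in>F. x e)
       \<and> (\<Sum>e\<in>F. x e) ^ Suc (card F) = 0"
  using assms
proof (induction F rule: finite_induct)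
  case (insert e F)
  define s where "s = (\<Sum>e\<in>F. x e)"
  have IH: "s ^ card F = of_nat (fact (card F)) * (\<Prod>e\<in>F. x e)" "s ^ Suc (card F) = 0"
    using insert by (auto simp: s_def)
  have sq: "x e * x e = 0" using insert by simp
  \<comment> \<open>Binomial theorem, cut off after the term linear in \<open>x e\<close>. For n = 0
    the truncated exponent \<open>n - 1\<close> meets the factor 0.\<close>
  have pow: "(x e + s) ^ n = s ^ n + of_nat n * x e * s ^ (n - 1)" for n
  proof (induction n)
    case (Suc n)
    have "(x e + s) ^ Suc n = (x e + s) * (s ^ n + of_nat n * x e * s ^ (n - 1))"
      by (simp add: Suc)
    also have "\<dots> = s ^ Suc n + x e * s ^ n + of_nat n * (x e * x e) * s ^ (n - 1)
                    + of_nat n * x e * (s * s ^ (n - 1))"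
      by (simp add: algebra_simps)
    also have "of_nat n * x e * (s * s ^ (n - 1)) = of_nat n * x e * s ^ n"
      by (cases n) simp_all
    finally show ?case by (simp add: sq algebra_simps)
  qed simp
  have "(x e + s) ^ Suc (card F) = of_nat (fact (Suc (card F))) * (x e * (\<Prod>e\<in>F. x e))"
    unfolding pow IH(2) using IH(1) by (simp add: algebra_simps)
  moreover have "(x e + s) ^ Suc (Suc (card F)) = 0"
    unfolding pow using IH(2) by simp
  ultimately show ?case using insert by (simp add: s_def)
qed simp

lemma power_eq_0_mono: "x ^ m = 0 \<Longrightarrow> m \<le> n \<Longrightarrow> x ^ n = (0::'r::comm_ring_1)"
  by (metis le_add_diff_inverse mult_zero_left power_add)

lemma gen_scaled_square: "(scalar a * gen e) * (scalar a * gen e) = 0"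
proof -
  have "(scalar a * gen e) * (scalar a * gen e) = scalar a * scalar a * (gen e * gen e)"
    by (simp only: mult_ac)
  then show ?thesis by (simp add: gen_square)
qed

text \<open>Nonvanishing is always detected in this form: in characteristic zero the scalar vanishes
  exactly if some coefficient \<open>l e\<close> does.\<close>

lemma linear_form_power:
  fixes l :: "'e \<Rightarrow> 'k::field_char_0"
  assumes "finite F"
  shows "(\<Sum>e\<in>F. scalar (l e) * gen e) ^ card F
           = scalar (fact (card F) * (\<Prod>e\<in>F. l e)) * (\<Prod>e\<in>F. gen e)"
    and "card F < n \<Longrightarrow> (\<Sum>e\<in>F. scalar (l e) * gen e) ^ n = 0"
proof -
  note * = power_sum_square_zero[OF assms, of "\<lambda>e. scalar (l e) * gen e", OF gen_scaled_square]
  have f: "scalar (fact (card F)) = (of_nat (fact (card F)) :: ('e, 'k) sqfree)"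
    unfolding scalar_of_nat[symmetric] by simp
  show "(\<Sum>e\<in>F. scalar (l e) * gen e) ^ card F
           = scalar (fact (card F) * (\<Prod>e\<in>F. l e)) * (\<Prod>e\<in>F. gen e)"
    using * by (simp add: prod.distrib scalar_prod scalar_hom f mult.assoc)
  show "(\<Sum>e\<in>F. scalar (l e) * gen e) ^ n = 0" if "card F < n"
    using * power_eq_0_mono[of _ "Suc (card F)" n] that by auto
qed

section \<open>Leading terms of products and powers\<close>

lemma order_ge_mult_diff:
  assumes "order_ge k (x - x')" "order_ge l y" "order_ge m x'" "order_ge n (y - y')"
    "d \<le> k + l" "d \<le> m + n"
  shows "order_ge d (x * y - x' * y')"
proof -
  have "x * y - x' * y' = (x - x') * y + x' * (y - y')" by (simp add: algebra_simps)
  then show ?thesis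
    using order_ge_mono[OF order_ge_mult[OF assms(1,2)] assms(5)]
      order_ge_mono[OF order_ge_mult[OF assms(3,4)] assms(6)] by (simp add: order_ge_add)
qed

lemma order_ge_power_1: "order_ge 1 x \<Longrightarrow> order_ge n (x ^ n)"
  using order_ge_power[of 1 x n] by simp

lemma order_ge_power_diff:
  assumes "order_ge 1 x" "order_ge 1 l" "order_ge 2 (x - l)"
  shows "order_ge (Suc n) (x ^ n - l ^ n)"
proof (induction n)
  case (Suc n)
  show ?case unfolding power_Suc
    by (rule order_ge_mult_diff[OF assms(3) order_ge_power_1[OF assms(1)] assms(2) Suc]) simp_all
qed simp

text \<open>The binomial expansion sorted by degree: \<open>p + 1\<close> for the pure power of
  \<open>L\<close>, \<open>p + 2\<close> for the terms with a single factor \<open>Q\<close>, at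
  least \<open>p + 3\<close> for the rest. It pays off when \<open>L ^ Suc p\<close> is 0, since the
  second term then leads.\<close>

lemma order_ge_power_second_order:
  assumes L: "order_ge 1 L" and Q: "order_ge 2 Q" and C: "order_ge 3 (x - L - Q)"
  shows "order_ge (p + 3) (x ^ Suc p - L ^ Suc p - of_nat (Suc p) * L ^ p * Q)"
proof (induction p)
  case (Suc p)
  define D where "D = x ^ Suc p - L ^ Suc p - of_nat (Suc p) * L ^ p * Q"
  have x1: "order_ge 1 x"
  proof -
    have "x = (x - L - Q) + (L + Q)" by simp
    moreover have "order_ge 1 ((x - L - Q) + (L + Q))"
      by (intro order_ge_add order_ge_mono[OF C] L order_ge_mono[OF Q]) simp_all
    ultimately show ?thesis by simp
  qed
  \<comment> \<open>Each summand on the right has order \<open>p + 4\<close>: as 1 + (p + 3), as 3 +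
    (p + 1), and as 2 + p + 2.\<close>
  have eq: "x ^ Suc (Suc p) - L ^ Suc (Suc p) - of_nat (Suc (Suc p)) * L ^ Suc p * Q
      = x * D + (x - L - Q) * L ^ Suc p + of_nat (Suc p) * ((x - L) * (L ^ p * Q))"
    by (simp add: D_def algebra_simps)
  have D: "order_ge (p + 3) D" using Suc by (simp add: D_def)
  have xL: "order_ge 2 (x - L)"
  proof -
    have "x - L = (x - L - Q) + Q" by simp
    moreover have "order_ge 2 ((x - L - Q) + Q)"
      by (intro order_ge_add order_ge_mono[OF C] Q) simp_all
    ultimately show ?thesis by metis
  qed
  show ?case unfolding eq
  proof (intro order_ge_add)
    show "order_ge (Suc p + 3) (x * D)" using order_ge_mult[OF x1 D] by simp
    show "order_ge (Suc p + 3) ((x - L - Q) * L ^ Suc p)"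
      using order_ge_mult[OF C order_ge_power_1[OF L, of "Suc p"]] by (simp add: add.commute)
    have "order_ge (Suc p + 3) ((x - L) * (L ^ p * Q))"
      using order_ge_mult[OF xL order_ge_mult[OF order_ge_power_1[OF L, of p] Q]]
      by (rule order_ge_mono) simp
    then show "order_ge (Suc p + 3) (of_nat (Suc p) * ((x - L) * (L ^ p * Q)))"
      by (rule order_ge_mult_left)
  qed
qed (use C in simp)

section \<open>Realizing the algebra by square-free coefficients\<close>

definition sqmono :: "'e set \<Rightarrow> 'e \<Rightarrow>\<^sub>0 nat" where
  "sqmono S = (\<Sum>e\<in>S. Poly_Mapping.single e 1)"

lemma lookup_sqmono:
  "finite S \<Longrightarrow> Poly_Mapping.lookup (sqmono S) e = (if e \<in> S then 1 else 0)"
  by (simp add: sqmono_def lookup_sum lookup_single when_def)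

lemma keys_sqmono: "finite S \<Longrightarrow> Poly_Mapping.keys (sqmono S) = S"
  by (auto simp: in_keys_iff lookup_sqmono split: if_splits)

lemma poly_mapping_sum_single:
  "p = (\<Sum>m\<in>Poly_Mapping.keys p. Poly_Mapping.single m (Poly_Mapping.lookup p m))"
  by (rule poly_mapping_eqI) (simp add: lookup_sum lookup_single when_def in_keys_iff)

text \<open>The quotient map in coordinates: coefficients of square-free monomials are kept, all
  others are dropped. The test for finiteness is there because \<open>sqmono S\<close> collapses to
  the empty monomial for infinite \<open>S\<close>.\<close>

lift_definition reduce :: "('e, 'k::field) mpoly \<Rightarrow> ('e, 'k) sqfree"
  is "\<lambda>p S. if finite S then Poly_Mapping.lookup p (sqmono S) else 0" by simp

lemma reduce_zero: "reduce 0 = 0"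
  and reduce_add: "reduce (p + q) = reduce p + reduce q"
  and reduce_diff: "reduce (p - q) = reduce p - reduce q"
  by (rule sqfree_eqI, simp add: reduce.rep_eq lookup_add lookup_minus)+

lemma reduce_sum: "reduce (\<Sum>i\<in>I. p i) = (\<Sum>i\<in>I. reduce (p i))"
  by (induction I rule: infinite_finite_induct) (simp_all add: reduce_zero reduce_add)

definition gen_monomial :: "('e \<Rightarrow>\<^sub>0 nat) \<Rightarrow> ('e, 'k::comm_ring_1) sqfree" where
  "gen_monomial m = (\<Prod>e\<in>Poly_Mapping.keys m. gen e ^ Poly_Mapping.lookup m e)"

lemma gen_monomial_superset:
  assumes "finite A" "Poly_Mapping.keys m \<subseteq> A"
  shows "gen_monomial m = (\<Prod>e\<in>A. gen e ^ Poly_Mapping.lookup m e)"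
  unfolding gen_monomial_def
  using assms by (intro prod.mono_neutral_left) (auto simp: in_keys_iff)

lemma gen_monomial_add: "gen_monomial (m + n) = gen_monomial m * gen_monomial n"
proof -
  let ?A = "Poly_Mapping.keys m \<union> Poly_Mapping.keys n"
  have "gen_monomial (m + n) = (\<Prod>e\<in>?A. gen e ^ Poly_Mapping.lookup (m + n) e)"
    using Poly_Mapping.keys_add[of m n] by (intro gen_monomial_superset) auto
  also have "\<dots> = gen_monomial m * gen_monomial n"
    by (simp add: gen_monomial_superset[of ?A] lookup_add power_add prod.distrib)
  finally show ?thesis .
qed

lemma gen_monomial_not_squarefree:
  assumes "2 \<le> Poly_Mapping.lookup m e"
  shows "gen_monomial m = (0 :: ('e, 'k::comm_ring_1) sqfree)"
proof -
  have "gen e ^ 2 = (0 :: ('e, 'k) sqfree)" by (simp add: power2_eq_square gen_square)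
  then have "gen e ^ Poly_Mapping.lookup m e = (0 :: ('e, 'k) sqfree)" using assms power_eq_0_mono by blast
  moreover have "e \<in> Poly_Mapping.keys m" using assms by (simp add: in_keys_iff)
  ultimately show ?thesis unfolding gen_monomial_def by (subst prod.remove[of _ e]) auto
qed

lemma squarefree_monomial_cases:
  obtains "m = sqmono (Poly_Mapping.keys m)" | e where "2 \<le> Poly_Mapping.lookup m e"
proof (cases "\<exists>e. 2 \<le> Poly_Mapping.lookup m e")
  case False
  have "m = sqmono (Poly_Mapping.keys m)"
  proof (rule poly_mapping_eqI)
    fix e
    have "Poly_Mapping.lookup m e = 0 \<or> Poly_Mapping.lookup m e = 1"
      using False by (metis One_nat_def less_2_cases linorder_not_less)
    then show "Poly_Mapping.lookup m e = Poly_Mapping.lookup (sqmono (Poly_Mapping.keys m)) e"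
      by (auto simp: lookup_sqmono in_keys_iff)
  qed
  then show ?thesis using that by blast
qed (use that in blast)

text \<open>Dropping coefficients is the same as evaluating at the generators: a monomial with a
  repeated variable evaluates to 0, a square-free one to the product of its generators.\<close>

lemma reduce_single: "reduce (Poly_Mapping.single m c) = scalar c * gen_monomial m"
proof (rule sqfree_eqI)
  fix S :: "'a set" assume S: "finite S"
  consider "m = sqmono (Poly_Mapping.keys m)" | e where "2 \<le> Poly_Mapping.lookup m e"
    using squarefree_monomial_cases .
  then show "coeff (reduce (Poly_Mapping.single m c)) S = coeff (scalar c * gen_monomial m) S"
  proof cases
    case 1
    then have "Poly_Mapping.lookup m e = 1" if "e \<in> Poly_Mapping.keys m" for e
      using that by (metis finite_keys lookup_sqmono)
    then have "gen_monomial m = (\<Prod>e\<in>Poly_Mapping.keys m. gen e :: ('a, 'b) sqfree)"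
      unfolding gen_monomial_def by simp
    then have "coeff (gen_monomial m :: ('a, 'b) sqfree) S = (if S = Poly_Mapping.keys m then 1 else 0)"
      by (simp add: coeff_prod_gen)
    moreover have "m = sqmono S \<longleftrightarrow> S = Poly_Mapping.keys m"
      using 1 S keys_sqmono by metis
    ultimately show ?thesis using S by (auto simp: reduce.rep_eq lookup_single when_def)
  next
    case 2
    then have "m \<noteq> sqmono S" using S by (auto simp: lookup_sqmono split: if_splits)
    then show ?thesis using 2 S
      by (simp add: reduce.rep_eq lookup_single when_def gen_monomial_not_squarefree)
  qed
qed

text \<open>By bilinearity only monomials matter, and there exponents add.\<close>

lemma reduce_mult: "reduce (p * q) = reduce p * reduce q"
proof -
  have single: "reduce (Poly_Mapping.single m a * Poly_Mapping.single n b)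
      = reduce (Poly_Mapping.single m a) * reduce (Poly_Mapping.single n b)" for m n a b
    by (simp add: mult_single reduce_single gen_monomial_add scalar_hom mult_ac)
  let ?s = "\<lambda>p m. Poly_Mapping.single m (Poly_Mapping.lookup p m)"
  have "reduce (p * q) = reduce ((\<Sum>m\<in>Poly_Mapping.keys p. ?s p m) * (\<Sum>n\<in>Poly_Mapping.keys q. ?s q n))"
    using poly_mapping_sum_single by metis
  also have "\<dots> = reduce (\<Sum>m\<in>Poly_Mapping.keys p. ?s p m) * reduce (\<Sum>n\<in>Poly_Mapping.keys q. ?s q n)"
    by (simp add: sum_product reduce_sum single)
  also have "\<dots> = reduce p * reduce q"
    using poly_mapping_sum_single by metis
  finally show ?thesis .
qed

lemma reduce_Const: "reduce (Const c) = scalar c"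
  by (simp add: Const_def reduce_single gen_monomial_def)

lemma reduce_Var: "reduce (Var e) = gen e"
  by (simp add: Var_def reduce_single gen_monomial_def scalar_hom)

lemma reduce_one: "reduce 1 = 1"
  using reduce_Const[of 1] by (simp add: Const_def scalar_hom)

lemma supported_reduce: "p \<in> carrier (poly_ring E) \<Longrightarrow> supported E (reduce p)"
  unfolding supported_def
proof (intro allI impI)
  fix S assume p: "p \<in> carrier (poly_ring E)" and nz: "coeff (reduce p) S \<noteq> 0"
  then have "finite S" "sqmono S \<in> Poly_Mapping.keys p"
    by (auto simp: reduce.rep_eq in_keys_iff split: if_splits)
  then show "S \<subseteq> E" using p keys_sqmono by (fastforce simp: poly_ring_def)
qed

text \<open>The kernel of \<open>reduce\<close> is an ideal containing the squares of the variables,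
  hence contains the ideal they generate. Conversely, a polynomial in the kernel has no square-free
  monomial, so each of its terms is divisible by the square of a variable.\<close>

lemma square_ideal_eq:
  "square_ideal E = {p \<in> carrier (poly_ring E). reduce p = (0 :: ('e, 'k::field) sqfree)}"
  (is "_ = ?J")
proof
  interpret P: cring "poly_ring E :: ('e, 'k) mpoly ring" by (rule cring_poly_ring)
  interpret I: ideal "square_ideal E" "poly_ring E :: ('e, 'k) mpoly ring"
    by (rule ideal_square_ideal)
  have minus: "\<ominus>\<^bsub>poly_ring E\<^esub> p = - p" if "p \<in> carrier (poly_ring E)" for p :: "('e, 'k) mpoly"
  proof -
    have "- p \<in> carrier (poly_ring E)" using that by (simp add: poly_ring_def)
    then show ?thesis
      using that by (intro P.minus_equality) (simp_all add: poly_ring_simps)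
  qed
  have "ideal ?J (poly_ring E)"
  proof (rule idealI[OF P.ring_axioms])
    show "subgroup ?J (add_monoid (poly_ring E))"
    proof (rule P.add.subgroupI)
      show "?J \<noteq> {}" using P.zero_closed by (auto simp: poly_ring_simps reduce_zero)
      fix p assume p: "p \<in> ?J"
      then show "\<ominus>\<^bsub>poly_ring E\<^esub> p \<in> ?J"
        using P.a_inv_closed[of p] minus[of p] reduce_diff[of 0 p] by (simp add: reduce_zero)
      fix q assume "q \<in> ?J"
      with p show "p \<oplus>\<^bsub>poly_ring E\<^esub> q \<in> ?J"
        using P.a_closed[of p q] by (simp add: poly_ring_simps reduce_add)
    qed auto
    fix p q :: "('e, 'k) mpoly" assume "p \<in> ?J" "q \<in> carrier (poly_ring E)"
    then show "q \<otimes>\<^bsub>poly_ring E\<^esub> p \<in> ?J" "p \<otimes>\<^bsub>poly_ring E\<^esub> q \<in> ?J"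
      using P.m_closed[of p q] P.m_closed[of q p] by (simp_all add: poly_ring_simps reduce_mult)
  qed
  moreover have "(\<lambda>e. Var e * Var e) ` E \<subseteq> ?J"
  proof safe
    fix e assume "e \<in> E"
    then show "Var e * Var e \<in> carrier (poly_ring E :: ('e, 'k) mpoly ring)"
      using P.m_closed[OF Var_in_carrier Var_in_carrier, of e e] by (simp add: poly_ring_simps)
  qed (simp add: reduce_mult reduce_Var gen_square)
  ultimately show "square_ideal E \<subseteq> ?J"
    unfolding square_ideal_def by (rule P.genideal_minimal)
  have sum_in: "(\<Sum>i\<in>A. x i) \<in> square_ideal E"
    if "\<And>i. i \<in> A \<Longrightarrow> x i \<in> square_ideal E" for A and x :: "_ \<Rightarrow> ('e, 'k) mpoly"
    using that
    by (induction A rule: infinite_finite_induct)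
       (use I.zero_closed I.a_closed in \<open>auto simp: poly_ring_simps\<close>)
  show "?J \<subseteq> square_ideal E"
  proof
    fix p assume p: "p \<in> ?J"
    have "(\<Sum>m\<in>Poly_Mapping.keys p. Poly_Mapping.single m (Poly_Mapping.lookup p m)) \<in> square_ideal E"
    proof (rule sum_in)
      fix m assume m: "m \<in> Poly_Mapping.keys p"
      have "m \<noteq> sqmono (Poly_Mapping.keys m)"
      proof
        assume "m = sqmono (Poly_Mapping.keys m)"
        then have "coeff (reduce p) (Poly_Mapping.keys m) = Poly_Mapping.lookup p m"
          by (simp add: reduce.rep_eq)
        with p m show False by (simp add: in_keys_iff)
      qed
      then obtain e where e: "2 \<le> Poly_Mapping.lookup m e"
        using squarefree_monomial_cases by blast
      \<comment> \<open>Splits the square of the variable \<open>e\<close> off the monomial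
        \<open>m\<close>; the exponent of \<open>e\<close> is at least 2, so the truncated
        subtraction is exact.\<close>
      define n where "n = m - Poly_Mapping.single e 2"
      have mn: "m = n + (Poly_Mapping.single e 1 + Poly_Mapping.single e 1)"
        by (rule poly_mapping_eqI)
           (use e in \<open>auto simp: n_def lookup_add lookup_minus lookup_single when_def\<close>)
      have mE: "Poly_Mapping.keys m \<subseteq> E" using p m by (simp add: poly_ring_def)
      then have eE: "e \<in> E" using e by (force simp: in_keys_iff)
      have "Poly_Mapping.keys n \<subseteq> Poly_Mapping.keys m"
        by (auto simp: mn in_keys_iff lookup_add)
      with mE have "Poly_Mapping.single n (Poly_Mapping.lookup p m) \<in> carrier (poly_ring E)"
        by (auto simp: poly_ring_def)
      moreover have "Var e * Var e \<in> (square_ideal E :: ('e, 'k) mpoly set)"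
        unfolding square_ideal_def
        by (rule subsetD[OF P.genideal_self])
           (use eE P.m_closed[OF Var_in_carrier Var_in_carrier] in \<open>auto simp: poly_ring_simps\<close>)
      ultimately have "Poly_Mapping.single n (Poly_Mapping.lookup p m) * (Var e * Var e) \<in> square_ideal E"
        using I.I_l_closed by (simp add: poly_ring_simps)
      then show "Poly_Mapping.single m (Poly_Mapping.lookup p m) \<in> square_ideal E"
        by (subst mn) (simp add: Var_def mult_single)
    qed
    then show "p \<in> square_ideal E" using poly_mapping_sum_single by metis
  qed
qed

lemma coset_of_eq_iff:
  fixes p q :: "('e, 'k::field) mpoly"
  assumes "p \<in> carrier (poly_ring E)" "q \<in> carrier (poly_ring E)"
  shows "coset_of E p = coset_of E q \<longleftrightarrow> reduce p = reduce q"
proof -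
  interpret P: cring "poly_ring E :: ('e, 'k) mpoly ring" by (rule cring_poly_ring)
  interpret I: ideal "square_ideal E" "poly_ring E :: ('e, 'k) mpoly ring"
    by (rule ideal_square_ideal)
  have "p \<ominus>\<^bsub>poly_ring E\<^esub> q = p - q"
  proof -
    have "- q \<in> carrier (poly_ring E)" using assms by (simp add: poly_ring_def)
    then have "\<ominus>\<^bsub>poly_ring E\<^esub> q = - q"
      using assms by (intro P.minus_equality) (simp_all add: poly_ring_simps)
    then show ?thesis by (simp add: a_minus_def poly_ring_simps)
  qed
  moreover have "p \<ominus>\<^bsub>poly_ring E\<^esub> q \<in> carrier (poly_ring E)"
    using assms by (rule P.minus_closed)
  moreover have "p \<in> coset_of E q \<longleftrightarrow> p \<ominus>\<^bsub>poly_ring E\<^esub> q \<in> square_ideal E"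
    unfolding coset_of_def by (rule I.a_rcos_module_minus[OF P.ring_axioms assms(2,1)])
  ultimately have "p \<in> coset_of E q \<longleftrightarrow> reduce p = reduce q"
    unfolding square_ideal_eq by (simp add: reduce_diff)
  moreover have "p \<in> coset_of E p"
    unfolding coset_of_def using assms by (intro I.a_rcos_self)
  moreover have "p \<in> coset_of E q \<Longrightarrow> coset_of E q = coset_of E p"
    unfolding coset_of_def using assms by (intro I.a_repr_independence')
  ultimately show ?thesis by metis
qed

section \<open>Coordinates on the coset algebra\<close>

lemma Phi_simps:
  fixes G :: "'e mgraph"
  defines "Q \<equiv> (poly_ring (edges G) :: ('e, 'k::field) mpoly ring) Quot square_ideal (edges G)"
  shows "carrier (Phi G) = carrier Q" "mult (Phi G) = mult Q" "one (Phi G) = one Q"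
    "zero (Phi G) = zero Q" "add (Phi G) = add Q"
    "smult (Phi G) = (\<lambda>c x. coset_of (edges G) (Const c) \<otimes>\<^bsub>Q\<^esub> x)"
  by (simp_all add: Phi_def ring.extend_def module.fields_def Q_def)

lemma carrier_Phi: "carrier (Phi G) = coset_of (edges G) ` carrier (poly_ring (edges G))"
  by (auto simp: Phi_simps FactRing_def A_RCOSETS_def' coset_of_def)

lemma coset_of_hom:
  fixes G :: "'e mgraph" and p q :: "('e, 'k::field) mpoly"
  assumes "p \<in> carrier (poly_ring (edges G))"
  shows "q \<in> carrier (poly_ring (edges G)) \<Longrightarrow>
      coset_of (edges G) p \<oplus>\<^bsub>Phi G\<^esub> coset_of (edges G) q = coset_of (edges G) (p + q)"
    and "q \<in> carrier (poly_ring (edges G)) \<Longrightarrow>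
      coset_of (edges G) p \<otimes>\<^bsub>Phi G\<^esub> coset_of (edges G) q = coset_of (edges G) (p * q)"
    and "c \<odot>\<^bsub>Phi G\<^esub> coset_of (edges G) p = coset_of (edges G) (Const c * p)"
proof -
  interpret I: ideal "square_ideal (edges G)" "poly_ring (edges G) :: ('e, 'k) mpoly ring"
    by (rule ideal_square_ideal)
  note hom = I.rcos_ring_hom
  show "coset_of (edges G) p \<oplus>\<^bsub>Phi G\<^esub> coset_of (edges G) q = coset_of (edges G) (p + q)"
    "coset_of (edges G) p \<otimes>\<^bsub>Phi G\<^esub> coset_of (edges G) q = coset_of (edges G) (p * q)"
    if "q \<in> carrier (poly_ring (edges G))"
    using ring_hom_add[OF hom assms that] ring_hom_mult[OF hom assms that]
    by (simp_all add: Phi_simps coset_of_def poly_ring_simps)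
  show "c \<odot>\<^bsub>Phi G\<^esub> coset_of (edges G) p = coset_of (edges G) (Const c * p)"
    using ring_hom_mult[OF hom Const_in_carrier assms]
    by (simp add: Phi_simps coset_of_def poly_ring_simps)
qed

lemma one_in_poly_ring: "1 \<in> carrier (poly_ring E)"
  and zero_in_poly_ring: "0 \<in> carrier (poly_ring E)"
  by (simp_all add: poly_ring_def)

lemma one_Phi: "\<one>\<^bsub>Phi G\<^esub> = coset_of (edges G) 1"
  by (simp add: Phi_simps coset_of_def FactRing_def poly_ring_simps)

lemma zero_Phi: "(\<zero>\<^bsub>Phi G\<^esub> :: ('e, 'k::field) mpoly set) = coset_of (edges G) 0"
proof -
  interpret I: ideal "square_ideal (edges G)" "poly_ring (edges G) :: ('e, 'k) mpoly ring"
    by (rule ideal_square_ideal)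
  have zero: "0 \<in> (square_ideal (edges G) :: ('e, 'k) mpoly set)"
    unfolding square_ideal_eq by (simp add: reduce_zero zero_in_poly_ring)
  show ?thesis
    using I.a_rcos_zero[OF I.ideal_axioms zero]
    by (simp add: Phi_simps coset_of_def FactRing_def)
qed

text \<open>A representative of the coset is chosen; \<open>coset_of_eq_iff\<close> shows that
  \<open>reduce\<close> takes the same value on all of them, and different values on different
  cosets.\<close>

definition realize :: "'e mgraph \<Rightarrow> ('e, 'k::field) mpoly set \<Rightarrow> ('e, 'k) sqfree" where
  "realize G x = reduce (SOME p. p \<in> carrier (poly_ring (edges G)) \<and> x = coset_of (edges G) p)"

lemma realize_coset_of:
  assumes "p \<in> carrier (poly_ring (edges G))"
  shows "realize G (coset_of (edges G) p) = reduce p"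
proof -
  let ?q = "SOME q. q \<in> carrier (poly_ring (edges G)) \<and> coset_of (edges G) p = coset_of (edges G) q"
  have "?q \<in> carrier (poly_ring (edges G)) \<and> coset_of (edges G) p = coset_of (edges G) ?q"
    by (rule someI[of _ p]) (use assms in simp)
  then show ?thesis using assms coset_of_eq_iff[of p "edges G" ?q] by (simp add: realize_def)
qed

lemma inj_on_realize: "inj_on (realize G) (carrier (Phi G))"
proof (rule inj_onI)
  fix x y :: "('a, 'b) mpoly set"
  assume "x \<in> carrier (Phi G)" "y \<in> carrier (Phi G)" and eq: "realize G x = realize G y"
  then obtain p q where p: "p \<in> carrier (poly_ring (edges G))" "x = coset_of (edges G) p"
    and q: "q \<in> carrier (poly_ring (edges G))" "y = coset_of (edges G) q"
    unfolding carrier_Phi by blast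
  from eq have "reduce p = reduce q" unfolding p(2) q(2) realize_coset_of[OF p(1)] realize_coset_of[OF q(1)] .
  then show "x = y" unfolding p(2) q(2) using coset_of_eq_iff[OF p(1) q(1)] by blast
qed

lemma poly_ring_closed:
  fixes p q :: "('e, 'k::field) mpoly"
  assumes "p \<in> carrier (poly_ring E)" "q \<in> carrier (poly_ring E)"
  shows "p + q \<in> carrier (poly_ring E)" "p * q \<in> carrier (poly_ring E)"
proof -
  interpret P: cring "poly_ring E :: ('e, 'k) mpoly ring" by (rule cring_poly_ring)
  show "p + q \<in> carrier (poly_ring E)" "p * q \<in> carrier (poly_ring E)"
    using assms P.a_closed[of p q] P.m_closed[of p q] by (simp_all add: poly_ring_simps)
qed

lemma realize_hom:
  fixes x y :: "('e, 'k::field) mpoly set"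
  assumes "x \<in> carrier (Phi G)" "y \<in> carrier (Phi G)"
  shows "realize G (x \<oplus>\<^bsub>Phi G\<^esub> y) = realize G x + realize G y" "x \<oplus>\<^bsub>Phi G\<^esub> y \<in> carrier (Phi G)"
    and "realize G (x \<otimes>\<^bsub>Phi G\<^esub> y) = realize G x * realize G y" "x \<otimes>\<^bsub>Phi G\<^esub> y \<in> carrier (Phi G)"
proof -
  obtain p q where p: "p \<in> carrier (poly_ring (edges G))" "x = coset_of (edges G) p"
    and q: "q \<in> carrier (poly_ring (edges G))" "y = coset_of (edges G) q"
    using assms by (auto simp: carrier_Phi)
  have sum: "x \<oplus>\<^bsub>Phi G\<^esub> y = coset_of (edges G) (p + q)" "p + q \<in> carrier (poly_ring (edges G))"
    and prod: "x \<otimes>\<^bsub>Phi G\<^esub> y = coset_of (edges G) (p * q)" "p * q \<in> carrier (poly_ring (edges G))"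
    using p q by (simp_all add: coset_of_hom poly_ring_closed)
  show "realize G (x \<oplus>\<^bsub>Phi G\<^esub> y) = realize G x + realize G y"
    "realize G (x \<otimes>\<^bsub>Phi G\<^esub> y) = realize G x * realize G y"
    unfolding sum(1) prod(1)
    using p q sum(2) prod(2) by (simp_all add: realize_coset_of reduce_add reduce_mult)
  show "x \<oplus>\<^bsub>Phi G\<^esub> y \<in> carrier (Phi G)" "x \<otimes>\<^bsub>Phi G\<^esub> y \<in> carrier (Phi G)"
    unfolding sum(1) prod(1) carrier_Phi using sum(2) prod(2) by blast+
qed

lemma realize_smult:
  fixes x :: "('e, 'k::field) mpoly set"
  assumes "x \<in> carrier (Phi G)"
  shows "realize G (c \<odot>\<^bsub>Phi G\<^esub> x) = scalar c * realize G x" "c \<odot>\<^bsub>Phi G\<^esub> x \<in> carrier (Phi G)"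
    and supported_realize: "supported (edges G) (realize G x)"
proof -
  obtain p where p: "p \<in> carrier (poly_ring (edges G))" "x = coset_of (edges G) p"
    using assms by (auto simp: carrier_Phi)
  have smult: "c \<odot>\<^bsub>Phi G\<^esub> x = coset_of (edges G) (Const c * p)"
    "Const c * p \<in> carrier (poly_ring (edges G))"
    using p by (simp_all add: coset_of_hom poly_ring_closed Const_in_carrier)
  show "realize G (c \<odot>\<^bsub>Phi G\<^esub> x) = scalar c * realize G x"
    unfolding smult(1) using p smult(2) by (simp add: realize_coset_of reduce_mult reduce_Const)
  show "c \<odot>\<^bsub>Phi G\<^esub> x \<in> carrier (Phi G)"
    unfolding smult(1) carrier_Phi using smult(2) by blast
  show "supported (edges G) (realize G x)" using p by (simp add: realize_coset_of supported_reduce)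
qed

lemma one_in_Phi: "\<one>\<^bsub>Phi G\<^esub> \<in> carrier (Phi G)"
  and zero_in_Phi: "\<zero>\<^bsub>Phi G\<^esub> \<in> carrier (Phi G)"
  by (simp_all add: carrier_Phi one_Phi zero_Phi one_in_poly_ring zero_in_poly_ring)

lemma realize_one: "realize G \<one>\<^bsub>Phi G\<^esub> = 1"
  and realize_zero: "realize G \<zero>\<^bsub>Phi G\<^esub> = 0"
  by (simp_all add: one_Phi zero_Phi realize_coset_of one_in_poly_ring zero_in_poly_ring
      reduce_one reduce_zero)

lemma phi_in_Phi: "e \<in> edges G \<Longrightarrow> phi G e \<in> carrier (Phi G)"
  by (simp add: phi_def carrier_Phi Var_in_carrier)

lemma realize_phi: "e \<in> edges G \<Longrightarrow> realize G (phi G e) = gen e"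
  by (simp add: phi_def realize_coset_of Var_in_carrier reduce_Var)

definition expX :: "'e mgraph \<Rightarrow> nat \<Rightarrow> ('e, 'k::field) sqfree" where
  "expX G i = (\<Prod>e\<in>edges G. 1 + scalar (incidence G i e) * gen e)"

lemma realize_Y:
  fixes G :: "'e mgraph"
  assumes "finite (edges G)"
  shows "(Y G i :: ('e, 'k::field) mpoly set) \<in> carrier (Phi G)"
    "realize G (Y G i :: ('e, 'k::field) mpoly set) = expX G i"
proof -
  interpret R: cring "Phi G :: ('k, ('e, 'k) mpoly set) module"
    by (rule algebra.axioms(2)[OF algebra_Phi])
  define t where "t = (\<lambda>e. \<one>\<^bsub>Phi G\<^esub> \<oplus>\<^bsub>Phi G\<^esub> (incidence G i e :: 'k) \<odot>\<^bsub>Phi G\<^esub> phi G e)"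
  have t: "t e \<in> carrier (Phi G)" "realize G (t e) = 1 + scalar (incidence G i e) * gen e"
    if "e \<in> edges G" for e
    using that by (simp_all add: t_def realize_hom realize_smult phi_in_Phi one_in_Phi realize_one realize_phi)
  have "finprod (Phi G) t F \<in> carrier (Phi G) \<and>
      realize G (finprod (Phi G) t F) = (\<Prod>e\<in>F. 1 + scalar (incidence G i e) * gen e)"
    if "finite F" "F \<subseteq> edges G" for F
    using that
  proof (induction F rule: finite_induct)
    case (insert e F)
    then have "finprod (Phi G) t (insert e F) = t e \<otimes>\<^bsub>Phi G\<^esub> finprod (Phi G) t F"
      using t by (intro R.finprod_insert) auto
    then show ?case using insert t by (simp add: realize_hom)
  qed (simp add: one_in_Phi realize_one)
  from this[OF assms subset_refl]
  show "(Y G i :: ('e, 'k::field) mpoly set) \<in> carrier (Phi G)"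
    "realize G (Y G i :: ('e, 'k::field) mpoly set) = expX G i"
    by (simp_all add: Y_def expX_def t_def)
qed

section \<open>The generated subalgebra and its filtration in coordinates\<close>

definition K_real :: "'e mgraph \<Rightarrow> ('e, 'k::field) sqfree set" where
  "K_real G = realize G ` carrier (K_alg G)"

definition F_real :: "'e mgraph \<Rightarrow> nat \<Rightarrow> ('e, 'k::field) sqfree set" where
  "F_real G k = realize G ` K_filt G k"

lemma K_alg_simps:
  "carrier (K_alg G) = gen_subalgebra (Phi G) (Y G ` vertices G)"
  "mult (K_alg G) = mult (Phi G)" "add (K_alg G) = add (Phi G)" "one (K_alg G) = one (Phi G)"
  "smult (K_alg G) = smult (Phi G)"
  by (simp_all add: K_alg_def)

lemma K_alg_subset_Phi:
  assumes "finite (edges G)"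
  shows "carrier (K_alg G) \<subseteq> carrier (Phi G)"
proof
  fix x assume "x \<in> carrier (K_alg G)"
  then have "x \<in> gen_subalgebra (Phi G) (Y G ` vertices G)" by (simp add: K_alg_simps)
  then show "x \<in> carrier (Phi G)"
    by induction (use realize_Y(1)[OF assms] in \<open>auto simp: one_in_Phi realize_hom realize_smult\<close>)
qed

text \<open>\<open>gen_subalgebra\<close> has no rule for zero, so zero is obtained as the multiple
  of the unit by 0; the equation is checked after the injective map \<open>realize\<close>.\<close>

lemma zero_in_K_alg:
  fixes G :: "'e mgraph"
  shows "(\<zero>\<^bsub>Phi G\<^esub> :: ('e, 'k::field) mpoly set) \<in> carrier (K_alg G)"
proof -
  have "(0::'k) \<odot>\<^bsub>Phi G\<^esub> \<one>\<^bsub>Phi G\<^esub> = \<zero>\<^bsub>Phi G\<^esub>"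
    by (rule inj_onD[OF inj_on_realize[of G]])
       (simp_all add: realize_smult one_in_Phi zero_in_Phi realize_zero scalar_hom)
  moreover have "(0::'k) \<odot>\<^bsub>Phi G\<^esub> \<one>\<^bsub>Phi G\<^esub> \<in> carrier (K_alg G)"
    unfolding K_alg_simps by (intro gen_subalgebra.intros)
  ultimately show ?thesis by simp
qed

lemma Y_prod_in_K_alg: "set is \<subseteq> vertices G \<Longrightarrow> Y_prod G is \<in> carrier (K_alg G)"
  by (induction "is") (auto simp: Y_prod_def K_alg_simps intro: gen_subalgebra.intros)

lemma K_filt_subset_K_alg: "K_filt G k \<subseteq> carrier (K_alg G)"
proof
  fix x assume "x \<in> K_filt G k"
  then show "x \<in> carrier (K_alg G)" unfolding K_filt_def
  proof induction
    case (base x)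
    then show ?case using Y_prod_in_K_alg by auto
  next
    case zero
    show ?case by (rule zero_in_K_alg)
  next
    case (add x y)
    then show ?case unfolding K_alg_simps by (intro gen_subalgebra.add)
  next
    case (smult x c)
    then show ?case unfolding K_alg_simps by (intro gen_subalgebra.smult)
  qed
qed

lemma supported_K_real:
  "finite (edges G) \<Longrightarrow> x \<in> K_real G \<Longrightarrow> supported (edges G) x"
  unfolding K_real_def using supported_realize[OF subsetD[OF K_alg_subset_Phi]] by blast

lemma F_real_subset: "F_real G k \<subseteq> K_real G"
  using K_filt_subset_K_alg by (auto simp: F_real_def K_real_def)

lemma K_real_closed:
  assumes "finite (edges G)"
  shows "1 \<in> K_real G" "0 \<in> K_real G"
    "x \<in> K_real G \<Longrightarrow> y \<in> K_real G \<Longrightarrow> x + y \<in> K_real G"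
    "x \<in> K_real G \<Longrightarrow> y \<in> K_real G \<Longrightarrow> x * y \<in> K_real G"
    "x \<in> K_real G \<Longrightarrow> scalar c * x \<in> K_real G"
    "i \<in> vertices G \<Longrightarrow> expX G i \<in> K_real G"
proof -
  note sub = subsetD[OF K_alg_subset_Phi[OF assms]]
  have 1: "\<one>\<^bsub>Phi G\<^esub> \<in> carrier (K_alg G)" by (simp add: K_alg_simps gen_subalgebra.one)
  show "1 \<in> K_real G" unfolding K_real_def using imageI[OF 1, of "realize G"] by (simp add: realize_one)
  show "0 \<in> K_real G" unfolding K_real_def
    using imageI[OF zero_in_K_alg, of "realize G" G] by (simp add: realize_zero)
  show "x + y \<in> K_real G" "x * y \<in> K_real G" if xy: "x \<in> K_real G" "y \<in> K_real G"
  proof -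
    obtain u v where uv: "u \<in> carrier (K_alg G)" "v \<in> carrier (K_alg G)"
      "x = realize G u" "y = realize G v" using xy by (auto simp: K_real_def)
    then have "u \<oplus>\<^bsub>Phi G\<^esub> v \<in> carrier (K_alg G)" "u \<otimes>\<^bsub>Phi G\<^esub> v \<in> carrier (K_alg G)"
      by (simp_all add: K_alg_simps gen_subalgebra.intros)
    then show "x + y \<in> K_real G" "x * y \<in> K_real G"
      unfolding K_real_def using uv by (metis imageI realize_hom(1,3) sub)+
  qed
  show "scalar c * x \<in> K_real G" if x: "x \<in> K_real G"
  proof -
    obtain u where u: "u \<in> carrier (K_alg G)" "x = realize G u" using x by (auto simp: K_real_def)
    then have "c \<odot>\<^bsub>Phi G\<^esub> u \<in> carrier (K_alg G)" by (simp add: K_alg_simps gen_subalgebra.intros)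
    then show ?thesis unfolding K_real_def using u by (metis imageI realize_smult(1) sub)
  qed
  show "expX G i \<in> K_real G" if "i \<in> vertices G"
  proof -
    have "Y G i \<in> carrier (K_alg G)" using that by (simp add: K_alg_simps gen_subalgebra.base)
    then show ?thesis unfolding K_real_def by (metis imageI realize_Y(2)[OF assms])
  qed
qed

lemma K_real_power:
  assumes "finite (edges G)" "x \<in> K_real G"
  shows "x ^ n \<in> K_real G"
  by (induction n) (auto intro: K_real_closed[OF assms(1)] assms(2))

lemma realize_Y_prod:
  fixes G :: "'e mgraph"
  assumes "finite (edges G)" "set is \<subseteq> vertices G"
  shows "realize G (Y_prod G is) = (\<Prod>i\<leftarrow>is. expX G i :: ('e, 'k::field) sqfree)"
  using assms(2)
proof (induction "is")
  case (Cons i "is")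
  have "(Y_prod G is :: ('e, 'k) mpoly set) \<in> carrier (Phi G)"
    using Y_prod_in_K_alg K_alg_subset_Phi[OF assms(1)] Cons by auto
  then show ?case
    using Cons by (simp add: Y_prod_def realize_hom realize_Y[OF assms(1)])
qed (simp add: Y_prod_def realize_one)

lemma F_real_closed:
  fixes x y :: "('e, 'k::field) sqfree"
  assumes "finite (edges G)"
  shows "(0 :: ('e, 'k) sqfree) \<in> F_real G k"
    "x \<in> F_real G k \<Longrightarrow> y \<in> F_real G k \<Longrightarrow> x + y \<in> F_real G k"
    "x \<in> F_real G k \<Longrightarrow> scalar c * x \<in> F_real G k"
    "set is \<subseteq> vertices G \<Longrightarrow> length is \<le> k \<Longrightarrow> (\<Prod>i\<leftarrow>is. expX G i :: ('e, 'k) sqfree) \<in> F_real G k"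
proof -
  have sub: "u \<in> K_filt G k \<Longrightarrow> u \<in> carrier (Phi G)" for u :: "('e, 'k) mpoly set"
    using K_filt_subset_K_alg K_alg_subset_Phi[OF assms] by blast
  have "\<zero>\<^bsub>Phi G\<^esub> \<in> K_filt G k" by (simp add: K_filt_def lin_span.zero)
  then show "(0 :: ('e, 'k) sqfree) \<in> F_real G k" unfolding F_real_def by (metis imageI realize_zero)
  show "x + y \<in> F_real G k" if xy: "x \<in> F_real G k" "y \<in> F_real G k"
  proof -
    obtain u v where uv: "u \<in> K_filt G k" "v \<in> K_filt G k"
      "x = realize G u" "y = realize G v" using xy by (auto simp: F_real_def)
    then have "u \<oplus>\<^bsub>Phi G\<^esub> v \<in> K_filt G k" by (simp add: K_filt_def lin_span.intros)
    then show ?thesis unfolding F_real_def using uv by (metis imageI realize_hom(1) sub)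
  qed
  show "scalar c * x \<in> F_real G k" if x: "x \<in> F_real G k"
  proof -
    obtain u where u: "u \<in> K_filt G k" "x = realize G u" using x by (auto simp: F_real_def)
    then have "c \<odot>\<^bsub>Phi G\<^esub> u \<in> K_filt G k" by (simp add: K_filt_def lin_span.intros)
    then show ?thesis unfolding F_real_def using u by (metis imageI realize_smult(1) sub)
  qed
  show "(\<Prod>i\<leftarrow>is. expX G i :: ('e, 'k) sqfree) \<in> F_real G k" if "is": "set is \<subseteq> vertices G" "length is \<le> k"
  proof -
    have "Y_prod G is \<in> K_filt G k" using "is" by (auto simp: K_filt_def intro: lin_span.base)
    then show ?thesis unfolding F_real_def by (metis imageI realize_Y_prod[OF assms "is"(1)])
  qed
qed

text \<open>The induction of \<open>lin_span\<close>, carried along \<open>realize\<close>, so that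
  later arguments about the pieces need not return to cosets.\<close>

lemma F_real_induct [consumes 2, case_names zero prod add smult]:
  fixes x :: "('e, 'k::field) sqfree"
  assumes "finite (edges G)" "x \<in> F_real G k"
    and "P 0"
    and "\<And>is. set is \<subseteq> vertices G \<Longrightarrow> length is \<le> k \<Longrightarrow> P (\<Prod>i\<leftarrow>is. expX G i)"
    and "\<And>x y. x \<in> F_real G k \<Longrightarrow> P x \<Longrightarrow> y \<in> F_real G k \<Longrightarrow> P y \<Longrightarrow> P (x + y)"
    and "\<And>c x. x \<in> F_real G k \<Longrightarrow> P x \<Longrightarrow> P (scalar c * x)"
  shows "P x"
proof -
  obtain u where u: "u \<in> K_filt G k" "x = realize G u" using assms(2) by (auto simp: F_real_def)
  have sub: "u \<in> carrier (Phi G)" if "u \<in> K_filt G k" for u :: "('e, 'k) mpoly set"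
    using K_filt_subset_K_alg K_alg_subset_Phi[OF assms(1)] that by blast
  have "u \<in> K_filt G k \<and> P (realize G u)"
    using u(1) unfolding K_filt_def
  proof induction
    case zero
    then show ?case using assms(3) by (simp add: realize_zero lin_span.zero)
  next
    case (base x)
    then obtain "is" where "is": "x = Y_prod G is" "set is \<subseteq> vertices G" "length is \<le> k" by auto
    then have "P (realize G x)" using assms(4) by (simp add: realize_Y_prod[OF assms(1)])
    then show ?case using lin_span.base[OF base] by blast
  next
    case (add x y)
    then have "x \<in> K_filt G k" "y \<in> K_filt G k" by (simp_all add: K_filt_def)
    then show ?case
      using add assms(5)[of "realize G x" "realize G y"] sub
      by (simp add: realize_hom F_real_def lin_span.add)
  next
    case (smult x c)
    then have "x \<in> K_filt G k" by (simp add: K_filt_def)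
    then show ?case
      using smult assms(6)[of "realize G x" c] sub
      by (simp add: realize_smult F_real_def lin_span.smult)
  qed
  then show ?thesis using u by simp
qed

lemma K_real_induct [consumes 2, case_names one base add mult smult]:
  fixes x :: "('e, 'k::field) sqfree"
  assumes "finite (edges G)" "x \<in> K_real G"
    and "P 1"
    and "\<And>i. i \<in> vertices G \<Longrightarrow> P (expX G i)"
    and "\<And>x y. x \<in> K_real G \<Longrightarrow> P x \<Longrightarrow> y \<in> K_real G \<Longrightarrow> P y \<Longrightarrow> P (x + y)"
    and "\<And>x y. x \<in> K_real G \<Longrightarrow> P x \<Longrightarrow> y \<in> K_real G \<Longrightarrow> P y \<Longrightarrow> P (x * y)"
    and "\<And>c x. x \<in> K_real G \<Longrightarrow> P x \<Longrightarrow> P (scalar c * x)"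
  shows "P x"
proof -
  obtain u where u: "u \<in> carrier (K_alg G)" "x = realize G u" using assms(2) by (auto simp: K_real_def)
  have sub: "u \<in> carrier (Phi G)" if "u \<in> gen_subalgebra (Phi G) (Y G ` vertices G)" for u :: "('e, 'k) mpoly set"
    using K_alg_subset_Phi[OF assms(1)] that by (auto simp: K_alg_simps)
  have "u \<in> carrier (K_alg G) \<and> P (realize G u)"
    using u(1) unfolding K_alg_simps
  proof induction
    case one
    then show ?case using assms(3) by (simp add: realize_one gen_subalgebra.one)
  next
    case (base x)
    then show ?case
      using assms(4) by (auto simp: realize_Y[OF assms(1)] intro: gen_subalgebra.base)
  next
    case (add x y)
    then show ?case
      using assms(5)[of "realize G x" "realize G y"] sub
      by (simp add: realize_hom K_real_def gen_subalgebra.add K_alg_simps)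
  next
    case (mult x y)
    then show ?case
      using assms(6)[of "realize G x" "realize G y"] sub
      by (simp add: realize_hom K_real_def gen_subalgebra.mult K_alg_simps)
  next
    case (smult x c)
    then show ?case
      using assms(7)[of "realize G x" c] sub
      by (simp add: realize_smult K_real_def gen_subalgebra.smult K_alg_simps)
  qed
  then show ?thesis using u by simp
qed

section \<open>Filtered isomorphisms in coordinates\<close>

definition filtered_sqfree_iso ::
  "'e mgraph \<Rightarrow> 'f mgraph \<Rightarrow> (('e, 'k::field) sqfree \<Rightarrow> ('f, 'k) sqfree) \<Rightarrow> bool" where
  "filtered_sqfree_iso G H F \<longleftrightarrow> bij_betw F (K_real G) (K_real H) \<and> F 1 = 1 \<and>
     (\<forall>x\<in>K_real G. \<forall>y\<in>K_real G. F (x + y) = F x + F y \<and> F (x * y) = F x * F y) \<and>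
     (\<forall>c. \<forall>x\<in>K_real G. F (scalar c * x) = scalar c * F x) \<and>
     (\<forall>k. F ` F_real G k = F_real H k)"

text \<open>\<open>realize\<close> is injective on the subalgebras, so conjugation with it and its
  inverse passes between the two kinds of maps. Values of \<open>F\<close> outside
  \<open>K_real G\<close> are irrelevant on the right-hand side.\<close>

lemma filtered_isomorphic_K_alg_iff:
  fixes G :: "'e mgraph" and H :: "'f mgraph"
  assumes "finite (edges G)" "finite (edges H)"
  shows "filtered_isomorphic (K_alg G :: ('k::field, ('e, 'k) mpoly set) module) (K_filt G)
           (K_alg H :: ('k, ('f, 'k) mpoly set) module) (K_filt H)
       \<longleftrightarrow> (\<exists>F :: ('e, 'k) sqfree \<Rightarrow> ('f, 'k) sqfree. filtered_sqfree_iso G H F)"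
proof
  let ?A = "K_alg G :: ('k, ('e, 'k) mpoly set) module"
  let ?B = "K_alg H :: ('k, ('f, 'k) mpoly set) module"
  note subG = subsetD[OF K_alg_subset_Phi[OF assms(1)]]
  note subH = subsetD[OF K_alg_subset_Phi[OF assms(2)]]
  have bijG: "bij_betw (realize G) (carrier ?A) (K_real G)"
    unfolding bij_betw_def K_real_def
    using inj_on_subset[OF inj_on_realize K_alg_subset_Phi[OF assms(1)]] by auto
  have bijH: "bij_betw (realize H) (carrier ?B) (K_real H)"
    unfolding bij_betw_def K_real_def
    using inj_on_subset[OF inj_on_realize K_alg_subset_Phi[OF assms(2)]] by auto
  have closed: "\<one>\<^bsub>Phi G\<^esub> \<in> carrier ?A"
    "x \<in> carrier ?A \<Longrightarrow> y \<in> carrier ?A \<Longrightarrow> x \<oplus>\<^bsub>Phi G\<^esub> y \<in> carrier ?A"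
    "x \<in> carrier ?A \<Longrightarrow> y \<in> carrier ?A \<Longrightarrow> x \<otimes>\<^bsub>Phi G\<^esub> y \<in> carrier ?A"
    "x \<in> carrier ?A \<Longrightarrow> c \<odot>\<^bsub>Phi G\<^esub> x \<in> carrier ?A" for x y c
    by (simp_all add: K_alg_simps gen_subalgebra.intros)
  have closedH: "\<one>\<^bsub>Phi H\<^esub> \<in> carrier ?B"
    "x \<in> carrier ?B \<Longrightarrow> y \<in> carrier ?B \<Longrightarrow> x \<oplus>\<^bsub>Phi H\<^esub> y \<in> carrier ?B"
    "x \<in> carrier ?B \<Longrightarrow> y \<in> carrier ?B \<Longrightarrow> x \<otimes>\<^bsub>Phi H\<^esub> y \<in> carrier ?B"
    "x \<in> carrier ?B \<Longrightarrow> c \<odot>\<^bsub>Phi H\<^esub> x \<in> carrier ?B" for x y c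
    by (simp_all add: K_alg_simps gen_subalgebra.intros)
  {
    assume "filtered_isomorphic ?A (K_filt G) ?B (K_filt H)"
    then obtain f where f: "f \<in> ring_hom ?A ?B" "bij_betw f (carrier ?A) (carrier ?B)"
      "\<And>c x. x \<in> carrier ?A \<Longrightarrow> f (c \<odot>\<^bsub>Phi G\<^esub> x) = c \<odot>\<^bsub>Phi H\<^esub> f x"
      "\<And>k. f ` K_filt G k = K_filt H k"
      unfolding filtered_isomorphic_def algebra_iso_def ring_iso_def by (auto simp: K_alg_simps)
    define F where "F = realize H \<circ> f \<circ> inv_into (carrier ?A) (realize G)"
    have F: "F (realize G x) = realize H (f x)" if "x \<in> carrier ?A" for x
      using that bijG by (simp add: F_def bij_betw_inv_into_left)
    have fc: "f x \<in> carrier ?B" if "x \<in> carrier ?A" for x using ring_hom_closed[OF f(1) that] .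
    have hom: "F (x + y) = F x + F y \<and> F (x * y) = F x * F y"
      if xy: "x \<in> K_real G" "y \<in> K_real G" for x y
    proof -
      obtain u v where uv: "u \<in> carrier ?A" "v \<in> carrier ?A" "x = realize G u" "y = realize G v"
        using xy by (auto simp: K_real_def)
      have "F (x + y) = realize H (f (u \<oplus>\<^bsub>Phi G\<^esub> v))" "F (x * y) = realize H (f (u \<otimes>\<^bsub>Phi G\<^esub> v))"
        using F[OF closed(2)[OF uv(1,2)]] F[OF closed(3)[OF uv(1,2)]]
        by (simp_all add: uv realize_hom subG)
      moreover have "f (u \<oplus>\<^bsub>Phi G\<^esub> v) = f u \<oplus>\<^bsub>Phi H\<^esub> f v" "f (u \<otimes>\<^bsub>Phi G\<^esub> v) = f u \<otimes>\<^bsub>Phi H\<^esub> f v"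
        using ring_hom_add[OF f(1) uv(1,2)] ring_hom_mult[OF f(1) uv(1,2)] by (simp_all add: K_alg_simps)
      ultimately show ?thesis using uv by (simp add: F fc subH realize_hom)
    qed
    have smult: "F (scalar c * x) = scalar c * F x" if x: "x \<in> K_real G" for c x
    proof -
      obtain u where u: "u \<in> carrier ?A" "x = realize G u" using x by (auto simp: K_real_def)
      have "F (scalar c * x) = realize H (f (c \<odot>\<^bsub>Phi G\<^esub> u))"
        using F[OF closed(4)[OF u(1)]] by (simp add: u realize_smult subG)
      then show ?thesis using u by (simp add: F f(3) fc subH realize_smult)
    qed
    have "F 1 = realize H (f \<one>\<^bsub>Phi G\<^esub>)" using F[OF closed(1)] by (simp add: realize_one)
    moreover have "f \<one>\<^bsub>Phi G\<^esub> = \<one>\<^bsub>Phi H\<^esub>" using ring_hom_one[OF f(1)] by (simp add: K_alg_simps)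
    ultimately have one: "F 1 = 1" by (simp add: realize_one)
    have bij: "bij_betw F (K_real G) (K_real H)"
      unfolding F_def
      by (rule bij_betw_trans[OF bij_betw_inv_into[OF bijG] bij_betw_trans[OF f(2) bijH], unfolded comp_assoc[symmetric]])
    have filt: "F ` F_real G k = F_real H k" for k
    proof -
      have "F ` F_real G k = (\<lambda>x. realize H (f x)) ` K_filt G k"
        unfolding F_real_def image_image
        using F K_filt_subset_K_alg by (intro image_cong) auto
      also have "\<dots> = F_real H k" unfolding F_real_def f(4)[symmetric] by (simp add: image_image)
      finally show ?thesis .
    qed
    have "filtered_sqfree_iso G H F"
      unfolding filtered_sqfree_iso_def using bij one hom smult filt by blast
    then show "\<exists>F :: ('e, 'k) sqfree \<Rightarrow> ('f, 'k) sqfree. filtered_sqfree_iso G H F" by blast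
  }
  {
    assume "\<exists>F :: ('e, 'k) sqfree \<Rightarrow> ('f, 'k) sqfree. filtered_sqfree_iso G H F"
    then obtain F :: "('e, 'k) sqfree \<Rightarrow> ('f, 'k) sqfree" where iso: "filtered_sqfree_iso G H F"
      by blast
    have F: "bij_betw F (K_real G) (K_real H)" "F 1 = 1"
      "\<And>x y. x \<in> K_real G \<Longrightarrow> y \<in> K_real G \<Longrightarrow> F (x + y) = F x + F y"
      "\<And>x y. x \<in> K_real G \<Longrightarrow> y \<in> K_real G \<Longrightarrow> F (x * y) = F x * F y"
      "\<And>c x. x \<in> K_real G \<Longrightarrow> F (scalar c * x) = scalar c * F x"
      "\<And>k. F ` F_real G k = F_real H k"
      using iso by (simp_all add: filtered_sqfree_iso_def)
    define f where "f = inv_into (carrier ?B) (realize H) \<circ> F \<circ> realize G"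
    have KG: "realize G x \<in> K_real G" if "x \<in> carrier ?A" for x using that by (simp add: K_real_def)
    have bij: "bij_betw f (carrier ?A) (carrier ?B)"
      unfolding f_def comp_assoc
      by (rule bij_betw_trans[OF bij_betw_trans[OF bijG F(1)] bij_betw_inv_into[OF bijH]])
    have fc: "f x \<in> carrier ?B" if "x \<in> carrier ?A" for x
      using bij that by (rule bij_betwE[THEN bspec])
    have f: "realize H (f x) = F (realize G x)" if "x \<in> carrier ?A" for x
      using bij_betw_inv_into_right[OF bijH] bij_betwE[OF F(1)] KG[OF that] by (simp add: f_def)
    have eqI: "u = v" if "u \<in> carrier ?B" "v \<in> carrier ?B" "realize H u = realize H v" for u v
      using that bijH by (auto simp: bij_betw_def inj_on_def)
    have "f \<in> ring_hom ?A ?B"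
    proof (rule ring_hom_memI)
      fix x y assume xy: "x \<in> carrier ?A" "y \<in> carrier ?A"
      show "f x \<in> carrier ?B" by (rule fc[OF xy(1)])
      show "f (x \<otimes>\<^bsub>?A\<^esub> y) = f x \<otimes>\<^bsub>?B\<^esub> f y"
        unfolding K_alg_simps
        by (rule eqI) (simp_all add: xy fc closed closedH subG subH f KG F(4) realize_hom)
      show "f (x \<oplus>\<^bsub>?A\<^esub> y) = f x \<oplus>\<^bsub>?B\<^esub> f y"
        unfolding K_alg_simps
        by (rule eqI) (simp_all add: xy fc closed closedH subG subH f KG F(3) realize_hom)
    next
      show "f \<one>\<^bsub>?A\<^esub> = \<one>\<^bsub>?B\<^esub>"
        unfolding K_alg_simps
        by (rule eqI) (simp_all add: fc closed closedH f F(2) realize_one)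
    qed
    moreover have "f (c \<odot>\<^bsub>?A\<^esub> x) = c \<odot>\<^bsub>?B\<^esub> f x" if x: "x \<in> carrier ?A" for c x
      unfolding K_alg_simps
      by (rule eqI) (simp_all add: x fc closed closedH subG subH f KG F(5) realize_smult)
    moreover have "f ` K_filt G k = K_filt H k" for k
    proof -
      have "f ` K_filt G k = inv_into (carrier ?B) (realize H) ` F ` F_real G k"
        by (simp add: f_def F_real_def image_comp comp_assoc)
      also have "\<dots> = inv_into (carrier ?B) (realize H) ` realize H ` K_filt H k"
        by (subst F(6)) (simp only: F_real_def)
      also have "\<dots> = K_filt H k"
        by (rule inv_into_image_cancel[OF bij_betw_imp_inj_on[OF bijH] K_filt_subset_K_alg])
      finally show ?thesis .
    qed
    ultimately show "filtered_isomorphic ?A (K_filt G) ?B (K_filt H)"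
      unfolding filtered_isomorphic_def algebra_iso_def ring_iso_def using bij by blast
  }
qed

section \<open>The nilpotent part of the first filtration piece\<close>

lemma loopless_finite: "loopless_multigraph G \<Longrightarrow> finite (edges G)"
  by (simp add: loopless_multigraph_def)

lemma finite_vertices [simp]: "finite (vertices G)"
  by (simp add: vertices_def)

lemma edge_ends:
  assumes "loopless_multigraph G" "e \<in> edges G"
  obtains i j where "i < j" "ends G e = {i, j}" "i \<in> vertices G" "j \<in> vertices G"
proof -
  have "card (ends G e) = 2" "ends G e \<subseteq> vertices G"
    using assms by (auto simp: loopless_multigraph_def)
  then obtain i j where "i \<noteq> j" "ends G e = {i, j}" by (auto simp: card_2_iff)
  then show ?thesis
    using that[of i j] that[of j i] \<open>ends G e \<subseteq> vertices G\<close>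
    by (cases "i < j") (auto simp: insert_commute)
qed

lemma incidence_eq:
  "i < j \<Longrightarrow> ends G e = {i, j} \<Longrightarrow> incidence G v e = (if v = i then 1 else if v = j then - 1 else 0)"
  by (auto simp: incidence_def doubleton_eq_iff)

lemma incidence_parallel: "ends G e = ends G f \<Longrightarrow> incidence G v e = incidence G v f"
  by (simp only: incidence_def)

lemma incidence_nonzero_iff:
  assumes "loopless_multigraph G" "e \<in> edges G"
  shows "incidence G v e \<noteq> (0::'k::field_char_0) \<longleftrightarrow> v \<in> ends G e"
proof -
  obtain i j where "i < j" "ends G e = {i, j}" by (rule edge_ends[OF assms])
  then show ?thesis by (simp add: incidence_eq[of i j])
qed

section \<open>Expansion up to degree two\<close>

lemma scalar_half_double:
  fixes z :: "('e, 'k::field_char_0) sqfree"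
  shows "scalar (1 / 2) * (2 * z) = z"
proof -
  have "(2 :: ('e, 'k) sqfree) = scalar 2" by (metis scalar_of_nat of_nat_numeral)
  then have "scalar (1 / 2) * (2 * z) = scalar (1 / 2 * 2) * z"
    by (simp only: scalar_hom(3) mult.assoc)
  then show ?thesis by (simp add: scalar_hom)
qed

text \<open>This is the exponential series up to degree two: since squares vanish, the second
  elementary symmetric polynomial of the summands is half the square of their sum.\<close>

lemma prod_one_plus_second_order:
  fixes c :: "'e \<Rightarrow> 'k::field_char_0"
  assumes "finite F"
  defines "s \<equiv> \<lambda>F. \<Sum>e\<in>F. scalar (c e) * gen e :: ('e, 'k) sqfree"
  shows "order_ge 3 ((\<Prod>e\<in>F. 1 + scalar (c e) * gen e) - 1 - s F - scalar (1 / 2) * (s F) ^ 2)"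
  using assms(1)
proof (induction F rule: finite_induct)
  case (insert g F)
  define x :: "('e, 'k) sqfree" where "x = scalar (c g) * gen g"
  define C where "C = (\<Prod>e\<in>F. 1 + scalar (c e) * gen e) - 1 - s F - scalar (1 / 2) * (s F) ^ 2"
  have C: "order_ge 3 C" using insert by (simp add: C_def)
  have x: "order_ge 1 x" unfolding x_def by (intro order_ge_mult_left order_ge_gen)
  have s: "order_ge 1 (s F)" unfolding s_def by (intro order_ge_sum order_ge_mult_left order_ge_gen)
  have xx: "x ^ 2 = 0" by (simp add: x_def power2_eq_square gen_scaled_square)
  have P: "(\<Prod>e\<in>F. 1 + scalar (c e) * gen e) = C + 1 + s F + scalar (1 / 2) * (s F) ^ 2"
    by (simp add: C_def)
  have sI: "s (insert g F) = x + s F" using insert by (simp add: s_def x_def)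
  have "scalar (1 / 2) * (x + s F) ^ 2
      = scalar (1 / 2) * x ^ 2 + scalar (1 / 2) * (2 * (x * s F)) + scalar (1 / 2) * (s F) ^ 2"
    by (simp add: power2_eq_square algebra_simps)
  then have sq: "scalar (1 / 2) * (x + s F) ^ 2 = x * s F + scalar (1 / 2) * (s F) ^ 2"
    by (simp add: xx scalar_half_double)
  have "(\<Prod>e\<in>insert g F. 1 + scalar (c e) * gen e) = (1 + x) * (C + 1 + s F + scalar (1 / 2) * (s F) ^ 2)"
    using insert P by (simp add: x_def)
  then have "(\<Prod>e\<in>insert g F. 1 + scalar (c e) * gen e) - 1 - s (insert g F) - scalar (1 / 2) * (s (insert g F)) ^ 2
      = C + x * C + scalar (1 / 2) * (x * (s F) ^ 2)"
    unfolding sI sq by (simp add: algebra_simps)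
  moreover have "order_ge 3 (x * (s F) ^ 2)"
    using order_ge_mult[OF x order_ge_power_1[OF s, of 2]] by (simp add: numeral_3_eq_3)
  ultimately show ?case by (simp add: order_ge_add order_ge_mult_left C)
qed (simp add: s_def)

definition X :: "'e mgraph \<Rightarrow> nat \<Rightarrow> ('e, 'k::field) sqfree" where
  "X G i = (\<Sum>e\<in>edges G. scalar (incidence G i e) * gen e)"

text \<open>The elements \<open>comb G a\<close> are those of the first filtration piece with zero constant term.\<close>

definition comb :: "'e mgraph \<Rightarrow> (nat \<Rightarrow> 'k::field) \<Rightarrow> ('e, 'k) sqfree" where
  "comb G a = (\<Sum>i\<in>vertices G. scalar (a i) * (expX G i - 1))"

definition lin :: "'e mgraph \<Rightarrow> (nat \<Rightarrow> 'k::field) \<Rightarrow> 'e \<Rightarrow> 'k" where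
  "lin G a e = (\<Sum>i\<in>vertices G. a i * incidence G i e)"

definition lin_form :: "'e mgraph \<Rightarrow> (nat \<Rightarrow> 'k::field) \<Rightarrow> ('e, 'k) sqfree" where
  "lin_form G a = (\<Sum>e\<in>edges G. scalar (lin G a e) * gen e)"

text \<open>The linear part sees only differences of weights along edges. This part can change when
  a constant is added to all weights, and the adjacency test rests on that.\<close>

definition quad_form :: "'e mgraph \<Rightarrow> (nat \<Rightarrow> 'k::field) \<Rightarrow> ('e, 'k) sqfree" where
  "quad_form G a = (\<Sum>i\<in>vertices G. scalar (a i) * (scalar (1 / 2) * X G i ^ 2))"

lemma lin_eq:
  assumes "i < j" "ends G e = {i, j}" "i \<in> vertices G" "j \<in> vertices G"
  shows "lin G a e = a i - a j"
proof -
  have "lin G a e = (\<Sum>v\<in>vertices G. (if v = i then a i else 0) + (if v = j then - a j else 0))"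
    unfolding lin_def using assms by (intro sum.cong) (auto simp: incidence_eq[OF assms(1,2)])
  then show ?thesis using assms by (simp add: sum.distrib)
qed

lemma lin_eq_0_iff:
  assumes "loopless_multigraph G" "e \<in> edges G"
  shows "lin G a e = 0 \<longleftrightarrow> (\<forall>u\<in>ends G e. \<forall>v\<in>ends G e. a u = a v)"
proof -
  obtain i j where "i < j" "ends G e = {i, j}" "i \<in> vertices G" "j \<in> vertices G"
    by (rule edge_ends[OF assms])
  then show ?thesis by (auto simp: lin_eq[of i j])
qed

lemma lin_parallel: "ends G e = ends G f \<Longrightarrow> lin G a e = lin G a f"
  by (simp add: lin_def incidence_parallel[of G e f])

lemma lin_form_eq: "lin_form G a = (\<Sum>i\<in>vertices G. scalar (a i) * X G i)"
proof -
  have "(\<Sum>i\<in>vertices G. scalar (a i) * X G i)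
      = (\<Sum>e\<in>edges G. \<Sum>i\<in>vertices G. scalar (a i * incidence G i e) * gen e)"
    unfolding X_def sum_distrib_left by (subst sum.swap) (simp add: scalar_hom mult.assoc)
  also have "\<dots> = lin_form G a" unfolding lin_form_def
    by (intro sum.cong refl sqfree_eqI) (simp add: lin_def sum_distrib_right)
  finally show ?thesis by simp
qed

lemma order_ge_lin_form: "order_ge 1 (lin_form G a)"
  unfolding lin_form_def by (intro order_ge_sum order_ge_mult_left order_ge_gen)

lemma order_ge_X: "order_ge 1 (X G i)"
  unfolding X_def by (intro order_ge_sum order_ge_mult_left order_ge_gen)

lemma order_ge_quad_form: "order_ge 2 (quad_form G a)"
  unfolding quad_form_def
  by (intro order_ge_sum order_ge_mult_left order_ge_power_1 order_ge_X)

lemma comb_second_order: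
  fixes a :: "nat \<Rightarrow> 'k::field_char_0"
  assumes "finite (edges G)"
  shows "order_ge 3 (comb G a - lin_form G a - quad_form G a)"
proof -
  have "comb G a - lin_form G a - quad_form G a
      = (\<Sum>i\<in>vertices G. scalar (a i) * (expX G i - 1 - X G i - scalar (1 / 2) * X G i ^ 2))"
    by (simp add: comb_def lin_form_eq quad_form_def sum_subtractf right_diff_distrib)
  also have "order_ge 3 \<dots>"
    unfolding expX_def X_def
    by (intro order_ge_sum order_ge_mult_left prod_one_plus_second_order assms)
  finally show ?thesis .
qed

lemma comb_first_order:
  fixes a :: "nat \<Rightarrow> 'k::field_char_0"
  assumes "finite (edges G)"
  shows "order_ge 2 (comb G a - lin_form G a)" "order_ge 1 (comb G a)"
proof -
  have "order_ge 2 ((comb G a - lin_form G a - quad_form G a) + quad_form G a)"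
    by (intro order_ge_add order_ge_quad_form order_ge_mono[OF comb_second_order[OF assms]]) simp
  then show *: "order_ge 2 (comb G a - lin_form G a)" by simp
  have "order_ge 1 ((comb G a - lin_form G a) + lin_form G a)"
    by (intro order_ge_add order_ge_lin_form order_ge_mono[OF *]) simp
  then show "order_ge 1 (comb G a)" by simp
qed

lemma supported_expX: "supported (edges G) (expX G i)"
  unfolding expX_def
  by (intro supported_prod supported_add supported_one supported_mult supported_scalar supported_gen)

lemma supported_comb: "supported (edges G) (comb G a)"
  unfolding comb_def
  by (intro supported_sum supported_mult supported_scalar supported_diff supported_expX supported_one)

lemma supported_lin_form: "supported (edges G) (lin_form G a)"
  unfolding lin_form_def by (intro supported_sum supported_mult supported_scalar supported_gen)

lemma supported_quad_form: "supported (edges G) (quad_form G a)"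
  unfolding quad_form_def X_def
  by (intro supported_sum supported_mult supported_scalar supported_power supported_gen)

text \<open>Recovers the linear part from the element itself, although the weights are in general
  not determined by the element.\<close>

lemma coeff_comb:
  fixes a :: "nat \<Rightarrow> 'k::field_char_0"
  assumes "finite (edges G)" "e \<in> edges G"
  shows "coeff (comb G a) {e} = lin G a e"
proof -
  have "coeff (comb G a - lin_form G a) {e} = 0"
    using comb_first_order(1)[OF assms(1), of a] by (simp add: order_ge_def)
  moreover have "coeff (lin_form G a) {e} = (\<Sum>g\<in>edges G. if g = e then lin G a e else 0)"
    unfolding lin_form_def coeff_sum by (intro sum.cong) (auto simp: gen.rep_eq)
  ultimately show ?thesis using assms by simp
qed

lemma comb_linear: "comb G (\<lambda>i. a i + c * b i) = comb G a + scalar c * comb G b"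
  by (simp add: comb_def scalar_hom distrib_right sum.distrib sum_distrib_left mult.assoc)

lemma eq_if_order_ge_diff:
  assumes "finite E" "supported E x" "supported E y" "order_ge (Suc (card E)) (x - y)"
  shows "x = y"
  using order_ge_imp_zero[OF assms(1) supported_diff[OF assms(2,3)] assms(4)] by simp

section \<open>Congruences modulo annihilators of monomials\<close>

lemma prod_gen_mult_gen:
  assumes "finite F" "g \<in> F"
  shows "(\<Prod>e\<in>F. gen e) * gen g = (0 :: ('e, 'k::comm_ring_1) sqfree)"
proof -
  have "(\<Prod>e\<in>F. gen e :: ('e, 'k) sqfree) * gen g = (gen g * gen g) * (\<Prod>e\<in>F - {g}. gen e)"
    using assms by (simp add: prod.remove mult_ac)
  then show ?thesis by (simp add: gen_square)
qed

text \<open>The monomial of \<open>F\<close> annihilates every generator in \<open>F\<close>, so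
  next to it a linear form only matters outside \<open>F\<close>.\<close>

lemma prod_gen_mult_sum:
  assumes "finite F" "finite E"
  shows "(\<Prod>e\<in>F. gen e) * (\<Sum>e\<in>E. scalar (l e) * gen e)
       = (\<Prod>e\<in>F. gen e) * (\<Sum>e\<in>E - F. scalar (l e) * gen e :: ('e, 'k::comm_ring_1) sqfree)"
  unfolding sum_distrib_left
proof (rule sum.mono_neutral_right)
  show "\<forall>i\<in>E - (E - F). prod gen F * (scalar (l i) * gen i) = 0"
  proof
    fix i assume "i \<in> E - (E - F)"
    then have "prod gen F * gen i = (0 :: ('e, 'k) sqfree)"
      using prod_gen_mult_gen[OF assms(1)] by blast
    then show "prod gen F * (scalar (l i) * gen i) = 0"
      by (subst mult.left_commute) simp
  qed
qed (use assms in auto)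

text \<open>The hypothesis says that \<open>u\<close> and \<open>v\<close> agree modulo the
  annihilator of \<open>z\<close>; this is an ideal, so their powers agree as well. It is applied
  with \<open>z\<close> a monomial.\<close>

lemma mult_power_cong:
  fixes z u v :: "'r::comm_ring_1"
  assumes "z * u = z * v"
  shows "z * u ^ n = z * v ^ n"
proof (induction n)
  case (Suc n)
  have "z * u ^ Suc n = (z * u) * u ^ n" by (simp add: mult_ac)
  also have "\<dots> = v * (z * u ^ n)" unfolding assms by (simp only: mult_ac)
  also have "\<dots> = z * v ^ Suc n" by (simp add: Suc mult_ac)
  finally show ?case .
qed simp

section \<open>Products of full degree\<close>

definition par :: "'e mgraph \<Rightarrow> nat set \<Rightarrow> 'e set" where
  "par G p = {e \<in> edges G. ends G e = p}"

lemma finite_par: "finite (edges G) \<Longrightarrow> finite (par G p)"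
  by (simp add: par_def)

text \<open>With as many factors as there are edges, each of order 1, any term using a higher part
  of some factor exceeds the largest possible degree.\<close>

lemma comb_power_mult:
  fixes a b :: "nat \<Rightarrow> 'k::field_char_0"
  assumes "finite (edges G)" "k + l = card (edges G)"
  shows "comb G a ^ k * comb G b ^ l = lin_form G a ^ k * lin_form G b ^ l"
proof (rule eq_if_order_ge_diff[OF assms(1)])
  have o: "order_ge (Suc n) (comb G c ^ n - lin_form G c ^ n)" for n and c :: "nat \<Rightarrow> 'k"
    by (rule order_ge_power_diff[OF comb_first_order(2)[OF assms(1)] order_ge_lin_form
          comb_first_order(1)[OF assms(1)]])
  show "order_ge (Suc (card (edges G))) (comb G a ^ k * comb G b ^ l - lin_form G a ^ k * lin_form G b ^ l)"
    by (rule order_ge_mult_diff[OF o[of k a] order_ge_power_1[OF comb_first_order(2)[OF assms(1)], of l b]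
          order_ge_power_1[OF order_ge_lin_form, of k] o[of l b]])
       (use assms(2) in simp_all)
qed (intro supported_mult supported_power supported_comb supported_lin_form)+

lemma comb_power_card:
  fixes a :: "nat \<Rightarrow> 'k::field_char_0"
  assumes "finite (edges G)"
  shows "comb G a ^ card (edges G)
       = scalar (fact (card (edges G)) * (\<Prod>e\<in>edges G. lin G a e)) * (\<Prod>e\<in>edges G. gen e)"
  using comb_power_mult[OF assms, of "card (edges G)" 0 a a]
  by (simp add: lin_form_def linear_form_power(1)[OF assms])

lemma comb_power_eq_0:
  fixes a :: "nat \<Rightarrow> 'k::field_char_0"
  assumes "finite (edges G)" "card (edges G) < n"
  shows "comb G a ^ n = 0"
  by (rule order_ge_imp_zero[OF assms(1) supported_power[OF supported_comb]
        order_ge_power_1[OF comb_first_order(2)[OF assms(1)]] assms(2)])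

lemma lin_form_restrict:
  assumes "finite (edges G)" "\<And>g. g \<in> edges G \<Longrightarrow> g \<in> F \<Longrightarrow> lin G a g = 0"
  shows "lin_form G a = (\<Sum>e\<in>edges G - F. scalar (lin G a e) * gen e)"
  unfolding lin_form_def using assms
  by (intro sum.mono_neutral_right) (auto simp: scalar_hom)

text \<open>On the hyperplane of \<open>e\<close> the linear part of \<open>comb G a\<close>
  involves only the \<open>n - card F\<close> edges outside \<open>F\<close>. Higher powers of it
  are 0, and that power itself is a multiple of the monomial of these edges, so that the other
  factors have to supply exactly the edges of \<open>F\<close>.\<close>

lemma multiplicity_product:
  fixes a b :: "nat \<Rightarrow> 'k::field_char_0"
  assumes fin: "finite (edges G)" and e: "e \<in> edges G" and a: "lin G a e = 0"
  defines "F \<equiv> par G (ends G e)"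
  defines "n \<equiv> card (edges G)"
  shows "k < card F \<Longrightarrow> comb G a ^ (n - k) * comb G b ^ k = 0"
    and "comb G a ^ (n - card F) * comb G b ^ card F
       = scalar (fact (n - card F) * (\<Prod>g\<in>edges G - F. lin G a g)
           * (fact (card F) * lin G b e ^ card F)) * (\<Prod>g\<in>edges G. gen g)"
proof -
  have F: "finite F" "F \<subseteq> edges G" using fin by (auto simp: F_def par_def)
  have la: "lin G a g = 0" if "g \<in> F" for g
    using that a lin_parallel[of G g e a] by (simp add: F_def par_def)
  have lb: "lin G b g = lin G b e" if "g \<in> F" for g
    using that lin_parallel[of G g e b] by (simp add: F_def par_def)
  have cF: "card F \<le> n" "card (edges G - F) = n - card F"
    using F fin by (simp_all add: n_def card_mono card_Diff_subset)
  have La: "lin_form G a = (\<Sum>g\<in>edges G - F. scalar (lin G a g) * gen g)"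
    using la by (intro lin_form_restrict fin)
  show "comb G a ^ (n - k) * comb G b ^ k = 0" if "k < card F"
  proof -
    have "lin_form G a ^ (n - k) = 0"
      unfolding La by (rule linear_form_power(2)) (use that cF fin in auto)
    then show ?thesis using comb_power_mult[OF fin, of "n - k" k a b] that cF by (simp add: n_def)
  qed
  have "comb G a ^ (n - card F) * comb G b ^ card F = lin_form G a ^ (n - card F) * lin_form G b ^ card F"
    using comb_power_mult[OF fin, of "n - card F" "card F" a b] cF by (simp add: n_def)
  also have "lin_form G a ^ (n - card F)
      = scalar (fact (n - card F) * (\<Prod>g\<in>edges G - F. lin G a g)) * (\<Prod>g\<in>edges G - F. gen g)"
    unfolding La cF(2)[symmetric] by (rule linear_form_power(1)) (use fin in simp)
  also have "\<dots> * lin_form G b ^ card F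
      = scalar (fact (n - card F) * (\<Prod>g\<in>edges G - F. lin G a g))
          * ((\<Prod>g\<in>edges G - F. gen g) * lin_form G b ^ card F)"
    by (simp only: mult.assoc)
  \<comment> \<open>Next to the monomial of the complement only the edges of \<open>F\<close> remain
    in the linear form, and they all carry the coefficient of \<open>e\<close>.\<close>
  also have "(\<Prod>g\<in>edges G - F. gen g) * lin_form G b ^ card F
      = (\<Prod>g\<in>edges G - F. gen g) * (\<Sum>g\<in>F. scalar (lin G b e) * gen g) ^ card F"
  proof (rule mult_power_cong)
    have "(\<Sum>g\<in>F. scalar (lin G b g) * gen g) = (\<Sum>g\<in>F. scalar (lin G b e) * gen g :: ('a, 'k) sqfree)"
      using lb by (intro sum.cong) auto
    moreover have "edges G - (edges G - F) = F" using F by blast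
    ultimately show "(\<Prod>g\<in>edges G - F. gen g) * lin_form G b
        = (\<Prod>g\<in>edges G - F. gen g) * (\<Sum>g\<in>F. scalar (lin G b e) * gen g)"
      unfolding lin_form_def using prod_gen_mult_sum[of "edges G - F" "edges G" "lin G b"] fin by simp
  qed
  also have "(\<Sum>g\<in>F. scalar (lin G b e) * gen g) ^ card F
      = scalar (fact (card F) * lin G b e ^ card F) * (\<Prod>g\<in>F. gen g)"
    using linear_form_power(1)[OF F(1), of "\<lambda>_. lin G b e"] by simp
  also have "(\<Prod>g\<in>edges G - F. gen g) * (scalar (fact (card F) * lin G b e ^ card F) * (\<Prod>g\<in>F. gen g))
      = scalar (fact (card F) * lin G b e ^ card F) * (\<Prod>g\<in>edges G. gen g)"
  proof -
    have "(\<Prod>g\<in>edges G. gen g :: ('a, 'k) sqfree) = (\<Prod>g\<in>edges G - F. gen g) * (\<Prod>g\<in>F. gen g)"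
      by (rule prod.subset_diff[OF F(2) fin])
    then show ?thesis by (simp add: mult_ac)
  qed
  finally show "comb G a ^ (n - card F) * comb G b ^ card F
       = scalar (fact (n - card F) * (\<Prod>g\<in>edges G - F. lin G a g)
           * (fact (card F) * lin G b e ^ card F)) * (\<Prod>g\<in>edges G. gen g)"
    by (simp add: scalar_hom mult.assoc)
qed

text \<open>Three factors are replaced one at a time; each of the three bounds on \<open>d\<close>
  covers the error made in one of them.\<close>

lemma order_ge_adjacency_product:
  assumes x: "order_ge k (x - x')" and x': "order_ge k' x'"
    and y: "order_ge l (y - y')" "order_ge l' y" "order_ge l' y'"
    and z: "order_ge m (z - z')" "order_ge m' z"
    and d: "d \<le> k + (l' + m')" "d \<le> k' + (l + m')" "d \<le> k' + (l' + m)"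
  shows "order_ge d (x * (y * z) - x' * (y' * z'))"
proof (rule order_ge_mult_diff[OF x order_ge_mult[OF y(2) z(2)] x' _ d(1)])
  show "order_ge (min (l + m') (l' + m)) (y * z - y' * z')"
    by (rule order_ge_mult_diff[OF y(1) z(2) y(3) z(1)]) simp_all
qed (use d in simp)

text \<open>With \<open>x\<close>, \<open>y\<close> the sums of the generators over the two parallel classes, the square
  \<open>(\<alpha> x + \<beta> y)\<^sup>2\<close> contributes only its mixed term, because \<open>x\<close> and \<open>y\<close> are nilpotent.\<close>

lemma adjacency_product:
  fixes a b c :: "nat \<Rightarrow> 'k::field_char_0"
  assumes fin: "finite (edges G)" and ef: "e \<in> edges G" "f \<in> edges G" "ends G e \<noteq> ends G f"
    and a: "lin G a e = 0" "lin G a f = 0" and b: "lin G b f = 0" and c: "lin G c e = 0"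
  defines "A \<equiv> par G (ends G e)" and "B \<equiv> par G (ends G f)"
  defines "D \<equiv> edges G - (A \<union> B)"
  shows "\<exists>K. (K \<noteq> 0 \<longleftrightarrow> (\<forall>g\<in>D. lin G a g \<noteq> 0) \<and> (lin G b e \<noteq> 0 \<or> card A = 1) \<and> (lin G c f \<noteq> 0 \<or> card B = 1)) \<and>
    comb G a ^ (card (edges G) + 1 - card A - card B) * (comb G b ^ (card A - 1) * comb G c ^ (card B - 1))
     = scalar (K * (\<Sum>i\<in>vertices G. a i * (incidence G i e * incidence G i f))) * (\<Prod>g\<in>edges G. gen g)"
proof -
  define m where "m = card A"
  define n where "n = card B"
  define p where "p = card D"
  have AB: "finite A" "finite B" "finite D" "A \<subseteq> edges G" "B \<subseteq> edges G" "A \<inter> B = {}" "e \<in> A" "f \<in> B"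
    using fin ef by (auto simp: A_def B_def D_def par_def)
  have mn: "m \<ge> 1" "n \<ge> 1" using AB by (auto simp: m_def n_def Suc_le_eq card_gt_0_iff)
  have "card (edges G) = card (A \<union> B) + card D"
    unfolding D_def using AB fin by (simp add: card_Diff_subset card_mono)
  then have card: "card (edges G) = m + n + p"
    using AB by (simp add: m_def n_def p_def card_Un_disjoint)
  have par: "g \<in> A \<Longrightarrow> lin G h g = lin G h e" "g \<in> B \<Longrightarrow> lin G h g = lin G h f"
    "g \<in> A \<Longrightarrow> incidence G i g = (incidence G i e :: 'k)"
    "g \<in> B \<Longrightarrow> incidence G i g = (incidence G i f :: 'k)" for g i and h :: "nat \<Rightarrow> 'k"
    using lin_parallel[of G g e] lin_parallel[of G g f] incidence_parallel[of G g e]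
      incidence_parallel[of G g f] by (auto simp: A_def B_def par_def)
  define La where "La = lin_form G a"
  define Q where "Q = quad_form G a"
  define Z :: "('a, 'k) sqfree" where "Z = (\<Prod>g\<in>D. gen g)"
  define x :: "('a, 'k) sqfree" where "x = (\<Sum>g\<in>A. gen g)"
  define y :: "('a, 'k) sqfree" where "y = (\<Sum>g\<in>B. gen g)"
  have La: "La = (\<Sum>g\<in>D. scalar (lin G a g) * gen g)"
    unfolding La_def D_def using a par by (intro lin_form_restrict fin) (auto simp: par)
  \<comment> \<open>Only the \<open>p\<close> edges of \<open>D\<close> are left in the linear part,
    so its power \<open>Suc p\<close> is 0 and the term with one quadratic factor takes the
    lead.\<close>
  have La_p: "La ^ p = scalar (fact p * (\<Prod>g\<in>D. lin G a g)) * Z" "La ^ Suc p = 0"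
    unfolding La p_def Z_def by (simp_all add: linear_form_power[OF AB(3)] del: power_Suc)
  have xm: "x ^ m = scalar (fact m) * (\<Prod>g\<in>A. gen g)" "x ^ Suc m = 0"
    using linear_form_power[OF AB(1), where l = "\<lambda>_. 1 :: 'k"] by (simp_all add: x_def m_def scalar_hom del: power_Suc)
  have yn: "y ^ n = scalar (fact n) * (\<Prod>g\<in>B. gen g)" "y ^ Suc n = 0"
    using linear_form_power[OF AB(2), where l = "\<lambda>_. 1 :: 'k"] by (simp_all add: y_def n_def scalar_hom del: power_Suc)
  \<comment> \<open>Modulo the annihilator of \<open>Z\<close>, every linear form that is constant
    on the two classes becomes a combination of \<open>x\<close> and \<open>y\<close>.\<close>
  have Zsum: "Z * (\<Sum>g\<in>edges G. scalar (h g) * gen g) = Z * (scalar s * x + scalar t * y)"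
    if h: "\<And>g. g \<in> A \<Longrightarrow> h g = s" "\<And>g. g \<in> B \<Longrightarrow> h g = t" for h s t
  proof -
    have "Z * (\<Sum>g\<in>edges G. scalar (h g) * gen g) = Z * (\<Sum>g\<in>edges G - D. scalar (h g) * gen g)"
      unfolding Z_def by (rule prod_gen_mult_sum[OF AB(3) fin])
    also have "edges G - D = A \<union> B" using AB by (auto simp: D_def)
    also have "(\<Sum>g\<in>A \<union> B. scalar (h g) * gen g) = (\<Sum>g\<in>A. scalar s * gen g) + (\<Sum>g\<in>B. scalar t * gen g :: ('a, 'k) sqfree)"
      using h AB by (simp add: sum.union_disjoint)
    finally show ?thesis by (simp add: x_def y_def sum_distrib_left)
  qed
  have ZX: "Z * X G i ^ 2 = Z * (scalar (incidence G i e) * x + scalar (incidence G i f) * y) ^ 2" for i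
    unfolding X_def by (rule mult_power_cong, rule Zsum) (simp_all add: par)
  have Zb: "Z * lin_form G b ^ k = Z * (scalar (lin G b e) * x) ^ k" for k
    using Zsum[of "lin G b" "lin G b e" 0] b unfolding lin_form_def
    by (intro mult_power_cong) (simp add: par scalar_hom)
  have Zc: "Z * lin_form G c ^ k = Z * (scalar (lin G c f) * y) ^ k" for k
    using Zsum[of "lin G c" 0 "lin G c f"] c unfolding lin_form_def
    by (intro mult_power_cong) (simp add: par scalar_hom)
  \<comment> \<open>The factors with weights \<open>b\<close> and \<open>c\<close> supply all but
    one generator of each class, so \<open>Q\<close> has to supply one from each.\<close>
  define W where "W = x ^ (m - 1) * y ^ (n - 1)"
  have xxW: "x * (x * W) = 0" "y * (y * W) = 0" "x * (y * W) = x ^ m * y ^ n"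
  proof -
    obtain m' n' where m'n': "m = Suc m'" "n = Suc n'" using mn by (metis Suc_le_D One_nat_def)
    have "x * (x * W) = x ^ Suc m * y ^ n'" "y * (y * W) = x ^ m' * y ^ Suc n"
      "x * (y * W) = x ^ m * y ^ n"
      by (simp_all add: W_def m'n' mult_ac)
    then show "x * (x * W) = 0" "y * (y * W) = 0" "x * (y * W) = x ^ m * y ^ n"
      unfolding xm(2) yn(2) by simp_all
  qed
  have sqW: "scalar (1 / 2) * ((scalar s * x + scalar t * y) ^ 2 * W) = scalar (s * t) * (x ^ m * y ^ n)" for s t
  proof -
    have "(scalar s * x + scalar t * y) ^ 2 * W
        = scalar s * scalar s * (x * (x * W)) + scalar t * scalar t * (y * (y * W))
          + 2 * (scalar (s * t) * (x * (y * W)))"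
      by (simp add: power2_eq_square algebra_simps scalar_hom)
    then show ?thesis by (simp add: xxW scalar_half_double)
  qed
  \<comment> \<open>Here the shared vertex enters: if the two pairs meet in \<open>w\<close>, only
    \<open>i = w\<close> contributes and the sum is \<open>a w\<close> up to sign; if they are
    disjoint, it is 0.\<close>
  define \<kappa> where "\<kappa> = (\<Sum>i\<in>vertices G. a i * (incidence G i e * incidence G i f))"
  have ZQW: "Z * (Q * W) = scalar \<kappa> * (Z * (x ^ m * y ^ n))"
  proof -
    have "Z * (Q * W) = (\<Sum>i\<in>vertices G. scalar (a i) * (scalar (1 / 2) * ((Z * X G i ^ 2) * W)))"
      by (simp add: Q_def quad_form_def sum_distrib_left sum_distrib_right mult_ac)
    also have "\<dots> = (\<Sum>i\<in>vertices G. scalar (a i) * (Z * (scalar (1 / 2) *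
        ((scalar (incidence G i e) * x + scalar (incidence G i f) * y) ^ 2 * W))))"
      unfolding ZX by (simp only: mult_ac)
    also have "\<dots> = (\<Sum>i\<in>vertices G. scalar (a i * (incidence G i e * incidence G i f)) * (Z * (x ^ m * y ^ n)))"
      unfolding sqW by (simp only: scalar_hom mult_ac)
    also have "\<dots> = scalar \<kappa> * (Z * (x ^ m * y ^ n))"
      by (rule sqfree_eqI) (simp add: \<kappa>_def sum_distrib_right)
    finally show ?thesis .
  qed
  have Zxy: "Z * (x ^ m * y ^ n) = scalar (fact m * fact n) * (\<Prod>g\<in>edges G. gen g)"
  proof -
    have "(\<Prod>g\<in>edges G. gen g :: ('a, 'k) sqfree) = Z * (\<Prod>g\<in>A \<union> B. gen g)"
      unfolding Z_def D_def using AB fin by (intro prod.subset_diff) auto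
    also have "(\<Prod>g\<in>A \<union> B. gen g) = (\<Prod>g\<in>A. gen g) * (\<Prod>g\<in>B. gen g :: ('a, 'k) sqfree)"
      using AB by (simp add: prod.union_disjoint)
    finally show ?thesis by (simp add: xm yn scalar_hom mult_ac)
  qed
  define K where "K = of_nat (Suc p) * (fact p * (\<Prod>g\<in>D. lin G a g))
      * (lin G b e ^ (m - 1) * lin G c f ^ (n - 1)) * (fact m * fact n)"
  have "comb G a ^ Suc p * (comb G b ^ (m - 1) * comb G c ^ (n - 1))
      = (of_nat (Suc p) * La ^ p * Q) * (lin_form G b ^ (m - 1) * lin_form G c ^ (n - 1))"
  proof (rule eq_if_order_ge_diff[OF fin])
    have o: "order_ge (Suc k) (comb G h ^ k - lin_form G h ^ k)" for k and h :: "nat \<Rightarrow> 'k"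
      by (rule order_ge_power_diff[OF comb_first_order(2)[OF fin] order_ge_lin_form comb_first_order(1)[OF fin]])
    have oc: "order_ge k (comb G h ^ k)" for k and h :: "nat \<Rightarrow> 'k"
      by (rule order_ge_power_1[OF comb_first_order(2)[OF fin]])
    have R: "order_ge (p + 3) (comb G a ^ Suc p - of_nat (Suc p) * La ^ p * Q)"
      using order_ge_power_second_order[OF order_ge_lin_form order_ge_quad_form comb_second_order[OF fin], of p a]
      by (simp only: La_def[symmetric] Q_def[symmetric] La_p(2) diff_zero)
    have "order_ge (p + 2) (La ^ p * Q)"
      unfolding La_def Q_def by (intro order_ge_mult order_ge_power_1 order_ge_lin_form order_ge_quad_form)
    then have R': "order_ge (p + 2) (of_nat (Suc p) * La ^ p * Q)"
      unfolding mult.assoc by (rule order_ge_mult_left)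
    \<comment> \<open>There are \<open>p + m + n\<close> edges. Replacing the first factor costs an
      error of order \<open>(p + 3) + (m - 1) + (n - 1)\<close>, the others
      \<open>(p + 2) + m + (n - 1)\<close> and \<open>(p + 2) + (m - 1) + n\<close>; each is one
      more than the number of edges.\<close>
    show "order_ge (Suc (card (edges G))) (comb G a ^ Suc p * (comb G b ^ (m - 1) * comb G c ^ (n - 1))
        - of_nat (Suc p) * La ^ p * Q * (lin_form G b ^ (m - 1) * lin_form G c ^ (n - 1)))"
      by (rule order_ge_adjacency_product[OF R R' o[of "m - 1" b] oc[of "m - 1" b]
            order_ge_power_1[OF order_ge_lin_form, of "m - 1"] o[of "n - 1" c] oc[of "n - 1" c]])
         (use mn card in simp_all)
    have "supported (edges G) (of_nat (Suc p) :: ('a, 'k) sqfree)"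
      unfolding scalar_of_nat[symmetric] by (rule supported_scalar)
    then show "supported (edges G) (of_nat (Suc p) * La ^ p * Q * (lin_form G b ^ (m - 1) * lin_form G c ^ (n - 1)))"
      unfolding La_def Q_def
      by (intro supported_mult supported_power supported_lin_form supported_quad_form)
  qed (intro supported_mult supported_power supported_comb)
  also have "\<dots> = scalar (of_nat (Suc p) * (fact p * (\<Prod>g\<in>D. lin G a g)))
      * (Q * ((Z * lin_form G b ^ (m - 1)) * lin_form G c ^ (n - 1)))"
    unfolding La_p(1) scalar_hom(3)[of "of_nat (Suc p)"] scalar_of_nat by (simp only: mult_ac)
  also have "(Z * lin_form G b ^ (m - 1)) * lin_form G c ^ (n - 1)
      = (scalar (lin G b e) * x) ^ (m - 1) * (Z * lin_form G c ^ (n - 1))"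
    unfolding Zb by (simp only: mult_ac)
  also have "\<dots> = scalar (lin G b e ^ (m - 1) * lin G c f ^ (n - 1)) * (Z * W)"
    unfolding Zc by (simp only: W_def power_mult_distrib scalar_power scalar_hom(3) mult_ac)
  also have "Q * (scalar (lin G b e ^ (m - 1) * lin G c f ^ (n - 1)) * (Z * W))
      = scalar (lin G b e ^ (m - 1) * lin G c f ^ (n - 1)) * (Z * (Q * W))"
    by (simp only: mult_ac)
  also have "scalar (of_nat (Suc p) * (fact p * (\<Prod>g\<in>D. lin G a g))) * \<dots>
      = scalar (K * \<kappa>) * (\<Prod>g\<in>edges G. gen g)"
    unfolding ZQW Zxy K_def by (simp only: scalar_hom(3) mult_ac)
  finally have "comb G a ^ Suc p * (comb G b ^ (m - 1) * comb G c ^ (n - 1))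
      = scalar (K * \<kappa>) * (\<Prod>g\<in>edges G. gen g)" .
  moreover have "card (edges G) + 1 - card A - card B = Suc p"
    using card by (simp add: m_def n_def)
  \<comment> \<open>For a class with a single edge the exponent \<open>card A - 1\<close> is 0 and
    the power is 1 whatever the weight, hence the alternatives \<open>card A = 1\<close> and
    \<open>card B = 1\<close>. The factor \<open>of_nat (Suc p)\<close> counts the positions of
    \<open>Q\<close> in the power.\<close>
  moreover have "K \<noteq> 0 \<longleftrightarrow> (\<forall>g\<in>D. lin G a g \<noteq> 0) \<and> (lin G b e \<noteq> 0 \<or> card A = 1) \<and> (lin G c f \<noteq> 0 \<or> card B = 1)"
  proof -
    have "of_nat (Suc p) \<noteq> (0::'k)" by (rule of_nat_neq_0)
    then show ?thesis using AB(3) mn unfolding K_def by (auto simp: m_def n_def)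
  qed
  ultimately show ?thesis unfolding m_def n_def \<kappa>_def by (intro exI[of _ K]) simp
qed

section \<open>Reconstructing vertices from adjacency and triangles of edges\<close>

definition star :: "nat set set \<Rightarrow> nat \<Rightarrow> nat set set" where
  "star P i = {p \<in> P. i \<in> p}"

text \<open>An isomorphism of line graphs that also matches triangles in both directions: the
  symmetric difference of two meeting pairs is the third side. The last clause excludes Whitney's
  exceptional case, in which the three edges of a triangle correspond to those of a star.\<close>

definition line_iso :: "nat set set \<Rightarrow> nat set set \<Rightarrow> (nat set \<Rightarrow> nat set) \<Rightarrow> bool" where
  "line_iso P Q \<sigma> \<longleftrightarrow> bij_betw \<sigma> P Q \<and> (\<forall>p\<in>P. card p = 2) \<and> (\<forall>q\<in>Q. card q = 2) \<and>
     (\<forall>p\<in>P. \<forall>q\<in>P. p \<noteq> q \<longrightarrow> (\<sigma> p \<inter> \<sigma> q \<noteq> {} \<longleftrightarrow> p \<inter> q \<noteq> {})) \<and>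
     (\<forall>p\<in>P. \<forall>q\<in>P. \<forall>r\<in>P. p \<inter> q \<noteq> {} \<longrightarrow> p \<noteq> q \<longrightarrow> r \<noteq> p \<longrightarrow> r \<noteq> q \<longrightarrow>
        (\<sigma> r = (\<sigma> p \<union> \<sigma> q) - (\<sigma> p \<inter> \<sigma> q) \<longleftrightarrow> r = (p \<union> q) - (p \<inter> q)))"

lemma line_iso_adj:
  assumes "line_iso P Q \<sigma>" "p \<in> P" "q \<in> P" "p \<noteq> q"
  shows "\<sigma> p \<inter> \<sigma> q \<noteq> {} \<longleftrightarrow> p \<inter> q \<noteq> {}"
proof -
  have "\<forall>p\<in>P. \<forall>q\<in>P. p \<noteq> q \<longrightarrow> (\<sigma> p \<inter> \<sigma> q \<noteq> {} \<longleftrightarrow> p \<inter> q \<noteq> {})"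
    using assms(1) unfolding line_iso_def by (elim conjE) assumption
  from bspec[OF bspec[OF this assms(2)] assms(3)] show ?thesis using assms(4) by (rule mp)
qed

lemma line_iso_tri:
  assumes "line_iso P Q \<sigma>" "p \<in> P" "q \<in> P" "r \<in> P" "p \<inter> q \<noteq> {}" "p \<noteq> q" "r \<noteq> p" "r \<noteq> q"
  shows "\<sigma> r = (\<sigma> p \<union> \<sigma> q) - (\<sigma> p \<inter> \<sigma> q) \<longleftrightarrow> r = (p \<union> q) - (p \<inter> q)"
proof -
  have "\<forall>p\<in>P. \<forall>q\<in>P. \<forall>r\<in>P. p \<inter> q \<noteq> {} \<longrightarrow> p \<noteq> q \<longrightarrow> r \<noteq> p \<longrightarrow> r \<noteq> q \<longrightarrow>
        (\<sigma> r = (\<sigma> p \<union> \<sigma> q) - (\<sigma> p \<inter> \<sigma> q) \<longleftrightarrow> r = (p \<union> q) - (p \<inter> q))"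
    using assms(1) unfolding line_iso_def by (elim conjE) assumption
  from bspec[OF bspec[OF bspec[OF this assms(2)] assms(3)] assms(4)] show ?thesis
    using assms(5-8) by (elim impE) simp_all
qed

text \<open>Symmetry is what later turns an inclusion between images of stars into an
  equality.\<close>

lemma line_iso_inv:
  assumes "line_iso P Q \<sigma>"
  shows "line_iso Q P (inv_into P \<sigma>)"
proof -
  have bij: "bij_betw \<sigma> P Q" using assms by (simp add: line_iso_def)
  define \<tau> where "\<tau> = inv_into P \<sigma>"
  have inP: "\<tau> q \<in> P" and inv: "\<sigma> (\<tau> q) = q" if "q \<in> Q" for q
    using bij_betw_apply[OF bij_betw_inv_into[OF bij] that] bij_betw_inv_into_right[OF bij that]
    by (simp_all add: \<tau>_def)
  have neq: "\<tau> q \<noteq> \<tau> q'" if "q \<in> Q" "q' \<in> Q" "q \<noteq> q'" for q q' using inv that by metis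
  have adj': "\<tau> p \<inter> \<tau> q \<noteq> {} \<longleftrightarrow> p \<inter> q \<noteq> {}" if "p \<in> Q" "q \<in> Q" "p \<noteq> q" for p q
    using line_iso_adj[OF assms inP[OF that(1)] inP[OF that(2)] neq[OF that]] inv that by simp
  have "\<tau> r = (\<tau> p \<union> \<tau> q) - (\<tau> p \<inter> \<tau> q) \<longleftrightarrow> r = (p \<union> q) - (p \<inter> q)"
    if "p \<in> Q" "q \<in> Q" "r \<in> Q" "p \<inter> q \<noteq> {}" "p \<noteq> q" "r \<noteq> p" "r \<noteq> q" for p q r
    using line_iso_tri[OF assms inP[OF that(1)] inP[OF that(2)] inP[OF that(3)]] adj'[OF that(1,2,5)]
      inv neq that by simp
  then show ?thesis
    using assms bij_betw_inv_into[OF bij] adj' unfolding line_iso_def \<tau>_def[symmetric] by simp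
qed

section \<open>Stars of vertices\<close>

lemma card_2_inter_unique:
  assumes "card p = 2" "card q = 2" "p \<noteq> q" "i \<in> p" "i \<in> q" "j \<in> p" "j \<in> q"
  shows "i = j"
  using assms by (auto simp: card_2_iff)

lemma card_2_other: "card p = 2 \<Longrightarrow> w \<in> p \<Longrightarrow> \<exists>x. p = {w, x} \<and> x \<noteq> w"
  by (auto simp: card_2_iff)

lemma star_inj:
  assumes "\<forall>p\<in>P. card p = 2" "star P i \<subseteq> star P j" "p \<in> star P i" "q \<in> star P i" "p \<noteq> q"
  shows "i = j"
  using assms card_2_inter_unique[of p q i j] by (auto simp: star_def)

text \<open>The images of pairs through \<open>i\<close> meet pairwise. Let \<open>v\<close> be the
  common vertex of the images of \<open>p\<close> and \<open>q\<close>. A third image missing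
  \<open>v\<close> would be the third side of their triangle, so its preimage would be the third
  side of the triangle on \<open>p\<close> and \<open>q\<close>, which does not contain
  \<open>i\<close>.\<close>

lemma star_image_subset:
  assumes iso: "line_iso P Q \<sigma>" and pq: "p \<in> star P i" "q \<in> star P i" "p \<noteq> q"
  shows "\<exists>v. \<sigma> ` star P i \<subseteq> star Q v"
proof -
  have bij: "bij_betw \<sigma> P Q" and c: "\<And>p. p \<in> P \<Longrightarrow> card p = 2" "\<And>q. q \<in> Q \<Longrightarrow> card q = 2"
    using iso by (auto simp: line_iso_def)
  have P: "p \<in> P" "q \<in> P" "i \<in> p" "i \<in> q" using pq by (auto simp: star_def)
  have inj: "\<sigma> r \<noteq> \<sigma> s" if "r \<in> P" "s \<in> P" "r \<noteq> s" for r s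
    using bij that by (auto simp: bij_betw_def inj_on_def)
  have mem: "\<sigma> r \<in> Q" if "r \<in> P" for r using bij that by (rule bij_betw_apply)
  have adj: "\<sigma> r \<inter> \<sigma> s \<noteq> {}" if "r \<in> star P i" "s \<in> star P i" "r \<noteq> s" for r s
    using line_iso_adj[OF iso, of r s] that by (auto simp: star_def)
  obtain v where v: "v \<in> \<sigma> p" "v \<in> \<sigma> q" using adj[OF pq] by blast
  have "v \<in> \<sigma> r" if r: "r \<in> star P i" for r
  proof (rule ccontr)
    assume nv: "v \<notin> \<sigma> r"
    then have rpq: "r \<noteq> p" "r \<noteq> q" using v by auto
    have rP: "r \<in> P" "i \<in> r" using r by (auto simp: star_def)
    obtain x where x: "\<sigma> p = {v, x}" "x \<noteq> v" using card_2_other[OF c(2)[OF mem[OF P(1)]] v(1)] by blast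
    obtain y where y: "\<sigma> q = {v, y}" "y \<noteq> v" using card_2_other[OF c(2)[OF mem[OF P(2)]] v(2)] by blast
    have xy: "x \<noteq> y" using x y inj[OF P(1,2) pq(3)] by auto
    have "x \<in> \<sigma> r" "y \<in> \<sigma> r" using adj[OF r pq(1) rpq(1)] adj[OF r pq(2) rpq(2)] nv x y by auto
    then have "\<sigma> r = {x, y}" using c(2)[OF mem[OF rP(1)]] xy by (auto simp: card_2_iff)
    then have "\<sigma> r = (\<sigma> p \<union> \<sigma> q) - (\<sigma> p \<inter> \<sigma> q)" using x y xy by auto
    moreover have "p \<inter> q \<noteq> {}" using P by blast
    ultimately have "r = (p \<union> q) - (p \<inter> q)"
      using line_iso_tri[OF iso P(1,2) rP(1) _ pq(3) rpq] by blast
    then show False using P rP by blast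
  qed
  then show ?thesis using mem by (auto simp: star_def)
qed

text \<open>The inclusion for the inverse map sends \<open>star Q v\<close> into a star of
  \<open>P\<close> that contains \<open>star P i\<close>; a vertex with two pairs is determined by
  them, so this is \<open>star P i\<close> itself.\<close>

lemma star_image:
  assumes iso: "line_iso P Q \<sigma>" and pq: "p \<in> star P i" "q \<in> star P i" "p \<noteq> q"
  shows "\<exists>v. \<sigma> ` star P i = star Q v"
proof -
  have bij: "bij_betw \<sigma> P Q" and c: "\<forall>p\<in>P. card p = 2" using iso by (auto simp: line_iso_def)
  obtain v where v: "\<sigma> ` star P i \<subseteq> star Q v" using star_image_subset[OF assms] by blast
  have P: "p \<in> P" "q \<in> P" using pq by (auto simp: star_def)
  have "\<sigma> p \<in> star Q v" "\<sigma> q \<in> star Q v" "\<sigma> p \<noteq> \<sigma> q"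
    using v pq bij P by (auto simp: bij_betw_def inj_on_def)
  then obtain j where j: "inv_into P \<sigma> ` star Q v \<subseteq> star P j"
    using star_image_subset[OF line_iso_inv[OF iso]] by blast
  have cancel: "inv_into P \<sigma> ` \<sigma> ` star P i = star P i"
    by (rule inv_into_image_cancel[OF bij_betw_imp_inj_on[OF bij]]) (auto simp: star_def)
  have "star P i \<subseteq> star P j" using image_mono[OF v, of "inv_into P \<sigma>"] j cancel by auto
  then have "i = j" using star_inj[OF c _ pq] by blast
  have "star Q v \<subseteq> \<sigma> ` star P i"
  proof
    fix r assume r: "r \<in> star Q v"
    then have "\<sigma> (inv_into P \<sigma> r) = r" using bij_betw_inv_into_right[OF bij] by (simp add: star_def)
    moreover have "inv_into P \<sigma> r \<in> star P i" using j r \<open>i = j\<close> by blast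
    ultimately show "r \<in> \<sigma> ` star P i" by (metis imageI)
  qed
  then show ?thesis using v by blast
qed

lemma star_image_unique:
  assumes iso: "line_iso P Q \<sigma>" and pq: "p \<in> star P i" "q \<in> star P i" "p \<noteq> q"
  shows "\<exists>!v. \<sigma> ` star P i = star Q v"
proof -
  have bij: "bij_betw \<sigma> P Q" and c: "\<forall>q\<in>Q. card q = 2" using iso by (auto simp: line_iso_def)
  have P: "p \<in> P" "q \<in> P" using pq by (auto simp: star_def)
  obtain v where v: "\<sigma> ` star P i = star Q v" using star_image[OF assms] by blast
  have "\<sigma> p \<in> star Q v" "\<sigma> q \<in> star Q v" "\<sigma> p \<noteq> \<sigma> q"
    using v pq bij P by (auto simp: bij_betw_def inj_on_def)
  then show ?thesis using v star_inj[OF c] by (metis subset_refl)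
qed

text \<open>A vertex is determined by its star only if the star has two members: both ends of an
  isolated edge have the same star.\<close>

definition big :: "nat set set \<Rightarrow> nat \<Rightarrow> bool" where
  "big P i \<longleftrightarrow> (\<exists>p q. p \<in> star P i \<and> q \<in> star P i \<and> p \<noteq> q)"

lemma big_vertex_bij:
  assumes iso: "line_iso P Q \<sigma>"
  shows "\<exists>\<beta>. bij_betw \<beta> {i. big P i} {v. big Q v} \<and> (\<forall>i. big P i \<longrightarrow> \<sigma> ` star P i = star Q (\<beta> i))"
proof -
  have bij: "bij_betw \<sigma> P Q" and c: "\<forall>p\<in>P. card p = 2" using iso by (auto simp: line_iso_def)
  define \<beta> where "\<beta> i = (THE v. \<sigma> ` star P i = star Q v)" for i
  have \<beta>: "\<sigma> ` star P i = star Q (\<beta> i)" if bi: "big P i" for i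
  proof -
    obtain p q where "p \<in> star P i" "q \<in> star P i" "p \<noteq> q" using bi unfolding big_def by blast
    then have "\<exists>!v. \<sigma> ` star P i = star Q v" by (rule star_image_unique[OF iso])
    then show ?thesis unfolding \<beta>_def by (rule theI')
  qed
  have cancel: "inv_into P \<sigma> ` \<sigma> ` star P i = star P i" for i
    by (rule inv_into_image_cancel[OF bij_betw_imp_inj_on[OF bij]]) (auto simp: star_def)
  have "bij_betw \<beta> {i. big P i} {v. big Q v}"
    unfolding bij_betw_def
  proof
    show "inj_on \<beta> {i. big P i}"
    proof (rule inj_onI)
      fix i j assume ij: "i \<in> {i. big P i}" "j \<in> {i. big P i}" and eq: "\<beta> i = \<beta> j"
      then have "\<sigma> ` star P i = \<sigma> ` star P j" using \<beta> by simp
      then have "star P i = star P j" using cancel by metis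
      then show "i = j" using star_inj[OF c] ij unfolding big_def by blast
    qed
    show "\<beta> ` {i. big P i} = {v. big Q v}"
    proof safe
      fix i assume "big P i"
      then obtain p q where pq: "p \<in> star P i" "q \<in> star P i" "p \<noteq> q" by (auto simp: big_def)
      then have "\<sigma> p \<noteq> \<sigma> q" using bij by (auto simp: bij_betw_def inj_on_def star_def)
      then show "big Q (\<beta> i)" using pq \<beta>[OF \<open>big P i\<close>] unfolding big_def by blast
    next
      fix v assume v: "big Q v"
      then obtain p q where pq: "p \<in> star Q v" "q \<in> star Q v" "p \<noteq> q" by (auto simp: big_def)
      obtain i where i: "inv_into P \<sigma> ` star Q v = star P i"
        using star_image[OF line_iso_inv[OF iso] pq] by blast
      have inv: "\<sigma> (inv_into P \<sigma> r) = r" if "r \<in> star Q v" for r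
        using that bij_betw_inv_into_right[OF bij] by (simp add: star_def)
      have "inv_into P \<sigma> p \<noteq> inv_into P \<sigma> q" using inv pq by metis
      then have bi: "big P i" using i pq unfolding big_def by blast
      have "\<sigma> ` star P i = star Q v" unfolding i[symmetric] image_image using inv by simp
      then have "star Q (\<beta> i) = star Q v" using \<beta>[OF bi] by simp
      then have "\<beta> i = v" using star_inj[of Q v "\<beta> i"] pq iso by (auto simp: line_iso_def)
      then show "v \<in> \<beta> ` {i. big P i}" using bi by blast
    qed
  qed
  then show ?thesis using \<beta> by blast
qed

lemma image_star_mem_iff:
  assumes "bij_betw \<sigma> P Q" "p \<in> P" "\<sigma> ` star P i = star Q v"
  shows "i \<in> p \<longleftrightarrow> v \<in> \<sigma> p"
proof -
  have "i \<in> p \<longleftrightarrow> p \<in> star P i" using assms(2) by (simp add: star_def)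
  also have "\<dots> \<longleftrightarrow> \<sigma> p \<in> \<sigma> ` star P i"
    using assms(1,2) by (auto simp: bij_betw_def inj_on_def star_def)
  also have "\<dots> \<longleftrightarrow> v \<in> \<sigma> p" unfolding assms(3) using bij_betw_apply[OF assms(1,2)] by (simp add: star_def)
  finally show ?thesis .
qed

text \<open>Vertices lying on at least two edges are read off from their stars; an edge has
  as many remaining endpoints as its image, and these are matched arbitrarily.\<close>

lemma line_iso_induced:
  assumes iso: "line_iso P Q \<sigma>"
  shows "\<exists>\<pi>. bij_betw \<pi> (\<Union>P) (\<Union>Q) \<and> (\<forall>p\<in>P. \<sigma> p = \<pi> ` p)"
proof -
  have bij: "bij_betw \<sigma> P Q" and c: "\<And>p. p \<in> P \<Longrightarrow> card p = 2" "\<And>q. q \<in> Q \<Longrightarrow> card q = 2"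
    using iso by (auto simp: line_iso_def)
  have mem: "\<sigma> p \<in> Q" if "p \<in> P" for p using bij that by (rule bij_betw_apply)
  obtain \<beta> where \<beta>: "bij_betw \<beta> {i. big P i} {v. big Q v}"
    "\<And>i. big P i \<Longrightarrow> \<sigma> ` star P i = star Q (\<beta> i)"
    using big_vertex_bij[OF iso] by blast
  define leaf where "leaf R p = {i \<in> p. \<not> big R i}" for R :: "nat set set" and p
  have fin: "finite p" if "p \<in> P \<or> p \<in> Q" for p using that c card_ge_0_finite[of p] by auto
  have big_image: "\<beta> ` {i \<in> p. big P i} = {v \<in> \<sigma> p. big Q v}" if p: "p \<in> P" for p
  proof -
    have "i \<in> p \<longleftrightarrow> \<beta> i \<in> \<sigma> p" if "big P i" for i using image_star_mem_iff[OF bij p \<beta>(2)[OF that]] .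
    then show ?thesis using \<beta>(1) by (fastforce simp: bij_betw_def)
  qed
  have "card (leaf P p) = card (leaf Q (\<sigma> p))" if p: "p \<in> P" for p
  proof -
    have "card {i \<in> p. big P i} = card {v \<in> \<sigma> p. big Q v}"
      unfolding big_image[OF p, symmetric]
      using \<beta>(1) by (intro card_image[symmetric]) (auto simp: bij_betw_def inj_on_def)
    moreover have "card p = card {i \<in> p. big P i} + card (leaf P p)"
    proof -
      have "p = {i \<in> p. big P i} \<union> leaf P p" by (auto simp: leaf_def)
      moreover have "{i \<in> p. big P i} \<inter> leaf P p = {}" by (auto simp: leaf_def)
      ultimately show ?thesis using fin p by (metis (no_types, lifting) card_Un_disjoint finite_Un)
    qed
    moreover have "card (\<sigma> p) = card {i \<in> \<sigma> p. big Q i} + card (leaf Q (\<sigma> p))"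
    proof -
      have "\<sigma> p = {i \<in> \<sigma> p. big Q i} \<union> leaf Q (\<sigma> p)" by (auto simp: leaf_def)
      moreover have "{i \<in> \<sigma> p. big Q i} \<inter> leaf Q (\<sigma> p) = {}" by (auto simp: leaf_def)
      ultimately show ?thesis using fin mem p by (metis (no_types, lifting) card_Un_disjoint finite_Un)
    qed
    ultimately show ?thesis using c(1)[OF p] c(2)[OF mem[OF p]] by linarith
  qed
  then have "\<exists>g. bij_betw g (leaf P p) (leaf Q (\<sigma> p))" if "p \<in> P" for p
    using that fin mem by (intro finite_same_card_bij) (auto simp: leaf_def)
  then obtain g where g: "\<And>p. p \<in> P \<Longrightarrow> bij_betw (g p) (leaf P p) (leaf Q (\<sigma> p))" by metis
  \<comment> \<open>A vertex that is not big lies on a single pair, so the bijections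
    \<open>g p\<close> chosen separately for each pair never compete for the same vertex.\<close>
  have leaf_unique: "p = q" if "p \<in> R" "q \<in> R" "i \<in> leaf R p" "i \<in> q" for R p q i
    using that by (auto simp: leaf_def big_def star_def)
  define \<pi> where "\<pi> i = (if big P i then \<beta> i else g (THE p. p \<in> P \<and> i \<in> p) i)" for i
  have \<pi>_big: "\<pi> i = \<beta> i" if "big P i" for i using that by (simp add: \<pi>_def)
  have \<pi>_leaf: "\<pi> i = g p i" if "p \<in> P" "i \<in> leaf P p" for p i
  proof -
    have "(THE p. p \<in> P \<and> i \<in> p) = p"
    proof (rule the_equality)
      show "p \<in> P \<and> i \<in> p" using that by (simp add: leaf_def)
      show "q = p" if "q \<in> P \<and> i \<in> q" for q
        using leaf_unique[of p P q i] that \<open>p \<in> P\<close> \<open>i \<in> leaf P p\<close> by blast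
    qed
    then show ?thesis using that by (simp add: \<pi>_def leaf_def)
  qed
  have split: "p = {i \<in> p. big R i} \<union> leaf R p" for R p by (auto simp: leaf_def)
  have image: "\<sigma> p = \<pi> ` p" if p: "p \<in> P" for p
  proof -
    have "\<pi> ` p = \<pi> ` {i \<in> p. big P i} \<union> \<pi> ` leaf P p" using split[of p P] by (metis image_Un)
    also have "\<pi> ` {i \<in> p. big P i} = \<beta> ` {i \<in> p. big P i}" by (intro image_cong) (auto simp: \<pi>_big)
    also have "\<pi> ` leaf P p = g p ` leaf P p" using \<pi>_leaf[OF p] by (intro image_cong) auto
    also have "g p ` leaf P p = leaf Q (\<sigma> p)" using g[OF p] by (simp add: bij_betw_def)
    finally show ?thesis using big_image[OF p] split[of "\<sigma> p" Q] by simp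
  qed
  have "\<pi> ` \<Union>P = \<Union>Q"
  proof -
    have "\<pi> ` \<Union>P = \<Union>(\<sigma> ` P)" using image by auto
    then show ?thesis using bij by (simp add: bij_betw_def)
  qed
  moreover have "inj_on \<pi> (\<Union>P)"
  proof (rule inj_onI)
    fix i j assume ij: "i \<in> \<Union>P" "j \<in> \<Union>P" and eq: "\<pi> i = \<pi> j"
    obtain p q where pq: "p \<in> P" "i \<in> p" "q \<in> P" "j \<in> q" using ij by blast
    \<comment> \<open>Big vertices go to big ones and leaves to leaves, so a collision of
      \<open>\<pi>\<close> could only occur within one of the two kinds.\<close>
    have big_iff: "big Q (\<pi> k) \<longleftrightarrow> big P k" if "r \<in> P" "k \<in> r" for k r
    proof (cases "big P k")
      case True
      then show ?thesis using \<beta>(1) \<pi>_big by (auto simp: bij_betw_def)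
    next
      case False
      then have k: "k \<in> leaf P r" using that by (simp add: leaf_def)
      then have "\<pi> k \<in> leaf Q (\<sigma> r)" using \<pi>_leaf[OF that(1) k] bij_betw_apply[OF g[OF that(1)] k] by simp
      then show ?thesis using False by (simp add: leaf_def)
    qed
    show "i = j"
    proof (cases "big P i")
      case True
      then have "big P j" using big_iff pq eq by metis
      then show ?thesis using True eq \<beta>(1) by (auto simp: \<pi>_big bij_betw_def inj_on_def)
    next
      case False
      then have "\<not> big P j" using big_iff[OF pq(1,2)] big_iff[OF pq(3,4)] eq by simp
      then have l: "i \<in> leaf P p" "j \<in> leaf P q" using False pq by (simp_all add: leaf_def)
      have im: "\<pi> i \<in> leaf Q (\<sigma> p)" "\<pi> j \<in> leaf Q (\<sigma> q)"
        using \<pi>_leaf[OF pq(1) l(1)] bij_betw_apply[OF g[OF pq(1)] l(1)]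
          \<pi>_leaf[OF pq(3) l(2)] bij_betw_apply[OF g[OF pq(3)] l(2)] by simp_all
      then have "\<sigma> p = \<sigma> q"
        using leaf_unique[of "\<sigma> p" Q "\<sigma> q" "\<pi> i"] mem pq eq by (auto simp: leaf_def)
      then have "p = q" using bij pq by (auto simp: bij_betw_def inj_on_def)
      then show ?thesis
        using eq \<pi>_leaf[OF pq(1)] l g[OF pq(1)] by (auto simp: bij_betw_def inj_on_def)
    qed
  qed
  ultimately show ?thesis using image by (auto simp: bij_betw_def)
qed

section \<open>Intrinsic description of hyperplanes, multiplicities and adjacency\<close>

text \<open>Products of length at most one are 1 and the \<open>Y\<^sub>i\<close>. Writing the
  latter as \<open>1 + (expX G i - 1)\<close> shows that the piece consists of scalars plus values
  of \<open>comb\<close>, and the constant term isolates the scalar.\<close>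

lemma first_piece_augmentation:
  fixes G :: "'e mgraph"
  assumes fin: "finite (edges G)"
  shows "range (comb G) = {x \<in> F_real G 1. coeff x {} = (0::'k::field_char_0)}"
proof
  have one: "(1 :: ('e, 'k) sqfree) \<in> F_real G 1"
    using F_real_closed(4)[OF fin, of "[]"] by simp
  have neg: "x - y \<in> F_real G 1" if "x \<in> F_real G 1" "y \<in> F_real G 1" for x y :: "('e, 'k) sqfree"
    using F_real_closed(2)[OF fin that(1) F_real_closed(3)[OF fin that(2), of "- 1"]]
    by (simp add: scalar_hom)
  have sum: "(\<Sum>i\<in>I. x i) \<in> F_real G 1" if "\<And>i. i \<in> I \<Longrightarrow> x i \<in> F_real G 1"
    for I :: "nat set" and x :: "nat \<Rightarrow> ('e, 'k) sqfree"
    using that by (induction I rule: infinite_finite_induct) (auto intro: F_real_closed[OF fin])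
  have "comb G a \<in> F_real G 1" for a :: "nat \<Rightarrow> 'k"
    unfolding comb_def
  proof (intro sum F_real_closed(3)[OF fin] neg one)
    show "expX G i \<in> F_real G 1" if "i \<in> vertices G" for i
      using F_real_closed(4)[OF fin, of "[i]" 1] that by simp
  qed
  then show "range (comb G) \<subseteq> {x \<in> F_real G 1. coeff x {} = (0::'k)}"
    using comb_first_order(2)[OF fin] by (auto simp: order_ge_1_iff)
  have ex: "\<exists>b a. x = scalar b + comb G a" if "x \<in> F_real G 1" for x :: "('e, 'k) sqfree"
    using fin that
  proof (induction rule: F_real_induct)
    case zero
    show ?case by (rule exI[of _ 0], rule exI[of _ "\<lambda>_. 0"]) (simp add: comb_def scalar_hom)
  next
    case (prod "is")
    show ?case
    proof (cases "is")
      case Nil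
      then show ?thesis
        by (intro exI[of _ 1] exI[of _ "\<lambda>_. 0"]) (simp add: comb_def scalar_hom)
    next
      case (Cons i js)
      then have i: "is = [i]" "i \<in> vertices G" using prod by auto
      have "comb G (\<lambda>j. if j = i then 1 else 0)
          = (\<Sum>j\<in>vertices G. if j = i then expX G i - 1 else 0 :: ('e, 'k) sqfree)"
        unfolding comb_def by (intro sum.cong) (auto simp: scalar_hom)
      then show ?thesis using i
        by (intro exI[of _ 1] exI[of _ "\<lambda>j. if j = i then 1 else 0"]) (simp add: scalar_hom)
    qed
  next
    case (add x y)
    then obtain b a b' a' where "x = scalar b + comb G a" "y = scalar b' + comb G a'" by blast
    then have "x + y = scalar (b + b') + comb G (\<lambda>i. a i + 1 * a' i)"
      unfolding comb_linear by (simp add: scalar_hom)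
    then show ?case by blast
  next
    case (smult c x)
    then obtain b a where "x = scalar b + comb G a" by blast
    then have "scalar c * x = scalar (c * b) + comb G (\<lambda>i. 0 + c * a i)"
      unfolding comb_linear by (simp add: scalar_hom distrib_left comb_def)
    then show ?case by blast
  qed
  show "{x \<in> F_real G 1. coeff x {} = (0::'k)} \<subseteq> range (comb G)"
  proof safe
    fix x :: "('e, 'k) sqfree" assume "x \<in> F_real G 1" and x0: "coeff x {} = 0"
    then obtain b a where x: "x = scalar b + comb G a" using ex by blast
    have "coeff (comb G a) {} = 0" using comb_first_order(2)[OF fin, of a] by (simp add: order_ge_1_iff)
    then have "b = 0" using x x0 by (simp add: scalar.rep_eq)
    then show "x \<in> range (comb G)" using x by (simp add: scalar_hom)
  qed
qed

section \<open>Hyperplanes of adjacent pairs\<close>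

definition pairs :: "'e mgraph \<Rightarrow> nat set set" where
  "pairs G = ends G ` edges G"

text \<open>Phrased through coefficients of the element rather than through weights, because
  different weights can give the same element.\<close>

definition hyp :: "'e mgraph \<Rightarrow> nat set \<Rightarrow> ('e, 'k::field) sqfree set" where
  "hyp G p = {v \<in> range (comb G). \<forall>e\<in>par G p. coeff v {e} = 0}"

lemma comb_in_hyp_lin:
  fixes a :: "nat \<Rightarrow> 'k::field_char_0"
  assumes "finite (edges G)" "e \<in> edges G"
  shows "comb G a \<in> hyp G (ends G e) \<longleftrightarrow> lin G a e = 0"
proof -
  have "coeff (comb G a) {g} = lin G a e" if "g \<in> par G (ends G e)" for g
    using that coeff_comb[OF assms(1), of g a] lin_parallel[of G g e a] by (simp add: par_def)
  moreover have "e \<in> par G (ends G e)" using assms by (simp add: par_def)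
  ultimately show ?thesis unfolding hyp_def by auto
qed

lemma comb_in_hyp_iff:
  fixes a :: "nat \<Rightarrow> 'k::field_char_0"
  assumes "loopless_multigraph G" "p \<in> pairs G"
  shows "comb G a \<in> hyp G p \<longleftrightarrow> (\<forall>u\<in>p. \<forall>v\<in>p. a u = a v)"
proof -
  obtain e where e: "e \<in> edges G" "p = ends G e" using assms(2) by (auto simp: pairs_def)
  show ?thesis unfolding e(2) comb_in_hyp_lin[OF loopless_finite[OF assms(1)] e(1)]
    by (rule lin_eq_0_iff[OF assms(1) e(1)])
qed

lemma hyp_subset: "hyp G p \<subseteq> range (comb G)"
  by (auto simp: hyp_def)

lemma range_comb_linear:
  "u \<in> range (comb G) \<Longrightarrow> v \<in> range (comb G) \<Longrightarrow> u + scalar c * v \<in> range (comb G)"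
proof -
  assume "u \<in> range (comb G)" "v \<in> range (comb G)"
  then obtain a b where "u = comb G a" "v = comb G b" by blast
  then have "u + scalar c * v = comb G (\<lambda>i. a i + c * b i)" by (simp only: comb_linear)
  then show ?thesis by (simp only: rangeI)
qed

lemma hyp_linear: "u \<in> hyp G p \<Longrightarrow> v \<in> hyp G p \<Longrightarrow> u + scalar c * v \<in> hyp G p"
proof -
  assume uv: "u \<in> hyp G p" "v \<in> hyp G p"
  then have "u + scalar c * v \<in> range (comb G)"
    by (intro range_comb_linear subsetD[OF hyp_subset])
  then show ?thesis using uv unfolding hyp_def by simp
qed

lemma zero_in_hyp: "(0 :: ('e, 'k::field) sqfree) \<in> hyp G p"
proof -
  have "comb G (\<lambda>_. 0) = (0 :: ('e, 'k) sqfree)" by (simp add: comb_def scalar_hom)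
  then have "(0 :: ('e, 'k) sqfree) \<in> range (comb G)" by (metis rangeI)
  then show ?thesis by (simp add: hyp_def)
qed

lemma pairs_card:
  assumes "loopless_multigraph G" "p \<in> pairs G"
  shows "card p = 2" "p \<subseteq> vertices G"
proof -
  obtain e where e: "e \<in> edges G" "p = ends G e" using assms(2) unfolding pairs_def by blast
  show "card p = 2" "p \<subseteq> vertices G"
    using assms(1) e(1) unfolding e(2) loopless_multigraph_def by blast+
qed

lemma finite_pairs: "finite (edges G) \<Longrightarrow> finite (pairs G)"
  by (simp add: pairs_def)

lemma scalar_mult_prod_gen_eq_0_iff:
  "finite E \<Longrightarrow> scalar c * (\<Prod>e\<in>E. gen e) = 0 \<longleftrightarrow> c = 0"
proof
  assume "finite E" "scalar c * (\<Prod>e\<in>E. gen e) = 0"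
  then have "coeff (scalar c * (\<Prod>e\<in>E. gen e)) E = 0" by simp
  then show "c = 0" using \<open>finite E\<close> by (simp only: coeff_scalar_mult coeff_prod_gen) simp
qed (simp add: scalar_hom)

text \<open>The union of all hyperplanes is thus described by the vanishing of a power, which an
  isomorphism respects; single hyperplanes are separated from the union afterwards.\<close>

lemma power_card_nonzero_iff:
  fixes v :: "('e, 'k::field_char_0) sqfree"
  assumes "loopless_multigraph G" "v \<in> range (comb G)"
  shows "v ^ card (edges G) \<noteq> 0 \<longleftrightarrow> (\<forall>p\<in>pairs G. v \<notin> hyp G p)"
proof -
  have fin: "finite (edges G)" using assms(1) by (rule loopless_finite)
  obtain a where v: "v = comb G a" using assms(2) by blast
  have "v ^ card (edges G) \<noteq> 0 \<longleftrightarrow> (\<forall>e\<in>edges G. lin G a e \<noteq> 0)"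
    unfolding v comb_power_card[OF fin] using fin by (simp add: scalar_mult_prod_gen_eq_0_iff)
  then show ?thesis by (auto simp: pairs_def v comb_in_hyp_lin[OF fin])
qed

lemma exists_generic:
  assumes "loopless_multigraph G"
  shows "\<exists>v\<in>range (comb G). v ^ card (edges G) \<noteq> (0 :: ('e, 'k::field_char_0) sqfree)"
proof -
  \<comment> \<open>The vertex numbers serve as weights, and characteristic zero keeps them
    distinct.\<close>
  let ?v = "comb G (\<lambda>i. of_nat i) :: ('e, 'k) sqfree"
  have "?v \<notin> hyp G p" if p: "p \<in> pairs G" for p
  proof -
    obtain i j where "p = {i, j}" "i \<noteq> j" using pairs_card(1)[OF assms p] by (auto simp: card_2_iff)
    then show ?thesis unfolding comb_in_hyp_iff[OF assms p] by auto
  qed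
  then have "?v ^ card (edges G) \<noteq> 0" using power_card_nonzero_iff[OF assms, of ?v] by blast
  then show ?thesis by blast
qed

section \<open>Inclusions between hyperplanes\<close>

text \<open>It is enough to find a set that contains or misses each of \<open>p\<close> and
  \<open>q\<close> but splits \<open>r\<close>, and to take its indicator: \<open>p\<close>,
  \<open>q\<close>, \<open>p \<union> q\<close> or a single vertex of \<open>r\<close> always works
  outside the excluded triangle. The case \<open>p = q\<close> is included and yields the comparison
  of two hyperplanes.\<close>

lemma separating_weights:
  fixes p q r :: "nat set"
  assumes "card p = 2" "card q = 2" "card r = 2" "r \<noteq> p" "r \<noteq> q"
    "\<not> (p \<inter> q \<noteq> {} \<and> r = (p \<union> q) - (p \<inter> q))"
  shows "\<exists>a :: nat \<Rightarrow> 'k::field_char_0. (\<forall>u\<in>p. \<forall>v\<in>p. a u = a v) \<and> (\<forall>u\<in>q. \<forall>v\<in>q. a u = a v)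
           \<and> \<not> (\<forall>u\<in>r. \<forall>v\<in>r. a u = a v)"
proof -
  define ind :: "nat set \<Rightarrow> nat \<Rightarrow> 'k" where "ind S u = (if u \<in> S then 1 else 0)" for S u
  have ind: "(\<forall>u\<in>S. \<forall>v\<in>S. ind T u = ind T v) \<longleftrightarrow> S \<subseteq> T \<or> S \<inter> T = {}" for S T
    by (auto simp: ind_def)
  obtain k l where hr: "r = {k, l}" "k \<noteq> l" using assms(3) by (auto simp: card_2_iff)
  have fin: "finite p" "finite q" using assms(1,2) by (auto intro: card_ge_0_finite)
  have rpq: "\<not> r \<subseteq> p" "\<not> r \<subseteq> q"
    using card_subset_eq[OF fin(1), of r] card_subset_eq[OF fin(2), of r] assms(1-5) by auto
  have "\<not> r \<subseteq> p \<union> q" if "p \<inter> q \<noteq> {}"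
  proof
    assume sub: "r \<subseteq> p \<union> q"
    obtain w where w: "w \<in> p" "w \<in> q" using \<open>p \<inter> q \<noteq> {}\<close> by blast
    obtain s where s: "p = {w, s}" "s \<noteq> w" using card_2_other[OF assms(1) w(1)] by blast
    obtain t where t: "q = {w, t}" "t \<noteq> w" using card_2_other[OF assms(2) w(2)] by blast
    have "r = {s, t}" using sub rpq hr unfolding s(1) t(1) by auto
    moreover from this hr have "s \<noteq> t" by (auto simp: doubleton_eq_iff)
    ultimately have "r = (p \<union> q) - (p \<inter> q)" using s t by auto
    then show False using assms(6) \<open>p \<inter> q \<noteq> {}\<close> by blast
  qed
  then have "(p \<inter> q = {} \<and> \<not> (r \<subseteq> p \<or> r \<inter> p = {})) \<or> (p \<inter> q = {} \<and> \<not> (r \<subseteq> q \<or> r \<inter> q = {}))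
      \<or> \<not> (r \<subseteq> p \<union> q \<or> r \<inter> (p \<union> q) = {}) \<or> r \<inter> (p \<union> q) = {}"
    using rpq by blast
  then consider (P) "p \<inter> q = {}" "\<not> (r \<subseteq> p \<or> r \<inter> p = {})" | (Q) "p \<inter> q = {}" "\<not> (r \<subseteq> q \<or> r \<inter> q = {})"
    | (U) "\<not> (r \<subseteq> p \<union> q \<or> r \<inter> (p \<union> q) = {})" | (none) "r \<inter> (p \<union> q) = {}"
    by blast
  then show ?thesis
  proof cases
    case P
    then have "p \<subseteq> p \<or> p \<inter> p = {}" "q \<subseteq> p \<or> q \<inter> p = {}" "\<not> (r \<subseteq> p \<or> r \<inter> p = {})" by blast+
    then show ?thesis unfolding ind[symmetric] by blast
  next
    case Q
    then have "p \<subseteq> q \<or> p \<inter> q = {}" "q \<subseteq> q \<or> q \<inter> q = {}" "\<not> (r \<subseteq> q \<or> r \<inter> q = {})" by blast+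
    then show ?thesis unfolding ind[symmetric] by blast
  next
    case U
    then have "p \<subseteq> p \<union> q \<or> p \<inter> (p \<union> q) = {}" "q \<subseteq> p \<union> q \<or> q \<inter> (p \<union> q) = {}"
      "\<not> (r \<subseteq> p \<union> q \<or> r \<inter> (p \<union> q) = {})" by blast+
    then show ?thesis unfolding ind[symmetric] by blast
  next
    case none
    then have "p \<subseteq> {k} \<or> p \<inter> {k} = {}" "q \<subseteq> {k} \<or> q \<inter> {k} = {}" "\<not> (r \<subseteq> {k} \<or> r \<inter> {k} = {})"
      using hr by blast+
    then show ?thesis unfolding ind[symmetric] by blast
  qed
qed

lemma hyp_subset_iff:
  assumes "loopless_multigraph G" "p \<in> pairs G" "q \<in> pairs G"
  shows "hyp G p \<subseteq> (hyp G q :: ('e, 'k::field_char_0) sqfree set) \<longleftrightarrow> p = q"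
proof
  assume sub: "hyp G p \<subseteq> (hyp G q :: ('e, 'k) sqfree set)"
  show "p = q"
  proof (rule ccontr)
    assume "p \<noteq> q"
    \<comment> \<open>With \<open>p\<close> in both places the third side of the triangle would be
      the empty set.\<close>
    moreover have "\<not> (p \<inter> p \<noteq> {} \<and> q = p \<union> p - p \<inter> p)"
      using pairs_card(1)[OF assms(1,3)] by auto
    ultimately obtain a :: "nat \<Rightarrow> 'k" where
      a: "\<forall>u\<in>p. \<forall>v\<in>p. a u = a v" "\<not> (\<forall>u\<in>q. \<forall>v\<in>q. a u = a v)"
      using separating_weights[of p p q, where 'k = 'k, OF pairs_card(1)[OF assms(1,2)]
          pairs_card(1)[OF assms(1,2)] pairs_card(1)[OF assms(1,3)]] by blast
    then show False
      using subsetD[OF sub, of "comb G a"]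
      unfolding comb_in_hyp_iff[OF assms(1,2)] comb_in_hyp_iff[OF assms(1,3)] by blast
  qed
qed simp

lemma hyp_inter_subset_iff:
  assumes "loopless_multigraph G" "p \<in> pairs G" "q \<in> pairs G" "r \<in> pairs G" "r \<noteq> p" "r \<noteq> q"
  shows "hyp G p \<inter> hyp G q \<subseteq> (hyp G r :: ('e, 'k::field_char_0) sqfree set)
       \<longleftrightarrow> p \<inter> q \<noteq> {} \<and> r = (p \<union> q) - (p \<inter> q)"
proof
  assume sub: "hyp G p \<inter> hyp G q \<subseteq> (hyp G r :: ('e, 'k) sqfree set)"
  show "p \<inter> q \<noteq> {} \<and> r = (p \<union> q) - (p \<inter> q)"
  proof (rule ccontr)
    assume "\<not> ?thesis"
    then obtain a :: "nat \<Rightarrow> 'k" where "\<forall>u\<in>p. \<forall>v\<in>p. a u = a v" "\<forall>u\<in>q. \<forall>v\<in>q. a u = a v"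
      "\<not> (\<forall>u\<in>r. \<forall>v\<in>r. a u = a v)"
      using separating_weights[of p q r, where 'k = 'k, OF pairs_card(1)[OF assms(1,2)]
          pairs_card(1)[OF assms(1,3)] pairs_card(1)[OF assms(1,4)] assms(5,6)] by blast
    then show False
      using subsetD[OF sub, of "comb G a"] unfolding Int_iff comb_in_hyp_iff[OF assms(1,2)]
        comb_in_hyp_iff[OF assms(1,3)] comb_in_hyp_iff[OF assms(1,4)] by blast
  qed
next
  assume pq: "p \<inter> q \<noteq> {} \<and> r = (p \<union> q) - (p \<inter> q)"
  then obtain w where w: "w \<in> p" "w \<in> q" by blast
  show "hyp G p \<inter> hyp G q \<subseteq> (hyp G r :: ('e, 'k) sqfree set)"
  proof
    fix v :: "('e, 'k) sqfree" assume v: "v \<in> hyp G p \<inter> hyp G q"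
    then obtain a where a: "v = comb G a" using hyp_subset by blast
    have "a u = a w" if "u \<in> r" for u
      using that v w pq unfolding a Int_iff comb_in_hyp_iff[OF assms(1,2)]
        comb_in_hyp_iff[OF assms(1,3)] by blast
    then show "v \<in> hyp G r" unfolding a comb_in_hyp_iff[OF assms(1,4)] by metis
  qed
qed

section \<open>Multiplicity and adjacency through products\<close>

text \<open>The multiplicity is the least \<open>k\<close> for which such a product can be nonzero.
  This mentions only the hyperplane and the vanishing of products, both of which an isomorphism
  transports.\<close>

lemma multiplicity_char:
  fixes G :: "'e mgraph"
  assumes "loopless_multigraph G" "p \<in> pairs G"
  defines "n \<equiv> card (edges G)"
  shows "\<exists>R\<in>hyp G p. \<exists>T\<in>range (comb G). R ^ (n - card (par G p)) * T ^ card (par G p) \<noteq> (0 :: ('e, 'k::field_char_0) sqfree)"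
    and "\<lbrakk>R \<in> hyp G p; T \<in> range (comb G); R ^ (n - k) * T ^ k \<noteq> (0 :: ('e, 'k) sqfree)\<rbrakk>
      \<Longrightarrow> card (par G p) \<le> k"
proof -
  have fin: "finite (edges G)" using assms(1) by (rule loopless_finite)
  obtain e where e: "e \<in> edges G" "ends G e = p" using assms(2) by (auto simp: pairs_def)
  show "card (par G p) \<le> k"
    if RT: "R \<in> hyp G p" "T \<in> range (comb G)" "R ^ (n - k) * T ^ k \<noteq> (0 :: ('e, 'k) sqfree)"
  proof (rule ccontr)
    assume "\<not> card (par G p) \<le> k"
    then have k: "k < card (par G (ends G e))" using e by simp
    obtain a b where ab: "R = comb G a" "T = comb G b" using RT hyp_subset by blast
    then have "lin G a e = 0" using RT comb_in_hyp_lin[OF fin e(1), of a] e by simp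
    then show False
      using multiplicity_product(1)[OF fin e(1), of a k b] k RT(3) by (simp add: ab n_def)
  qed
  obtain i j where ij: "p = {i, j}" "i \<noteq> j" using pairs_card(1)[OF assms(1,2)] by (auto simp: card_2_iff)
  \<comment> \<open>The weight is 0 on \<open>p\<close> and takes distinct nonzero values elsewhere,
    so \<open>p\<close> is the only pair on which it is constant; \<open>b\<close> separates all
    vertices.\<close>
  define a :: "nat \<Rightarrow> 'k" where "a u = (if u \<in> p then 0 else of_nat (Suc u))" for u
  define b :: "nat \<Rightarrow> 'k" where "b u = of_nat u" for u
  have a: "comb G a \<in> hyp G p" unfolding comb_in_hyp_iff[OF assms(1,2)] by (simp add: a_def)
  then have la: "lin G a e = 0" using comb_in_hyp_lin[OF fin e(1), of a] e by simp
  have lb: "lin G b e \<noteq> 0" unfolding lin_eq_0_iff[OF assms(1) e(1)] using e ij by (auto simp: b_def)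
  have lag: "lin G a g \<noteq> 0" if g: "g \<in> edges G - par G p" for g
  proof -
    have "g \<in> edges G" "ends G g \<noteq> p" using g by (auto simp: par_def)
    moreover obtain k l where kl: "ends G g = {k, l}" "k \<noteq> l"
      using edge_ends[OF assms(1)] calculation(1) by (metis less_irrefl)
    ultimately have "a k \<noteq> a l" unfolding a_def ij by (auto simp del: of_nat_Suc)
    then show ?thesis unfolding lin_eq_0_iff[OF assms(1) \<open>g \<in> edges G\<close>] using kl by auto
  qed
  have "comb G a ^ (n - card (par G p)) * comb G b ^ card (par G p) \<noteq> 0"
    using multiplicity_product(2)[OF fin e(1) la, of b] lb lag fin
    by (simp add: e n_def scalar_mult_prod_gen_eq_0_iff)
  then show "\<exists>R\<in>hyp G p. \<exists>T\<in>range (comb G).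
      R ^ (n - card (par G p)) * T ^ card (par G p) \<noteq> (0 :: ('e, 'k) sqfree)"
    using a by blast
qed

text \<open>The premise excludes triangles in intrinsic terms. If a third hyperplane contained the
  intersection, \<open>R\<close> would have coefficient 0 at its edges and every such product would
  vanish, even for pairs that meet.\<close>

lemma adjacency_char:
  fixes G :: "'e mgraph"
  assumes "loopless_multigraph G" "p \<in> pairs G" "q \<in> pairs G" "p \<noteq> q"
    and no_third: "\<And>r. r \<in> pairs G \<Longrightarrow> r \<noteq> p \<Longrightarrow> r \<noteq> q \<Longrightarrow>
      \<not> hyp G p \<inter> hyp G q \<subseteq> (hyp G r :: ('e, 'k::field_char_0) sqfree set)"
  shows "(\<exists>R\<in>hyp G p \<inter> hyp G q. \<exists>S\<in>hyp G q. \<exists>T\<in>hyp G p.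
            R ^ (card (edges G) + 1 - card (par G p) - card (par G q))
              * (S ^ (card (par G p) - 1) * T ^ (card (par G q) - 1)) \<noteq> (0 :: ('e, 'k) sqfree))
         \<longleftrightarrow> p \<inter> q \<noteq> {}"
proof -
  have fin: "finite (edges G)" using assms(1) by (rule loopless_finite)
  obtain e where e: "e \<in> edges G" "ends G e = p" using assms(2) by (auto simp: pairs_def)
  obtain f where f: "f \<in> edges G" "ends G f = q" using assms(3) by (auto simp: pairs_def)
  have ef: "ends G e \<noteq> ends G f" using e f assms(4) by simp
  let ?\<kappa> = "\<lambda>a. \<Sum>i\<in>vertices G. a i * (incidence G i e * incidence G i f :: 'k)"
  note prod = adjacency_product[OF fin e(1) f(1) ef, unfolded e f, where 'k = 'k]
  have inc: "incidence G i e * incidence G i f \<noteq> (0::'k) \<longleftrightarrow> i \<in> p \<inter> q" for i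
    using incidence_nonzero_iff[OF assms(1) e(1), of i, where 'k = 'k]
      incidence_nonzero_iff[OF assms(1) f(1), of i, where 'k = 'k] e f by simp
  show ?thesis
  proof
    assume "\<exists>R\<in>hyp G p \<inter> hyp G q. \<exists>S\<in>hyp G q. \<exists>T\<in>hyp G p.
            R ^ (card (edges G) + 1 - card (par G p) - card (par G q))
              * (S ^ (card (par G p) - 1) * T ^ (card (par G q) - 1)) \<noteq> (0 :: ('e, 'k) sqfree)"
    then obtain R S T where RST: "R \<in> hyp G p" "R \<in> hyp G q" "S \<in> hyp G q" "T \<in> hyp G p"
      "R ^ (card (edges G) + 1 - card (par G p) - card (par G q))
              * (S ^ (card (par G p) - 1) * T ^ (card (par G q) - 1)) \<noteq> (0 :: ('e, 'k) sqfree)"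
      by blast
    obtain a where a: "R = comb G a" using RST(1) hyp_subset by blast
    obtain b where b: "S = comb G b" using RST(3) hyp_subset by blast
    obtain c where c: "T = comb G c" using RST(4) hyp_subset by blast
    note abc = a b c
    have "lin G a e = 0" "lin G a f = 0" "lin G b f = 0" "lin G c e = 0"
      using RST comb_in_hyp_lin[OF fin e(1), of a] comb_in_hyp_lin[OF fin f(1), of a]
        comb_in_hyp_lin[OF fin f(1), of b] comb_in_hyp_lin[OF fin e(1), of c] e f
      by (auto simp: abc)
    from prod[OF this] RST(5) have "?\<kappa> a \<noteq> 0"
      unfolding abc by (auto simp: scalar_hom)
    then obtain i where "a i * (incidence G i e * incidence G i f) \<noteq> 0"
      by (meson sum.not_neutral_contains_not_neutral)
    then show "p \<inter> q \<noteq> {}" using inc[of i] by auto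
  next
    assume "p \<inter> q \<noteq> {}"
    then obtain w where w: "w \<in> p" "w \<in> q" by blast
    have cp: "card p = 2" "card q = 2" using pairs_card(1)[OF assms(1)] assms(2,3) by auto
    obtain x where x: "p = {w, x}" "x \<noteq> w" using cp(1) w(1) by (auto simp: card_2_iff)
    obtain y where y: "q = {w, y}" "y \<noteq> w" using cp(2) w(2) by (auto simp: card_2_iff)
    have xy: "x \<noteq> y" using x y assms(4) by auto
    have pq: "p \<inter> q = {w}" using x y xy by auto
    \<comment> \<open>The common value on \<open>w\<close>, \<open>x\<close>, \<open>y\<close> is 1
      and not 0, because the mixed quadratic term is multiplied by \<open>a w\<close>; all other
      vertices get distinct values different from 1. The weights \<open>b\<close> and
      \<open>c\<close> mark the ends that the two pairs do not share.\<close>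
    define a :: "nat \<Rightarrow> 'k" where "a u = (if u \<in> {w, x, y} then 1 else of_nat (Suc (Suc u)))" for u
    define b :: "nat \<Rightarrow> 'k" where "b u = (if u = x then 1 else 0)" for u
    define c :: "nat \<Rightarrow> 'k" where "c u = (if u = y then 1 else 0)" for u
    have hyps: "comb G a \<in> hyp G p" "comb G a \<in> hyp G q" "comb G b \<in> hyp G q" "comb G c \<in> hyp G p"
      unfolding comb_in_hyp_iff[OF assms(1,2)] comb_in_hyp_iff[OF assms(1,3)]
      using x y xy by (auto simp: a_def b_def c_def)
    then have lins: "lin G a e = 0" "lin G a f = 0" "lin G b f = 0" "lin G c e = 0"
      using comb_in_hyp_lin[OF fin e(1), of a] comb_in_hyp_lin[OF fin f(1), of a]
        comb_in_hyp_lin[OF fin f(1), of b] comb_in_hyp_lin[OF fin e(1), of c] e f by auto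
    have "lin G b e \<noteq> 0" "lin G c f \<noteq> 0"
      unfolding lin_eq_0_iff[OF assms(1) e(1)] lin_eq_0_iff[OF assms(1) f(1)]
      using e f x y xy by (auto simp: b_def c_def)
    moreover have "lin G a g \<noteq> 0" if g: "g \<in> edges G - (par G p \<union> par G q)" for g
    proof -
      have g': "g \<in> edges G" "ends G g \<noteq> p" "ends G g \<noteq> q" using g by (auto simp: par_def)
      have gp: "ends G g \<in> pairs G" using g' by (simp add: pairs_def)
      have "\<not> hyp G p \<inter> hyp G q \<subseteq> (hyp G (ends G g) :: ('e, 'k) sqfree set)"
        using no_third[OF gp g'(2,3)] .
      then have third: "ends G g \<noteq> (p \<union> q) - (p \<inter> q)"
        using hyp_inter_subset_iff[OF assms(1-3) gp g'(2,3)] pq by blast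
      obtain k l where kl: "ends G g = {k, l}" "k \<noteq> l"
        using edge_ends[OF assms(1) g'(1)] by (metis less_irrefl)
      \<comment> \<open>Inside \<open>{w, x, y}\<close> the only pairs are \<open>p\<close>,
        \<open>q\<close> and the third side, and the third side is not the pair of any edge
        here.\<close>
      have "\<not> {k, l} \<subseteq> {w, x, y}"
        using kl third g'(2,3) x y xy by auto
      moreover have "of_nat (Suc (Suc u)) \<noteq> (1::'k)" for u
        by (metis One_nat_def Suc_inject Zero_not_Suc of_nat_1 of_nat_eq_iff)
      ultimately have "a k \<noteq> a l" unfolding a_def using kl(2)
        by (auto simp del: of_nat_Suc)
      then show ?thesis unfolding lin_eq_0_iff[OF assms(1) g'(1)] using kl by auto
    qed
    moreover have "?\<kappa> a \<noteq> 0"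
    proof -
      have "w \<in> vertices G" using pairs_card(2)[OF assms(1,2)] w by auto
      moreover have "(\<Sum>i\<in>vertices G - {w}. a i * (incidence G i e * incidence G i f)) = 0"
        using inc pq by (intro sum.neutral) force
      ultimately have "?\<kappa> a = a w * (incidence G w e * incidence G w f)"
        by (simp add: sum.remove)
      then show ?thesis using inc[of w] w by (simp add: a_def)
    qed
    ultimately have "comb G a ^ (card (edges G) + 1 - card (par G p) - card (par G q))
        * (comb G b ^ (card (par G p) - 1) * comb G c ^ (card (par G q) - 1)) \<noteq> 0"
      using prod[OF lins] fin by (auto simp: scalar_mult_prod_gen_eq_0_iff)
    then show "\<exists>R\<in>hyp G p \<inter> hyp G q. \<exists>S\<in>hyp G q. \<exists>T\<in>hyp G p.
            R ^ (card (edges G) + 1 - card (par G p) - card (par G q))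
              * (S ^ (card (par G p) - 1) * T ^ (card (par G q) - 1)) \<noteq> (0 :: ('e, 'k) sqfree)"
      using hyps by blast
  qed
qed

section \<open>From filtered isomorphisms to graph isomorphisms\<close>

text \<open>A vector space over an infinite field is not a finite union of proper subspaces: a
  vector good for all but one functional is moved along a vector on which the last one is nonzero,
  and only finitely many multiples are bad.\<close>

lemma avoid_hyperplanes:
  fixes S :: "('e, 'k::field_char_0) sqfree set" and l :: "'q \<Rightarrow> ('e, 'k) sqfree \<Rightarrow> 'k"
  assumes "finite Q" "S \<noteq> {}"
    and closed: "\<And>u v c. u \<in> S \<Longrightarrow> v \<in> S \<Longrightarrow> u + scalar c * v \<in> S"
    and linear: "\<And>q u v c. q \<in> Q \<Longrightarrow> u \<in> S \<Longrightarrow> v \<in> S \<Longrightarrow> l q (u + scalar c * v) = l q u + c * l q v"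
    and nonzero: "\<And>q. q \<in> Q \<Longrightarrow> \<exists>u\<in>S. l q u \<noteq> 0"
  shows "\<exists>u\<in>S. \<forall>q\<in>Q. l q u \<noteq> 0"
  using assms(1) linear nonzero
proof (induction Q rule: finite_induct)
  case empty
  then show ?case using assms(2) by auto
next
  case (insert q Q)
  then obtain u where u: "u \<in> S" "\<forall>r\<in>Q. l r u \<noteq> 0" by blast
  obtain w where w: "w \<in> S" "l q w \<noteq> 0" using insert.prems(2) by blast
  show ?case
  proof (cases "l q u = 0")
    case True
    \<comment> \<open>The value 0 is excluded for the new functional, the quotients for the old
      ones. Where \<open>l r w\<close> is 0, the quotient is 0 by convention and excludes nothing
      more; there the value at \<open>u\<close> does not change.\<close>
    have "finite (insert 0 ((\<lambda>r. - l r u / l r w) ` Q))" using insert by simp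
    then obtain c where c: "c \<notin> insert 0 ((\<lambda>r. - l r u / l r w) ` Q)"
      using ex_new_if_finite[OF infinite_UNIV_char_0] by blast
    have "l r (u + scalar c * w) \<noteq> 0" if r: "r \<in> insert q Q" for r
    proof -
      have eq: "l r (u + scalar c * w) = l r u + c * l r w" using insert.prems(1)[OF r u(1) w(1)] .
      show ?thesis
      proof (cases "r = q")
        case True
        then show ?thesis using eq \<open>l q u = 0\<close> w(2) c by simp
      next
        case False
        then have "l r u \<noteq> 0" "c \<noteq> - l r u / l r w" using r u(2) c by auto
        then show ?thesis unfolding eq by (cases "l r w = 0") (auto simp: field_simps add_eq_0_iff)
      qed
    qed
    then show ?thesis using closed[OF u(1) w(1)] by blast
  qed (use u in auto)
qed

section \<open>The invariant data on nilpotent elements\<close>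

text \<open>Products leave the space of values of \<open>comb\<close>, so only their vanishing is
  recorded. Three powers are enough because the adjacency test uses three elements; multiplicities
  use two and the edge count one.\<close>

definition V_iso :: "'e mgraph \<Rightarrow> 'f mgraph \<Rightarrow> (('e, 'k::field) sqfree \<Rightarrow> ('f, 'k) sqfree) \<Rightarrow> bool" where
  "V_iso G H F \<longleftrightarrow> bij_betw F (range (comb G)) (range (comb H)) \<and>
     (\<forall>u\<in>range (comb G). \<forall>v\<in>range (comb G). \<forall>c. F (u + scalar c * v) = F u + scalar c * F v) \<and>
     (\<forall>u\<in>range (comb G). \<forall>v\<in>range (comb G). \<forall>w\<in>range (comb G). \<forall>i j k.
        F u ^ i * (F v ^ j * F w ^ k) = 0 \<longleftrightarrow> u ^ i * (v ^ j * w ^ k) = 0)"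

lemma V_isoD:
  assumes "V_iso G H F"
  shows "bij_betw F (range (comb G)) (range (comb H))"
    and "u \<in> range (comb G) \<Longrightarrow> v \<in> range (comb G) \<Longrightarrow> F (u + scalar c * v) = F u + scalar c * F v"
    and "u \<in> range (comb G) \<Longrightarrow> v \<in> range (comb G) \<Longrightarrow> w \<in> range (comb G) \<Longrightarrow>
      F u ^ i * (F v ^ j * F w ^ k) = 0 \<longleftrightarrow> u ^ i * (v ^ j * w ^ k) = 0"
    and "u \<in> range (comb G) \<Longrightarrow> F u \<in> range (comb H)"
    and "u \<in> range (comb G) \<Longrightarrow> F u ^ i = 0 \<longleftrightarrow> u ^ i = 0"
proof -
  show bij: "bij_betw F (range (comb G)) (range (comb H))"
    using assms unfolding V_iso_def by (elim conjE)
  show "F (u + scalar c * v) = F u + scalar c * F v" if "u \<in> range (comb G)" "v \<in> range (comb G)"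
  proof -
    have "\<forall>u\<in>range (comb G). \<forall>v\<in>range (comb G). \<forall>c. F (u + scalar c * v) = F u + scalar c * F v"
      using assms unfolding V_iso_def by (elim conjE)
    from bspec[OF bspec[OF this that(1)] that(2)] show ?thesis by (rule spec)
  qed
  show prod: "F u ^ i * (F v ^ j * F w ^ k) = 0 \<longleftrightarrow> u ^ i * (v ^ j * w ^ k) = 0"
    if "u \<in> range (comb G)" "v \<in> range (comb G)" "w \<in> range (comb G)" for u v w i j k
  proof -
    have "\<forall>u\<in>range (comb G). \<forall>v\<in>range (comb G). \<forall>w\<in>range (comb G). \<forall>i j k.
        F u ^ i * (F v ^ j * F w ^ k) = 0 \<longleftrightarrow> u ^ i * (v ^ j * w ^ k) = 0"
      using assms unfolding V_iso_def by (elim conjE)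
    from bspec[OF bspec[OF bspec[OF this that(1)] that(2)] that(3)] show ?thesis by simp
  qed
  show "F u \<in> range (comb H)" if "u \<in> range (comb G)" using bij that by (rule bij_betw_apply)
  show "F u ^ i = 0 \<longleftrightarrow> u ^ i = 0" if "u \<in> range (comb G)"
    using prod[OF that that that, of i 0 0] by simp
qed

lemma V_isoI:
  assumes "bij_betw F (range (comb G)) (range (comb H))"
    and "\<And>u v c. u \<in> range (comb G) \<Longrightarrow> v \<in> range (comb G) \<Longrightarrow> F (u + scalar c * v) = F u + scalar c * F v"
    and "\<And>u v w i j k. u \<in> range (comb G) \<Longrightarrow> v \<in> range (comb G) \<Longrightarrow> w \<in> range (comb G) \<Longrightarrow>
      F u ^ i * (F v ^ j * F w ^ k) = 0 \<longleftrightarrow> u ^ i * (v ^ j * w ^ k) = 0"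
  shows "V_iso G H F"
  unfolding V_iso_def by (intro conjI ballI allI assms)

text \<open>Thanks to this symmetry each invariant below needs only one inequality or
  inclusion.\<close>

lemma V_iso_inv:
  assumes "V_iso G H F"
  shows "V_iso H G (inv_into (range (comb G)) F)"
proof -
  note bij = V_isoD(1)[OF assms]
  define J where "J = inv_into (range (comb G)) F"
  have J: "J y \<in> range (comb G)" "F (J y) = y" if "y \<in> range (comb H)" for y
    using bij_betw_apply[OF bij_betw_inv_into[OF bij] that] bij_betw_inv_into_right[OF bij that]
    by (simp_all only: J_def)
  have JF: "J (F x) = x" if "x \<in> range (comb G)" for x
    unfolding J_def by (rule bij_betw_inv_into_left[OF bij that])
  have lin: "J (u + scalar c * v) = J u + scalar c * J v"
    if uv: "u \<in> range (comb H)" "v \<in> range (comb H)" for u v c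
  proof -
    have "J (F (J u + scalar c * J v)) = J u + scalar c * J v"
      by (intro JF range_comb_linear J uv)
    then show ?thesis unfolding V_isoD(2)[OF assms J(1)[OF uv(1)] J(1)[OF uv(2)]] J(2)[OF uv(1)] J(2)[OF uv(2)] .
  qed
  have prod: "J u ^ i * (J v ^ j * J w ^ k) = 0 \<longleftrightarrow> u ^ i * (v ^ j * w ^ k) = 0"
    if uvw: "u \<in> range (comb H)" "v \<in> range (comb H)" "w \<in> range (comb H)" for u v w i j k
    using V_isoD(3)[OF assms J(1)[OF uvw(1)] J(1)[OF uvw(2)] J(1)[OF uvw(3)], of i j k]
    unfolding J(2)[OF uvw(1)] J(2)[OF uvw(2)] J(2)[OF uvw(3)] by (rule sym)
  show ?thesis unfolding J_def[symmetric]
    by (rule V_isoI[OF bij_betw_inv_into[OF bij, folded J_def] lin prod])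
qed

text \<open>Expresses the vanishing of the constant term by ring operations alone, so that any
  isomorphism respects it.\<close>

lemma nilpotent_iff:
  fixes x :: "('e, 'k::field_char_0) sqfree"
  assumes "finite E" "supported E x"
  shows "(\<exists>k. x ^ k = 0) \<longleftrightarrow> coeff x {} = 0"
proof
  assume "\<exists>k. x ^ k = 0"
  then obtain k where k: "x ^ k = 0" by blast
  have "coeff (x ^ k) {} = coeff x {} ^ k" by (induction k) (simp_all add: coeff_one)
  then have "coeff x {} ^ k = 0" using k by simp
  then show "coeff x {} = 0" by simp
next
  assume "coeff x {} = 0"
  then have "order_ge 1 x" by (simp add: order_ge_1_iff)
  then have "x ^ Suc (card E) = 0"
    using order_ge_imp_zero[OF assms(1) supported_power[OF assms(2)] order_ge_power_1] by blast
  then show "\<exists>k. x ^ k = 0" by blast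
qed

text \<open>The map preserves the first piece and nilpotency, hence the space of values of
  \<open>comb\<close>; vanishing of products is transferred by injectivity and
  \<open>F 0 = 0\<close>.\<close>

lemma filtered_sqfree_iso_imp_V_iso:
  fixes F :: "('e, 'k::field_char_0) sqfree \<Rightarrow> ('f, 'k) sqfree"
  assumes iso: "filtered_sqfree_iso G H F" and fin: "finite (edges G)" "finite (edges H)"
  shows "V_iso G H F"
proof -
  have F: "bij_betw F (K_real G) (K_real H)" "F 1 = 1"
    "\<And>x y. x \<in> K_real G \<Longrightarrow> y \<in> K_real G \<Longrightarrow> F (x + y) = F x + F y"
    "\<And>x y. x \<in> K_real G \<Longrightarrow> y \<in> K_real G \<Longrightarrow> F (x * y) = F x * F y"
    "\<And>c x. x \<in> K_real G \<Longrightarrow> F (scalar c * x) = scalar c * F x"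
    "\<And>k. F ` F_real G k = F_real H k"
    using iso by (simp_all add: filtered_sqfree_iso_def)
  have pow: "F (x ^ k) = F x ^ k" if x: "x \<in> K_real G" for x k
    by (induction k) (simp_all add: F(2) F(4)[OF x K_real_power[OF fin(1) x]])
  have "F 0 = 0" using F(5)[OF K_real_closed(1)[OF fin(1)], of 0] by (simp add: scalar_hom)
  then have zero: "F x = 0 \<longleftrightarrow> x = 0" if "x \<in> K_real G" for x
    using F(1) that K_real_closed(2)[OF fin(1)] by (metis bij_betw_imp_inj_on inj_onD)
  have mem: "F x \<in> K_real H" if "x \<in> K_real G" for x using F(1) that by (rule bij_betw_apply)
  have aug: "coeff (F x) {} = 0 \<longleftrightarrow> coeff x {} = 0" if x: "x \<in> K_real G" for x
  proof -
    have "F x ^ k = 0 \<longleftrightarrow> x ^ k = 0" for k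
      unfolding pow[OF x, symmetric] by (rule zero[OF K_real_power[OF fin(1) x]])
    then show ?thesis
      using nilpotent_iff[OF fin(1) supported_K_real[OF fin(1) x]]
        nilpotent_iff[OF fin(2) supported_K_real[OF fin(2) mem[OF x]]] by simp
  qed
  have V1: "range (comb G) = {x \<in> F_real G 1. coeff x {} = (0::'k)}"
    by (rule first_piece_augmentation[OF fin(1)])
  have V2: "range (comb H) = {x \<in> F_real H 1. coeff x {} = (0::'k)}"
    by (rule first_piece_augmentation[OF fin(2)])
  note V = V1 V2
  have sub: "x \<in> K_real G" if "x \<in> range (comb G)" for x :: "('e, 'k) sqfree"
    using subsetD[OF F_real_subset[of G 1], of x] that unfolding V by simp
  have "F ` range (comb G) = range (comb H)"
  proof
    show "F ` range (comb G) \<subseteq> range (comb H)"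
    proof
      fix y assume "y \<in> F ` range (comb G)"
      then obtain x where x: "x \<in> range (comb G)" "y = F x" by (rule imageE) blast
      then have "x \<in> F_real G 1" "coeff x {} = 0" unfolding V by simp_all
      then have "F x \<in> F_real H 1" "coeff (F x) {} = 0"
        using F(6)[of 1] aug[OF sub[OF x(1)]] by blast+
      then show "y \<in> range (comb H)" unfolding V x(2) by simp
    qed
    show "range (comb H) \<subseteq> F ` range (comb G)"
    proof
      fix y :: "('f, 'k) sqfree" assume "y \<in> range (comb H)"
      then have y: "y \<in> F_real H 1" "coeff y {} = 0" unfolding V by auto
      then obtain x where x: "x \<in> F_real G 1" "y = F x" using F(6)[of 1] by blast
      then have "coeff x {} = 0" using aug[OF subsetD[OF F_real_subset x(1)]] y by simp
      then have "x \<in> range (comb G)" unfolding V using x(1) by simp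
      then show "y \<in> F ` range (comb G)" unfolding x(2) by (rule imageI)
    qed
  qed
  then have bij: "bij_betw F (range (comb G)) (range (comb H))"
    using inj_on_subset[OF bij_betw_imp_inj_on[OF F(1)] subsetI[OF sub]] unfolding bij_betw_def by blast
  have lin: "F (u + scalar c * v) = F u + scalar c * F v"
    if "u \<in> range (comb G)" "v \<in> range (comb G)" for u v c
    using that[THEN sub] by (simp add: F(3,5) K_real_closed(5)[OF fin(1)])
  have prod: "F u ^ i * (F v ^ j * F w ^ k) = 0 \<longleftrightarrow> u ^ i * (v ^ j * w ^ k) = 0"
    if "u \<in> range (comb G)" "v \<in> range (comb G)" "w \<in> range (comb G)" for u v w i j k
  proof -
    note K = K_real_power[OF fin(1) that(1)[THEN sub], of i] K_real_power[OF fin(1) that(2)[THEN sub], of j]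
      K_real_power[OF fin(1) that(3)[THEN sub], of k]
    have "F (u ^ i * (v ^ j * w ^ k)) = F u ^ i * (F v ^ j * F w ^ k)"
      using F(4)[OF K(1) K_real_closed(4)[OF fin(1) K(2,3)]] F(4)[OF K(2,3)] pow that[THEN sub] by simp
    then show ?thesis
      using zero[OF K_real_closed(4)[OF fin(1) K(1) K_real_closed(4)[OF fin(1) K(2,3)]]] by simp
  qed
  show ?thesis by (rule V_isoI[OF bij lin prod])
qed

section \<open>Transport of hyperplanes\<close>

lemma hyp_iff_coeff:
  fixes v :: "('e, 'k::field_char_0) sqfree"
  assumes "finite (edges G)" "e \<in> edges G" "v \<in> range (comb G)"
  shows "v \<in> hyp G (ends G e) \<longleftrightarrow> coeff v {e} = 0"
proof -
  obtain a where v: "v = comb G a" using assms(3) by blast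
  show ?thesis unfolding v comb_in_hyp_lin[OF assms(1,2)] coeff_comb[OF assms(1,2)] ..
qed

text \<open>The number of edges is the largest exponent with a nonzero power: generic weights attain
  it, and degree reasons forbid more.\<close>

lemma V_iso_card_edges_le:
  fixes F :: "('e, 'k::field_char_0) sqfree \<Rightarrow> ('f, 'k) sqfree"
  assumes "V_iso G H F" "loopless_multigraph G" "loopless_multigraph H"
  shows "card (edges G) \<le> card (edges H)"
proof -
  obtain v :: "('e, 'k) sqfree" where v: "v \<in> range (comb G)" "v ^ card (edges G) \<noteq> 0"
    using exists_generic[OF assms(2)] by blast
  obtain b where b: "F v = comb H b" using V_isoD(4)[OF assms(1) v(1)] by blast
  have "comb H b ^ card (edges G) \<noteq> 0" using V_isoD(5)[OF assms(1) v(1)] v(2) b by simp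
  then show ?thesis using comb_power_eq_0[OF loopless_finite[OF assms(3)]] linorder_not_less by blast
qed

lemma V_iso_card_edges:
  fixes F :: "('e, 'k::field_char_0) sqfree \<Rightarrow> ('f, 'k) sqfree"
  assumes "V_iso G H F" "loopless_multigraph G" "loopless_multigraph H"
  shows "card (edges G) = card (edges H)"
  using V_iso_card_edges_le[OF assms] V_iso_card_edges_le[OF V_iso_inv[OF assms(1)] assms(3,2)]
  by (rule antisym)

text \<open>If the image of a hyperplane lay in none of those of \<open>H\<close>, some element
  \<open>u\<close> of it would have an image off all of them. The top power of that image is
  nonzero, while the top power of \<open>u\<close> is 0.\<close>

lemma V_iso_hyp_subset:
  fixes F :: "('e, 'k::field_char_0) sqfree \<Rightarrow> ('f, 'k) sqfree"
  assumes "V_iso G H F" "loopless_multigraph G" "loopless_multigraph H" "p \<in> pairs G"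
  shows "\<exists>q\<in>pairs H. F ` hyp G p \<subseteq> hyp H q"
proof (rule ccontr)
  assume neg: "\<not> ?thesis"
  have finH: "finite (edges H)" using assms(3) by (rule loopless_finite)
  \<comment> \<open>One edge per pair is fixed, so that a single coefficient becomes the linear
    functional defining the hyperplane.\<close>
  define e where "e q = (SOME f. f \<in> edges H \<and> ends H f = q)" for q
  have e: "e q \<in> edges H" "ends H (e q) = q" if "q \<in> pairs H" for q
  proof -
    have "\<exists>f. f \<in> edges H \<and> ends H f = q" using that by (auto simp: pairs_def)
    then have "e q \<in> edges H \<and> ends H (e q) = q" unfolding e_def by (rule someI_ex)
    then show "e q \<in> edges H" "ends H (e q) = q" by auto
  qed
  have sub: "u \<in> range (comb G)" if "u \<in> hyp G p" for u :: "('e, 'k) sqfree"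
    using that hyp_subset by blast
  have coeff: "F u \<in> hyp H q \<longleftrightarrow> coeff (F u) {e q} = 0" if "u \<in> hyp G p" "q \<in> pairs H" for u q
    using hyp_iff_coeff[OF finH e(1)[OF that(2)] V_isoD(4)[OF assms(1) sub[OF that(1)]]] e(2)[OF that(2)]
    by simp
  have "\<exists>u\<in>hyp G p. \<forall>q\<in>pairs H. coeff (F u) {e q} \<noteq> 0"
  proof (rule avoid_hyperplanes)
    show "hyp G p \<noteq> ({} :: ('e, 'k) sqfree set)" using zero_in_hyp by blast
    show "u + scalar c * v \<in> hyp G p" if "u \<in> hyp G p" "v \<in> hyp G p" for u v :: "('e, 'k) sqfree" and c
      using that by (rule hyp_linear)
    show "coeff (F (u + scalar c * v)) {e q} = coeff (F u) {e q} + c * coeff (F v) {e q}"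
      if "u \<in> hyp G p" "v \<in> hyp G p" for q u v c
      by (simp add: V_isoD(2)[OF assms(1) sub[OF that(1)] sub[OF that(2)]])
    show "\<exists>u\<in>hyp G p. coeff (F u) {e q} \<noteq> 0" if q: "q \<in> pairs H" for q
    proof -
      obtain u where "u \<in> hyp G p" "F u \<notin> hyp H q" using neg q by blast
      then show ?thesis using coeff[OF _ q] by blast
    qed
  qed (rule finite_pairs[OF finH])
  then obtain u where u: "u \<in> hyp G p" "\<forall>q\<in>pairs H. F u \<notin> hyp H q" using coeff by blast
  have "F u ^ card (edges H) \<noteq> 0"
    using power_card_nonzero_iff[OF assms(3) V_isoD(4)[OF assms(1) sub[OF u(1)]]] u(2) by blast
  then have "u ^ card (edges G) \<noteq> 0"
    using V_isoD(5)[OF assms(1) sub[OF u(1)]] V_iso_card_edges[OF assms(1-3)] by simp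
  then show False using power_card_nonzero_iff[OF assms(2) sub[OF u(1)]] u(1) assms(4) by blast
qed

text \<open>Going forth and back puts the hyperplane of \<open>p\<close> inside that of some
  \<open>r\<close>; distinct hyperplanes are incomparable, so \<open>r = p\<close> and both
  inclusions are equalities.\<close>

lemma V_iso_hyp:
  fixes F :: "('e, 'k::field_char_0) sqfree \<Rightarrow> ('f, 'k) sqfree"
  assumes "V_iso G H F" "loopless_multigraph G" "loopless_multigraph H" "p \<in> pairs G"
  shows "\<exists>q\<in>pairs H. F ` hyp G p = hyp H q"
proof -
  let ?J = "inv_into (range (comb G)) F"
  note bij = V_isoD(1)[OF assms(1)]
  obtain q where q: "q \<in> pairs H" "F ` hyp G p \<subseteq> hyp H q" using V_iso_hyp_subset[OF assms] by blast
  obtain r where r: "r \<in> pairs G" "?J ` hyp H q \<subseteq> hyp G r"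
    using V_iso_hyp_subset[OF V_iso_inv[OF assms(1)] assms(3,2) q(1)] by blast
  have "hyp G p \<subseteq> (hyp G r :: ('e, 'k) sqfree set)"
  proof
    fix u :: "('e, 'k) sqfree" assume u: "u \<in> hyp G p"
    then have "?J (F u) \<in> hyp G r" using q r by blast
    then show "u \<in> hyp G r" using bij_betw_inv_into_left[OF bij] u hyp_subset by force
  qed
  then have "p = r" using hyp_subset_iff[OF assms(2,4) r(1)] by blast
  have "hyp H q \<subseteq> F ` hyp G p"
  proof
    fix y :: "('f, 'k) sqfree" assume y: "y \<in> hyp H q"
    then have "F (?J y) = y" using bij_betw_inv_into_right[OF bij] hyp_subset by blast
    moreover have "?J y \<in> hyp G p" using y r \<open>p = r\<close> by blast
    ultimately show "y \<in> F ` hyp G p" by (metis imageI)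
  qed
  then show ?thesis using q by blast
qed

lemma V_iso_pairs_bij:
  fixes F :: "('e, 'k::field_char_0) sqfree \<Rightarrow> ('f, 'k) sqfree"
  assumes "V_iso G H F" "loopless_multigraph G" "loopless_multigraph H"
  shows "\<exists>\<sigma>. bij_betw \<sigma> (pairs G) (pairs H) \<and> (\<forall>p\<in>pairs G. F ` hyp G p = hyp H (\<sigma> p))"
proof -
  let ?J = "inv_into (range (comb G)) F"
  note bij = V_isoD(1)[OF assms(1)]
  obtain \<sigma> where \<sigma>: "\<And>p. p \<in> pairs G \<Longrightarrow> \<sigma> p \<in> pairs H \<and> F ` hyp G p = hyp H (\<sigma> p)"
    using V_iso_hyp[OF assms] by metis
  have JF: "?J ` F ` hyp G p = hyp G p" for p
    by (rule inv_into_image_cancel[OF bij_betw_imp_inj_on[OF bij] hyp_subset])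
  have "inj_on \<sigma> (pairs G)"
  proof (rule inj_onI)
    fix p q assume pq: "p \<in> pairs G" "q \<in> pairs G" "\<sigma> p = \<sigma> q"
    then have "F ` hyp G p = F ` hyp G q" using \<sigma> by simp
    then have "hyp G p = (hyp G q :: ('e, 'k) sqfree set)" using JF by metis
    then show "p = q" using hyp_subset_iff[OF assms(2) pq(1,2)] by blast
  qed
  moreover have "pairs H \<subseteq> \<sigma> ` pairs G"
  proof
    fix q assume q: "q \<in> pairs H"
    obtain p where p: "p \<in> pairs G" "?J ` hyp H q = hyp G p"
      using V_iso_hyp[OF V_iso_inv[OF assms(1)] assms(3,2) q] by blast
    have "F ` ?J ` hyp H q = hyp H q"
      by (rule image_inv_into_cancel[OF _ hyp_subset]) (use bij in \<open>simp add: bij_betw_def\<close>)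
    then have "hyp H (\<sigma> p) = (hyp H q :: ('f, 'k) sqfree set)" using \<sigma>[OF p(1)] p(2) by simp
    then have "\<sigma> p = q" using hyp_subset_iff[OF assms(3) _ q, of "\<sigma> p"] \<sigma>[OF p(1)] by blast
    then show "q \<in> \<sigma> ` pairs G" using p by blast
  qed
  ultimately have "bij_betw \<sigma> (pairs G) (pairs H)" using \<sigma> by (auto simp: bij_betw_def)
  then show ?thesis using \<sigma> by blast
qed

section \<open>Transport of multiplicities, triangles and adjacency\<close>

lemma V_iso_inv_hyp:
  fixes F :: "('e, 'k::field_char_0) sqfree \<Rightarrow> ('f, 'k) sqfree"
  assumes "V_iso G H F" "F ` hyp G p = hyp H q"
  shows "inv_into (range (comb G)) F ` hyp H q = hyp G p"
  unfolding assms(2)[symmetric]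
  by (rule inv_into_image_cancel[OF bij_betw_imp_inj_on[OF V_isoD(1)[OF assms(1)]] hyp_subset])

text \<open>A nonzero product is carried to a nonzero product with the same exponents, so the least
  exponent for \<open>H\<close> cannot exceed that for \<open>G\<close>.\<close>

lemma V_iso_mult_le:
  fixes F :: "('e, 'k::field_char_0) sqfree \<Rightarrow> ('f, 'k) sqfree"
  assumes "V_iso G H F" "loopless_multigraph G" "loopless_multigraph H" "p \<in> pairs G" "q \<in> pairs H"
    "F ` hyp G p = hyp H q"
  shows "card (par H q) \<le> card (par G p)"
proof -
  let ?k = "card (par G p)"
  obtain R T :: "('e, 'k) sqfree" where RT: "R \<in> hyp G p" "T \<in> range (comb G)"
    "R ^ (card (edges G) - ?k) * T ^ ?k \<noteq> 0"
    using multiplicity_char(1)[OF assms(2,4)] by blast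
  have R: "R \<in> range (comb G)" using RT(1) hyp_subset by blast
  have "F R ^ (card (edges G) - ?k) * F T ^ ?k \<noteq> 0"
    using V_isoD(3)[OF assms(1) R RT(2,2), of "card (edges G) - ?k" ?k 0] RT(3) by simp
  moreover have "F R \<in> hyp H q" using RT(1) assms(6) by blast
  ultimately show ?thesis
    using multiplicity_char(2)[OF assms(3,5) _ V_isoD(4)[OF assms(1) RT(2)], of "F R" ?k]
      V_iso_card_edges[OF assms(1-3)] by simp
qed

lemma V_iso_mult:
  fixes F :: "('e, 'k::field_char_0) sqfree \<Rightarrow> ('f, 'k) sqfree"
  assumes "V_iso G H F" "loopless_multigraph G" "loopless_multigraph H" "p \<in> pairs G" "q \<in> pairs H"
    "F ` hyp G p = hyp H q"
  shows "card (par G p) = card (par H q)"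
  using V_iso_mult_le[OF assms]
    V_iso_mult_le[OF V_iso_inv[OF assms(1)] assms(3,2,5,4) V_iso_inv_hyp[OF assms(1,6)]]
  by linarith

lemma V_iso_hyp_inter:
  fixes F :: "('e, 'k::field_char_0) sqfree \<Rightarrow> ('f, 'k) sqfree"
  assumes "V_iso G H F" "F ` hyp G p = hyp H p'" "F ` hyp G q = hyp H q'" "F ` hyp G r = hyp H r'"
  shows "hyp H p' \<inter> hyp H q' \<subseteq> (hyp H r' :: ('f, 'k) sqfree set)
       \<longleftrightarrow> hyp G p \<inter> hyp G q \<subseteq> (hyp G r :: ('e, 'k) sqfree set)"
proof -
  note inj = bij_betw_imp_inj_on[OF V_isoD(1)[OF assms(1)]]
  have sub: "hyp G p \<inter> hyp G q \<subseteq> (range (comb G) :: ('e, 'k) sqfree set)" using hyp_subset by blast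
  have "hyp H p' \<inter> hyp H q' = F ` (hyp G p \<inter> hyp G q)"
    unfolding assms(2,3)[symmetric] by (rule inj_on_image_Int[OF inj hyp_subset hyp_subset, symmetric])
  moreover have "F ` (hyp G p \<inter> hyp G q) \<subseteq> F ` hyp G r
      \<longleftrightarrow> hyp G p \<inter> hyp G q \<subseteq> (hyp G r :: ('e, 'k) sqfree set)"
  proof
    assume img: "F ` (hyp G p \<inter> hyp G q) \<subseteq> F ` hyp G r"
    show "hyp G p \<inter> hyp G q \<subseteq> (hyp G r :: ('e, 'k) sqfree set)"
    proof
      fix u :: "('e, 'k) sqfree" assume u: "u \<in> hyp G p \<inter> hyp G q"
      then have "F u \<in> F ` hyp G r" using img by blast
      then show "u \<in> hyp G r" using inj_on_image_mem_iff[OF inj subsetD[OF sub u] hyp_subset] by blast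
    qed
  qed (rule image_mono)
  ultimately show ?thesis unfolding assms(4)[symmetric] by simp
qed

text \<open>If a third hyperplane contains the intersection, the same holds for the images, and this
  alone forces a common vertex. Otherwise no third hyperplane does so in \<open>H\<close> either,
  and the product criterion is available on both sides.\<close>

lemma V_iso_adjacent:
  fixes F :: "('e, 'k::field_char_0) sqfree \<Rightarrow> ('f, 'k) sqfree"
  assumes "V_iso G H F" "loopless_multigraph G" "loopless_multigraph H"
    and \<sigma>: "bij_betw \<sigma> (pairs G) (pairs H)" "\<And>p. p \<in> pairs G \<Longrightarrow> F ` hyp G p = hyp H (\<sigma> p)"
    and pq: "p \<in> pairs G" "q \<in> pairs G" "p \<noteq> q" "p \<inter> q \<noteq> {}"
  shows "\<sigma> p \<inter> \<sigma> q \<noteq> {}"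
proof -
  have mem: "\<sigma> r \<in> pairs H" if "r \<in> pairs G" for r using \<sigma>(1) that by (rule bij_betw_apply)
  have inj: "\<sigma> r \<noteq> \<sigma> s" if "r \<in> pairs G" "s \<in> pairs G" "r \<noteq> s" for r s
    using \<sigma>(1) that by (auto simp: bij_betw_def inj_on_def)
  show ?thesis
  proof (cases "\<exists>r\<in>pairs G. r \<noteq> p \<and> r \<noteq> q \<and> hyp G p \<inter> hyp G q \<subseteq> (hyp G r :: ('e, 'k) sqfree set)")
    case True
    then obtain r where r: "r \<in> pairs G" "r \<noteq> p" "r \<noteq> q"
      "hyp G p \<inter> hyp G q \<subseteq> (hyp G r :: ('e, 'k) sqfree set)" by blast
    then have "hyp H (\<sigma> p) \<inter> hyp H (\<sigma> q) \<subseteq> (hyp H (\<sigma> r) :: ('f, 'k) sqfree set)"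
      using V_iso_hyp_inter[OF assms(1) \<sigma>(2)[OF pq(1)] \<sigma>(2)[OF pq(2)] \<sigma>(2)[OF r(1)]] by blast
    then show ?thesis
      using hyp_inter_subset_iff[OF assms(3) mem[OF pq(1)] mem[OF pq(2)] mem[OF r(1)]
          inj[OF r(1) pq(1) r(2)] inj[OF r(1) pq(2) r(3)]] by blast
  next
    case False
    have none: "\<not> hyp H (\<sigma> p) \<inter> hyp H (\<sigma> q) \<subseteq> (hyp H s :: ('f, 'k) sqfree set)"
      if s: "s \<in> pairs H" "s \<noteq> \<sigma> p" "s \<noteq> \<sigma> q" for s
    proof -
      obtain r where r: "r \<in> pairs G" "s = \<sigma> r" using \<sigma>(1) s(1) by (auto simp: bij_betw_def)
      then have "r \<noteq> p" "r \<noteq> q" using s by auto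
      then have "\<not> hyp G p \<inter> hyp G q \<subseteq> (hyp G r :: ('e, 'k) sqfree set)" using False r(1) by blast
      then show ?thesis
        unfolding r(2) using V_iso_hyp_inter[OF assms(1) \<sigma>(2)[OF pq(1)] \<sigma>(2)[OF pq(2)] \<sigma>(2)[OF r(1)]] by blast
    qed
    let ?i = "card (edges G) + 1 - card (par G p) - card (par G q)"
    let ?j = "card (par G p) - 1"
    let ?k = "card (par G q) - 1"
    have "\<exists>R\<in>hyp G p \<inter> hyp G q. \<exists>S\<in>hyp G q. \<exists>T\<in>hyp G p. R ^ ?i * (S ^ ?j * T ^ ?k) \<noteq> (0 :: ('e, 'k) sqfree)"
      using adjacency_char[OF assms(2) pq(1-3), where 'k = 'k] False pq(4) by blast
    then obtain R S T :: "('e, 'k) sqfree" where RST: "R \<in> hyp G p" "R \<in> hyp G q" "S \<in> hyp G q" "T \<in> hyp G p"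
      "R ^ ?i * (S ^ ?j * T ^ ?k) \<noteq> 0" by blast
    have "F R ^ ?i * (F S ^ ?j * F T ^ ?k) \<noteq> 0"
      using V_isoD(3)[OF assms(1) subsetD[OF hyp_subset RST(1)] subsetD[OF hyp_subset RST(3)]
          subsetD[OF hyp_subset RST(4)], of ?i ?j ?k] RST(5) by blast
    moreover have "F R \<in> hyp H (\<sigma> p) \<inter> hyp H (\<sigma> q)" "F S \<in> hyp H (\<sigma> q)" "F T \<in> hyp H (\<sigma> p)"
      using RST(1-4) \<sigma>(2)[OF pq(1)] \<sigma>(2)[OF pq(2)] by blast+
    \<comment> \<open>The exponents of the criterion are formed from these numbers, so the criterion
      for \<open>H\<close> asks for exactly the transported product.\<close>
    moreover have "card (par H (\<sigma> p)) = card (par G p)" "card (par H (\<sigma> q)) = card (par G q)"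
      "card (edges H) = card (edges G)"
      using V_iso_mult[OF assms(1-3) pq(1) mem[OF pq(1)] \<sigma>(2)[OF pq(1)]]
        V_iso_mult[OF assms(1-3) pq(2) mem[OF pq(2)] \<sigma>(2)[OF pq(2)]]
        V_iso_card_edges[OF assms(1-3)] by simp_all
    ultimately have "\<exists>R\<in>hyp H (\<sigma> p) \<inter> hyp H (\<sigma> q). \<exists>S\<in>hyp H (\<sigma> q). \<exists>T\<in>hyp H (\<sigma> p).
        R ^ (card (edges H) + 1 - card (par H (\<sigma> p)) - card (par H (\<sigma> q)))
          * (S ^ (card (par H (\<sigma> p)) - 1) * T ^ (card (par H (\<sigma> q)) - 1)) \<noteq> (0 :: ('f, 'k) sqfree)"
      by (auto simp del: One_nat_def)
    then show ?thesis
      using adjacency_char[OF assms(3) mem[OF pq(1)] mem[OF pq(2)] inj[OF pq(1-3)] none] by blast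
  qed
qed

lemma V_iso_line_iso:
  fixes F :: "('e, 'k::field_char_0) sqfree \<Rightarrow> ('f, 'k) sqfree"
  assumes "V_iso G H F" "loopless_multigraph G" "loopless_multigraph H"
    and \<sigma>: "bij_betw \<sigma> (pairs G) (pairs H)" "\<And>p. p \<in> pairs G \<Longrightarrow> F ` hyp G p = hyp H (\<sigma> p)"
  shows "line_iso (pairs G) (pairs H) \<sigma>"
proof -
  let ?J = "inv_into (range (comb G)) F" and ?\<tau> = "inv_into (pairs G) \<sigma>"
  have mem: "\<sigma> r \<in> pairs H" if "r \<in> pairs G" for r using \<sigma>(1) that by (rule bij_betw_apply)
  have inj: "\<sigma> r \<noteq> \<sigma> s" if "r \<in> pairs G" "s \<in> pairs G" "r \<noteq> s" for r s
    using \<sigma>(1) that by (auto simp: bij_betw_def inj_on_def)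
  have \<tau>: "?J ` hyp H q = hyp G (?\<tau> q)" if q: "q \<in> pairs H" for q
  proof -
    have "F ` hyp G (?\<tau> q) = hyp H q"
      using \<sigma>(2)[OF bij_betw_apply[OF bij_betw_inv_into[OF \<sigma>(1)] q]] bij_betw_inv_into_right[OF \<sigma>(1) q] by simp
    then show ?thesis by (rule V_iso_inv_hyp[OF assms(1)])
  qed
  have adj: "\<sigma> p \<inter> \<sigma> q \<noteq> {} \<longleftrightarrow> p \<inter> q \<noteq> {}" if pq: "p \<in> pairs G" "q \<in> pairs G" "p \<noteq> q" for p q
  proof
    show "\<sigma> p \<inter> \<sigma> q \<noteq> {}" if "p \<inter> q \<noteq> {}"
      using V_iso_adjacent[OF assms(1-3) \<sigma> pq that] .
    show "p \<inter> q \<noteq> {}" if "\<sigma> p \<inter> \<sigma> q \<noteq> {}"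
      using V_iso_adjacent[OF V_iso_inv[OF assms(1)] assms(3,2) bij_betw_inv_into[OF \<sigma>(1)] \<tau>
          mem[OF pq(1)] mem[OF pq(2)] inj[OF pq] that]
        bij_betw_inv_into_left[OF \<sigma>(1)] pq by simp
  qed
  \<comment> \<open>A third hyperplane containing the intersection of two others is the intrinsic
    form of a triangle.\<close>
  have tri: "\<sigma> r = (\<sigma> p \<union> \<sigma> q) - (\<sigma> p \<inter> \<sigma> q) \<longleftrightarrow> r = (p \<union> q) - (p \<inter> q)"
    if pqr: "p \<in> pairs G" "q \<in> pairs G" "r \<in> pairs G" "p \<inter> q \<noteq> {}" "p \<noteq> q" "r \<noteq> p" "r \<noteq> q" for p q r
    using hyp_inter_subset_iff[OF assms(2) pqr(1-3) pqr(6,7), where 'k = 'k]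
      hyp_inter_subset_iff[OF assms(3) mem[OF pqr(1)] mem[OF pqr(2)] mem[OF pqr(3)]
        inj[OF pqr(3,1,6)] inj[OF pqr(3,2,7)], where 'k = 'k]
      V_iso_hyp_inter[OF assms(1) \<sigma>(2)[OF pqr(1)] \<sigma>(2)[OF pqr(2)] \<sigma>(2)[OF pqr(3)]]
      adj[OF pqr(1,2,5)] pqr(4) by blast
  show ?thesis
    unfolding line_iso_def
    using \<sigma>(1) pairs_card(1)[OF assms(2)] pairs_card(1)[OF assms(3)] adj tri by simp
qed

section \<open>From pairs back to vertices\<close>

lemma edge_count_eq: "edge_count G i j = card (par G {i, j})"
  by (simp add: edge_count_def par_def)

text \<open>The bijection reconstructed from pairs is defined on covered vertices only. An isolated
  vertex has \<open>Y\<^sub>i\<close> equal to 1 and leaves no trace in the algebra, which is why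
  such vertices are excluded.\<close>

lemma Union_pairs:
  assumes "loopless_multigraph G" "\<nexists>i. isolated G i"
  shows "\<Union>(pairs G) = vertices G"
proof
  show "\<Union>(pairs G) \<subseteq> vertices G" using pairs_card(2)[OF assms(1)] by blast
  show "vertices G \<subseteq> \<Union>(pairs G)"
  proof
    fix i assume "i \<in> vertices G"
    then obtain e where "e \<in> edges G" "i \<in> ends G e" using assms(2) unfolding isolated_def by blast
    then show "i \<in> \<Union>(pairs G)" unfolding pairs_def by blast
  qed
qed

lemma par_empty: "p \<notin> pairs G \<Longrightarrow> par G p = {}"
  by (auto simp: par_def pairs_def)

lemma V_iso_imp_graph_isomorphic:
  fixes F :: "('e, 'k::field_char_0) sqfree \<Rightarrow> ('f, 'k) sqfree"
  assumes "V_iso G H F" "loopless_multigraph G" "loopless_multigraph H"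
    "\<nexists>i. isolated G i" "\<nexists>i. isolated H i"
  shows "graph_isomorphic G H"
proof -
  obtain \<sigma> where \<sigma>: "bij_betw \<sigma> (pairs G) (pairs H)" "\<And>p. p \<in> pairs G \<Longrightarrow> F ` hyp G p = hyp H (\<sigma> p)"
    using V_iso_pairs_bij[OF assms(1-3)] by blast
  obtain \<pi> where \<pi>: "bij_betw \<pi> (vertices G) (vertices H)" "\<And>p. p \<in> pairs G \<Longrightarrow> \<sigma> p = \<pi> ` p"
    using line_iso_induced[OF V_iso_line_iso[OF assms(1-3) \<sigma>]]
    unfolding Union_pairs[OF assms(2,4)] Union_pairs[OF assms(3,5)] by blast
  have "card (par H {\<pi> i, \<pi> j}) = card (par G {i, j})" if ij: "i \<in> vertices G" "j \<in> vertices G" for i j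
  proof (cases "{i, j} \<in> pairs G")
    case True
    then have "{\<pi> i, \<pi> j} = \<sigma> {i, j}" using \<pi>(2) by simp
    then show ?thesis
      using V_iso_mult[OF assms(1-3) True bij_betw_apply[OF \<sigma>(1) True] \<sigma>(2)[OF True]] by simp
  next
    case False
    \<comment> \<open>This includes \<open>i = j\<close>, where the set has one element and is not a
      pair.\<close>
    have "{\<pi> i, \<pi> j} \<notin> pairs H"
    proof
      assume "{\<pi> i, \<pi> j} \<in> pairs H"
      then have "{\<pi> i, \<pi> j} \<in> \<sigma> ` pairs G" using \<sigma>(1) by (simp add: bij_betw_def)
      then obtain r where r: "r \<in> pairs G" "{\<pi> i, \<pi> j} = \<sigma> r" by blast
      then obtain p where p: "p \<in> pairs G" "\<pi> ` p = \<pi> ` {i, j}" using \<pi>(2)[OF r(1)] by auto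
      then have "p = {i, j}"
        using inj_on_image_eq_iff[OF bij_betw_imp_inj_on[OF \<pi>(1)] pairs_card(2)[OF assms(2) p(1)], of "{i, j}"]
          p(2) ij by simp
      then show False using False p by simp
    qed
    then show ?thesis using False by (simp add: par_empty)
  qed
  then show ?thesis unfolding graph_isomorphic_def edge_count_eq using \<pi>(1) by blast
qed

section \<open>From graph isomorphisms to filtered isomorphisms\<close>

text \<open>The homomorphism taking \<open>gen e\<close> to \<open>s e\<close> times
  \<open>gen (\<sigma> e)\<close>, written on coefficients by pulling edge sets back. Pulling back
  ignores elements outside \<open>E'\<close>, so sets not contained in \<open>E'\<close> must be
  given coefficient 0 explicitly.\<close>

lift_definition relabel :: "'e set \<Rightarrow> 'f set \<Rightarrow> ('e \<Rightarrow> 'f) \<Rightarrow> ('e \<Rightarrow> 'k) \<Rightarrow> ('e, 'k::field) sqfree \<Rightarrow> ('f, 'k) sqfree"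
  is "\<lambda>E E' \<sigma> s x S. if finite S \<and> S \<subseteq> E' then (\<Prod>e\<in>{e \<in> E. \<sigma> e \<in> S}. s e) * x {e \<in> E. \<sigma> e \<in> S} else 0"
  by simp

lemma relabel_linear:
  "relabel E E' \<sigma> s (x + y) = relabel E E' \<sigma> s x + relabel E E' \<sigma> s y"
  "relabel E E' \<sigma> s (scalar c * x) = scalar c * relabel E E' \<sigma> s x"
  by (rule sqfree_eqI, simp add: relabel.rep_eq distrib_left mult.left_commute)+

context
  fixes E :: "'e set" and E' :: "'f set" and \<sigma> :: "'e \<Rightarrow> 'f" and s :: "'e \<Rightarrow> 'k::field"
  assumes bij: "bij_betw \<sigma> E E'"
begin

lemma preimage_eq_iff:
  assumes "S \<subseteq> E'" "A \<subseteq> E"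
  shows "{e \<in> E. \<sigma> e \<in> S} = A \<longleftrightarrow> S = \<sigma> ` A"
proof
  assume "{e \<in> E. \<sigma> e \<in> S} = A"
  moreover have "S = \<sigma> ` {e \<in> E. \<sigma> e \<in> S}" using assms(1) bij by (auto simp: bij_betw_def)
  ultimately show "S = \<sigma> ` A" by simp
next
  assume "S = \<sigma> ` A"
  then show "{e \<in> E. \<sigma> e \<in> S} = A"
    using assms(2) bij by (auto simp: bij_betw_def inj_on_def)
qed

lemma relabel_one: "relabel E E' \<sigma> s 1 = 1"
proof (rule sqfree_eqI)
  fix S :: "'f set" assume "finite S"
  then show "coeff (relabel E E' \<sigma> s 1) S = coeff 1 S"
    using preimage_eq_iff[of S "{}"] by (auto simp: relabel.rep_eq coeff_one)
qed

lemma relabel_gen: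
  assumes "e \<in> E"
  shows "relabel E E' \<sigma> s (gen e) = scalar (s e) * gen (\<sigma> e)"
proof (rule sqfree_eqI)
  fix S :: "'f set" assume S: "finite S"
  have "\<sigma> e \<in> E'" using bij assms by (rule bij_betw_apply)
  then show "coeff (relabel E E' \<sigma> s (gen e)) S = coeff (scalar (s e) * gen (\<sigma> e)) S"
    using S assms preimage_eq_iff[of S "{e}"] by (auto simp: relabel.rep_eq gen.rep_eq)
qed

text \<open>The bijection matches the decompositions of \<open>S\<close> into two parts with those
  of its preimage, and the product of the factors \<open>s e\<close> splits accordingly.\<close>

lemma relabel_mult: "relabel E E' \<sigma> s (x * y) = relabel E E' \<sigma> s x * relabel E E' \<sigma> s y"
proof (rule sqfree_eqI)
  fix S :: "'f set" assume S: "finite S"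
  define T where "T S = {e \<in> E. \<sigma> e \<in> S}" for S
  have rel: "coeff (relabel E E' \<sigma> s z) B = (if finite B \<and> B \<subseteq> E' then (\<Prod>e\<in>T B. s e) * coeff z (T B) else 0)"
    for z B by (simp add: relabel.rep_eq T_def)
  show "coeff (relabel E E' \<sigma> s (x * y)) S = coeff (relabel E E' \<sigma> s x * relabel E E' \<sigma> s y) S"
  proof (cases "S \<subseteq> E'")
    case False
    then have "coeff (relabel E E' \<sigma> s x) B * coeff (relabel E E' \<sigma> s y) (S - B) = 0" if "B \<subseteq> S" for B
      using that by (auto simp: rel)
    then have "coeff (relabel E E' \<sigma> s x * relabel E E' \<sigma> s y) S = 0"
      unfolding coeff_mult by (intro sum.neutral) blast
    then show ?thesis using False by (simp add: rel)
  next
    case True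
    have "S = \<sigma> ` T S" using True bij by (auto simp: bij_betw_def T_def)
    moreover have "inj_on \<sigma> (T S)" using bij by (auto simp: bij_betw_def inj_on_def T_def)
    ultimately have finT: "finite (T S)" using S finite_imageD by metis
    have "coeff (relabel E E' \<sigma> s (x * y)) S = (\<Sum>A\<in>Pow (T S). (\<Prod>e\<in>T S. s e) * (coeff x A * coeff y (T S - A)))"
      using S True by (simp add: rel coeff_mult sum_distrib_left)
    also have "\<dots> = (\<Sum>B\<in>Pow S. coeff (relabel E E' \<sigma> s x) B * coeff (relabel E E' \<sigma> s y) (S - B))"
    proof (rule sum.reindex_bij_witness[where i = T and j = "image \<sigma>"])
      fix A assume "A \<in> Pow (T S)"
      then have A: "A \<subseteq> E" "A \<subseteq> T S" by (auto simp: T_def)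
      then have sub: "\<sigma> ` A \<subseteq> S" by (auto simp: T_def)
      then have subE: "\<sigma> ` A \<subseteq> E'" "S - \<sigma> ` A \<subseteq> E'" using True by auto
      show T1: "T (\<sigma> ` A) = A" using preimage_eq_iff[OF subE(1) A(1)] by (simp add: T_def)
      show "\<sigma> ` A \<in> Pow S" using sub by blast
      have T2: "T (S - \<sigma> ` A) = T S - A" using T1 by (auto simp: T_def)
      have "(\<Prod>e\<in>T S. s e) = (\<Prod>e\<in>T S - A. s e) * (\<Prod>e\<in>A. s e)"
        using A finT by (intro prod.subset_diff)
      then show "coeff (relabel E E' \<sigma> s x) (\<sigma> ` A) * coeff (relabel E E' \<sigma> s y) (S - \<sigma> ` A)
          = (\<Prod>e\<in>T S. s e) * (coeff x A * coeff y (T S - A))"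
        using S sub subE finite_subset[OF sub S] by (simp add: rel T1 T2)
    next
      fix B assume "B \<in> Pow S"
      then show "T B \<in> Pow (T S)" "\<sigma> ` T B = B" using True bij by (auto simp: T_def bij_betw_def)
    qed
    finally show ?thesis unfolding coeff_mult .
  qed
qed

lemma relabel_prod: "relabel E E' \<sigma> s (\<Prod>i\<in>I. x i) = (\<Prod>i\<in>I. relabel E E' \<sigma> s (x i))"
  by (induction I rule: infinite_finite_induct) (simp_all add: relabel_one relabel_mult)

end

text \<open>Parallel classes of equal size are matched by arbitrary bijections, and these are glued
  because the classes partition the edges. The choice within a class is harmless, as parallel edges
  have the same incidence signs.\<close>

lemma exists_edge_bijection:
  assumes "loopless_multigraph G" "loopless_multigraph H"
    and \<pi>: "bij_betw \<pi> (vertices G) (vertices H)"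
    and count: "\<And>i j. i \<in> vertices G \<Longrightarrow> j \<in> vertices G \<Longrightarrow> edge_count H (\<pi> i) (\<pi> j) = edge_count G i j"
  shows "\<exists>\<sigma>. bij_betw \<sigma> (edges G) (edges H) \<and> (\<forall>e\<in>edges G. ends H (\<sigma> e) = \<pi> ` ends G e)"
proof -
  have "card (par G p) = card (par H (\<pi> ` p))" if p: "p \<in> pairs G" for p
  proof -
    obtain i j where ij: "p = {i, j}" "i \<in> vertices G" "j \<in> vertices G"
      using pairs_card[OF assms(1) p] by (auto simp: card_2_iff)
    then show ?thesis using count[OF ij(2,3)] by (simp add: edge_count_def par_def)
  qed
  then have "\<exists>g. bij_betw g (par G p) (par H (\<pi> ` p))" if "p \<in> pairs G" for p
    using that assms(1,2) by (intro finite_same_card_bij finite_par loopless_finite)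
  then obtain g where g: "\<And>p. p \<in> pairs G \<Longrightarrow> bij_betw (g p) (par G p) (par H (\<pi> ` p))" by metis
  define \<sigma> where "\<sigma> e = g (ends G e) e" for e
  have \<sigma>: "\<sigma> e \<in> edges H" "ends H (\<sigma> e) = \<pi> ` ends G e" if e: "e \<in> edges G" for e
    using bij_betw_apply[OF g[of "ends G e"], of e] e by (auto simp: \<sigma>_def par_def pairs_def)
  have img_inj: "p = q" if "p \<subseteq> vertices G" "q \<subseteq> vertices G" "\<pi> ` p = \<pi> ` q" for p q
    using inj_on_image_eq_iff[OF bij_betw_imp_inj_on[OF \<pi>] that(1,2)] that(3) by simp
  have sub: "ends G e \<subseteq> vertices G" if "e \<in> edges G" for e
    using assms(1) that by (simp add: loopless_multigraph_def)
  have "inj_on \<sigma> (edges G)"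
  proof (rule inj_onI)
    fix e f assume ef: "e \<in> edges G" "f \<in> edges G" "\<sigma> e = \<sigma> f"
    then have "\<pi> ` ends G e = \<pi> ` ends G f" using \<sigma>(2) by metis
    then have eq: "ends G e = ends G f" using img_inj sub ef by blast
    then have "g (ends G e) e = g (ends G e) f" using ef(3) by (simp add: \<sigma>_def)
    moreover have "inj_on (g (ends G e)) (par G (ends G e))"
      using g[of "ends G e"] ef(1) by (auto simp: bij_betw_def pairs_def)
    ultimately show "e = f" using ef eq by (auto simp: inj_on_def par_def)
  qed
  moreover have "edges H \<subseteq> \<sigma> ` edges G"
  proof
    fix f assume f: "f \<in> edges H"
    obtain u v where uv: "ends H f = {u, v}" "u \<in> vertices H" "v \<in> vertices H"
      using edge_ends[OF assms(2) f] by metis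
    have "u \<in> \<pi> ` vertices G" "v \<in> \<pi> ` vertices G" using uv \<pi> by (simp_all add: bij_betw_def)
    then obtain i j where ij: "i \<in> vertices G" "j \<in> vertices G" "u = \<pi> i" "v = \<pi> j" by blast
    have "f \<in> par H {u, v}" using f uv by (simp add: par_def)
    then have "card (par H {u, v}) \<noteq> 0" using finite_par[OF loopless_finite[OF assms(2)]] by auto
    then have "card (par G {i, j}) \<noteq> 0" using count[OF ij(1,2)] ij by (simp add: edge_count_def par_def)
    then obtain e where e: "e \<in> par G {i, j}" by fastforce
    then have p: "{i, j} \<in> pairs G" by (auto simp: pairs_def par_def)
    have "f \<in> g {i, j} ` par G {i, j}" using g[OF p] \<open>f \<in> par H {u, v}\<close> ij by (simp add: bij_betw_def)
    then obtain d where d: "d \<in> edges G" "ends G d = {i, j}" "f = g {i, j} d" by (auto simp: par_def)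
    then have "f = \<sigma> d" by (simp add: \<sigma>_def)
    then show "f \<in> \<sigma> ` edges G" using d(1) by blast
  qed
  ultimately have "bij_betw \<sigma> (edges G) (edges H)" using \<sigma>(1) by (auto simp: bij_betw_def)
  then show ?thesis using \<sigma>(2) by blast
qed

text \<open>The incidence signs depend on the vertex order, so an edge whose ends are exchanged by
  \<open>\<pi>\<close> has its generator negated.\<close>

lemma exists_expX_hom:
  fixes G :: "'e mgraph" and H :: "'f mgraph"
  assumes "loopless_multigraph G" "loopless_multigraph H"
    and \<pi>: "bij_betw \<pi> (vertices G) (vertices H)"
    and count: "\<And>i j. i \<in> vertices G \<Longrightarrow> j \<in> vertices G \<Longrightarrow> edge_count H (\<pi> i) (\<pi> j) = edge_count G i j"
  shows "\<exists>F :: ('e, 'k::field_char_0) sqfree \<Rightarrow> ('f, 'k) sqfree. F 1 = 1 \<and> (\<forall>x y. F (x + y) = F x + F y)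
     \<and> (\<forall>x y. F (x * y) = F x * F y) \<and> (\<forall>c x. F (scalar c * x) = scalar c * F x)
     \<and> (\<forall>i\<in>vertices G. F (expX G i) = expX H (\<pi> i))"
proof -
  obtain \<sigma> where \<sigma>: "bij_betw \<sigma> (edges G) (edges H)" "\<And>e. e \<in> edges G \<Longrightarrow> ends H (\<sigma> e) = \<pi> ` ends G e"
    using exists_edge_bijection[OF assms] by blast
  have "\<exists>s::'k. \<forall>i\<in>vertices G. incidence H (\<pi> i) (\<sigma> e) = s * incidence G i e" if e: "e \<in> edges G" for e
  proof -
    obtain i j where ij: "i < j" "ends G e = {i, j}" "i \<in> vertices G" "j \<in> vertices G"
      by (rule edge_ends[OF assms(1) e])
    have inj: "\<pi> u = \<pi> v \<longleftrightarrow> u = v" if "u \<in> vertices G" "v \<in> vertices G" for u v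
      using \<pi> that by (auto simp: bij_betw_def inj_on_def)
    have endsH: "ends H (\<sigma> e) = {\<pi> i, \<pi> j}" using \<sigma>(2)[OF e] ij(2) by simp
    show ?thesis
    proof (cases "\<pi> i < \<pi> j")
      case True
      have "incidence H (\<pi> v) (\<sigma> e) = 1 * (incidence G v e :: 'k)" if "v \<in> vertices G" for v
        unfolding incidence_eq[OF True endsH] incidence_eq[OF ij(1,2)] using inj that ij by simp
      then show ?thesis by blast
    next
      case False
      then have lt: "\<pi> j < \<pi> i" using inj[OF ij(3,4)] ij(1) by (metis less_irrefl linorder_neqE_nat)
      have "incidence H (\<pi> v) (\<sigma> e) = (- 1) * (incidence G v e :: 'k)" if "v \<in> vertices G" for v
        unfolding incidence_eq[OF lt endsH[unfolded insert_commute[of "\<pi> i"]]] incidence_eq[OF ij(1,2)]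
        using inj that ij by auto
      then show ?thesis by blast
    qed
  qed
  then obtain s :: "'e \<Rightarrow> 'k" where
    s: "\<And>e i. e \<in> edges G \<Longrightarrow> i \<in> vertices G \<Longrightarrow> incidence H (\<pi> i) (\<sigma> e) = s e * incidence G i e"
    by metis
  define F where "F = relabel (edges G) (edges H) \<sigma> s"
  have "F (expX G i) = expX H (\<pi> i)" if i: "i \<in> vertices G" for i
  proof -
    have "F (1 + scalar (incidence G i e) * gen e) = 1 + scalar (incidence H (\<pi> i) (\<sigma> e)) * gen (\<sigma> e)"
      if e: "e \<in> edges G" for e
      unfolding F_def relabel_linear relabel_one[OF \<sigma>(1)] relabel_gen[OF \<sigma>(1) e] s[OF e i]
      by (simp add: scalar_hom mult_ac)
    then have "F (expX G i) = (\<Prod>e\<in>edges G. 1 + scalar (incidence H (\<pi> i) (\<sigma> e)) * gen (\<sigma> e))"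
      unfolding expX_def F_def relabel_prod[OF \<sigma>(1)] by (intro prod.cong refl)
    also have "\<dots> = expX H (\<pi> i)" unfolding expX_def by (rule prod.reindex_bij_betw[OF \<sigma>(1)])
    finally show ?thesis .
  qed
  then show ?thesis
    using relabel_linear[of "edges G" "edges H" \<sigma> s] relabel_one[OF \<sigma>(1), of s]
      relabel_mult[OF \<sigma>(1), of s] unfolding F_def[symmetric] by (intro exI[of _ F]) simp
qed

section \<open>Compatibility with the subalgebra and the filtration\<close>

text \<open>A homomorphism taking each \<open>Y\<^sub>i\<close> to some \<open>Y\<^sub>j\<close>
  takes products to products of the same length. Only inclusions are claimed; equality comes from
  the map in the other direction.\<close>

lemma expX_hom_closed:
  fixes F :: "('e, 'k::field) sqfree \<Rightarrow> ('f, 'k) sqfree"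
  assumes fin: "finite (edges G)" "finite (edges H)"
    and F: "F 1 = 1" "\<And>x y. F (x + y) = F x + F y" "\<And>x y. F (x * y) = F x * F y"
      "\<And>c x. F (scalar c * x) = scalar c * F x"
    and "\<forall>i\<in>vertices G. \<pi> i \<in> vertices H \<and> F (expX G i) = expX H (\<pi> i)"
  shows "x \<in> K_real G \<Longrightarrow> F x \<in> K_real H" "x \<in> F_real G k \<Longrightarrow> F x \<in> F_real H k"
proof -
  have \<pi>: "\<pi> i \<in> vertices H" "F (expX G i) = expX H (\<pi> i)" if "i \<in> vertices G" for i
    using assms(7) that by blast+
  have Fs: "F (scalar c) = scalar c" for c using F(4)[of c 1] by (simp only: F(1) mult_1_right)
  show "F x \<in> K_real H" if "x \<in> K_real G"
    using fin(1) that
    by (induction rule: K_real_induct) (simp_all add: F Fs \<pi> K_real_closed[OF fin(2)])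
  have F0: "F 0 = 0" using F(4)[of 0 0] by (simp add: scalar_hom)
  have list: "F (\<Prod>i\<leftarrow>is. expX G i) = (\<Prod>i\<leftarrow>map \<pi> is. expX H i)" if "set is \<subseteq> vertices G" for "is"
    using that by (induction "is") (simp_all add: F \<pi>)
  show "F x \<in> F_real H k" if "x \<in> F_real G k"
    using fin(1) that
  proof (induction rule: F_real_induct)
    case (prod "is")
    have "(\<Prod>i\<leftarrow>map \<pi> is. expX H i :: ('f, 'k) sqfree) \<in> F_real H k"
      using prod \<pi>(1) by (intro F_real_closed(4)[OF fin(2)]) auto
    then show ?case unfolding list[OF prod(1)] .
  qed (simp_all add: F F0 Fs F_real_closed[OF fin(2)])
qed

lemma graph_isomorphic_imp_filtered_sqfree_iso:
  fixes G :: "'e mgraph" and H :: "'f mgraph"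
  assumes "loopless_multigraph G" "loopless_multigraph H" "graph_isomorphic G H"
  shows "\<exists>F :: ('e, 'k::field_char_0) sqfree \<Rightarrow> ('f, 'k) sqfree. filtered_sqfree_iso G H F"
proof -
  have fin: "finite (edges G)" "finite (edges H)" using assms(1,2) by (simp_all add: loopless_finite)
  obtain \<pi> where \<pi>: "bij_betw \<pi> (vertices G) (vertices H)"
    and count: "\<And>i j. i \<in> vertices G \<Longrightarrow> j \<in> vertices G \<Longrightarrow> edge_count H (\<pi> i) (\<pi> j) = edge_count G i j"
    using assms(3) unfolding graph_isomorphic_def by blast
  define \<rho> where "\<rho> = inv_into (vertices G) \<pi>"
  have \<rho>: "bij_betw \<rho> (vertices H) (vertices G)" unfolding \<rho>_def by (rule bij_betw_inv_into[OF \<pi>])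
  have \<pi>\<rho>: "\<pi> (\<rho> j) = j" if "j \<in> vertices H" for j
    unfolding \<rho>_def by (rule bij_betw_inv_into_right[OF \<pi> that])
  have \<rho>\<pi>: "\<rho> (\<pi> i) = i" if "i \<in> vertices G" for i
    unfolding \<rho>_def by (rule bij_betw_inv_into_left[OF \<pi> that])
  have \<rho>_mem: "\<rho> j \<in> vertices G" if "j \<in> vertices H" for j using \<rho> that by (rule bij_betw_apply)
  have \<pi>_mem: "\<pi> i \<in> vertices H" if "i \<in> vertices G" for i using \<pi> that by (rule bij_betw_apply)
  have count': "edge_count G (\<rho> i) (\<rho> j) = edge_count H i j" if "i \<in> vertices H" "j \<in> vertices H" for i j
    using count[OF \<rho>_mem[OF that(1)] \<rho>_mem[OF that(2)]] \<pi>\<rho> that by simp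
  obtain F :: "('e, 'k) sqfree \<Rightarrow> ('f, 'k) sqfree" where
    F: "F 1 = 1" "\<And>x y. F (x + y) = F x + F y" "\<And>x y. F (x * y) = F x * F y"
      "\<And>c x. F (scalar c * x) = scalar c * F x" "\<And>i. i \<in> vertices G \<Longrightarrow> F (expX G i) = expX H (\<pi> i)"
    using exists_expX_hom[OF assms(1,2) \<pi> count] by blast
  obtain J :: "('f, 'k) sqfree \<Rightarrow> ('e, 'k) sqfree" where
    J: "J 1 = 1" "\<And>x y. J (x + y) = J x + J y" "\<And>x y. J (x * y) = J x * J y"
      "\<And>c x. J (scalar c * x) = scalar c * J x" "\<And>i. i \<in> vertices H \<Longrightarrow> J (expX H i) = expX G (\<rho> i)"
    using exists_expX_hom[OF assms(2,1) \<rho> count'] by blast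
  have "\<forall>i\<in>vertices G. \<pi> i \<in> vertices H \<and> F (expX G i) = expX H (\<pi> i)" using \<pi>_mem F(5) by blast
  note Fc = expX_hom_closed[OF fin F(1-4) this]
  have "\<forall>i\<in>vertices H. \<rho> i \<in> vertices G \<and> J (expX H i) = expX G (\<rho> i)" using \<rho>_mem J(5) by blast
  note Jc = expX_hom_closed[OF fin(2,1) J(1-4) this]
  have Fs: "F (scalar c) = scalar c" for c using F(4)[of c 1] by (simp only: F(1) mult_1_right)
  have Js: "J (scalar c) = scalar c" for c using J(4)[of c 1] by (simp only: J(1) mult_1_right)
  \<comment> \<open>\<open>J\<close> comes from its own choice of edge bijection and need not invert
    \<open>F\<close> on the ambient algebra. On the subalgebra it does, because this can be checked
    on the elements \<open>expX G i\<close>.\<close>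
  have JF: "J (F x) = x" if "x \<in> K_real G" for x
    using fin(1) that by (induction rule: K_real_induct) (simp_all add: F J Fs Js \<pi>_mem \<rho>\<pi>)
  have FJ: "F (J x) = x" if "x \<in> K_real H" for x
    using fin(2) that by (induction rule: K_real_induct) (simp_all add: F J Fs Js \<rho>_mem \<pi>\<rho>)
  have bij: "bij_betw F (K_real G) (K_real H)"
    by (rule bij_betw_byWitness[where f' = J]) (use JF FJ Fc(1) Jc(1) in auto)
  have filt: "F ` F_real G k = F_real H k" for k
  proof
    show "F ` F_real G k \<subseteq> F_real H k" using Fc(2) by blast
    show "F_real H k \<subseteq> F ` F_real G k"
    proof
      fix y :: "('f, 'k) sqfree" assume y: "y \<in> F_real H k"
      then have "F (J y) = y" using FJ F_real_subset by blast
      then show "y \<in> F ` F_real G k" using Jc(2)[OF y] by (metis imageI)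
    qed
  qed
  have "filtered_sqfree_iso G H F"
    unfolding filtered_sqfree_iso_def by (intro conjI ballI allI bij filt F(1-4))
  then show ?thesis by (rule exI[of _ F])
qed

theorem theorem5:
  fixes G1 :: "'e1 mgraph" and G2 :: "'e2 mgraph"
  assumes "loopless_multigraph G1" and "loopless_multigraph G2"
    and "\<nexists>i. isolated G1 i" and "\<nexists>i. isolated G2 i"
  shows "filtered_isomorphic
           (K_alg G1 :: ('k::field_char_0, ('e1, 'k) mpoly set) module) (K_filt G1)
           (K_alg G2 :: ('k, ('e2, 'k) mpoly set) module) (K_filt G2)
         \<longleftrightarrow> graph_isomorphic G1 G2"
proof -
  have fin: "finite (edges G1)" "finite (edges G2)"
    using assms(1,2) by (simp_all add: loopless_finite)
  show ?thesis
    unfolding filtered_isomorphic_K_alg_iff[OF fin]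
  proof
    assume "\<exists>F :: ('e1, 'k) sqfree \<Rightarrow> ('e2, 'k) sqfree. filtered_sqfree_iso G1 G2 F"
    then obtain F :: "('e1, 'k) sqfree \<Rightarrow> ('e2, 'k) sqfree" where "filtered_sqfree_iso G1 G2 F"
      by blast
    then have "V_iso G1 G2 F" using fin by (rule filtered_sqfree_iso_imp_V_iso)
    then show "graph_isomorphic G1 G2" using assms by (rule V_iso_imp_graph_isomorphic)
  next
    assume "graph_isomorphic G1 G2"
    then show "\<exists>F :: ('e1, 'k) sqfree \<Rightarrow> ('e2, 'k) sqfree. filtered_sqfree_iso G1 G2 F"
      by (rule graph_isomorphic_imp_filtered_sqfree_iso[OF assms(1,2)])
  qed
qed

end
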